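(* Let $n\ge2$, $0<p<\infty$, $N\in\mathbb{N}=\{1,2,\dots\}$ and $\alpha\in\mathbb{R}$. Then every $u\in\mathrm{PH}^p_{N,\alpha}(\mathbb{B})$ has a unique decomposition $$u=\sum_{j=0}^{N-1}\mathbf{M}^j[w_j]$$ with each term $\mathbf{M}^j[w_j]$ being in $\mathrm{PH}^p_{N,\alpha}(\mathbb{B})$, where the function $w_j$ is $(N-j)$-harmonic and solves $\mathbf{L}_{N-j-1}[w_j]=0$ on $\mathbb{B}$, for $j=0,\dots,N-1$.
   Context: $\mathbb{B}$ is the open unit ball of $\mathbb{R}^n$. A function $u:\mathbb{B}\to\mathbb{C}$ is $N$-harmonic if it is $2N$ times continuously differentiable and $\Delta^N u=0$ in $\mathbb{B}$. $\mathrm{PH}^p_{N,\alpha}(\mathbb{B})$ is the set of $N$-harmonic functions $u$ on $\mathbb{B}$ with $\int_{\mathbb{B}}|u(x)|^p[\mathrm{dist}(x,\partial\mathbb{B})]^\alpha dV(x)<\infty$, where $dV$ is Lebesgue measure. $\mathbf{M}^j[w](x):=(1-|x|^2)^j w(x)$ for $x\in\mathbb{B}$. For $\theta\in\mathbb{R}$, $\mathbf{L}_\theta[u](x):=(1-|x|^2)\Delta u(x)+4\theta\,\mathbf{R}[u](x)+2\theta(n-2-2\theta)u(x)$, where $\mathbf{R}[u](x):=x\cdot\nabla u(x)$. *)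

theory Defs
  imports "HOL-Analysis.Analysis"
begin

text \<open>
  Functions on the unit ball are represented by total functions. All derivatives below are taken
  at points of the open ball, so they depend only on the values on the ball.
\<close>

definition partial_deriv ::
    "'a::euclidean_space \<Rightarrow> ('a \<Rightarrow> complex) \<Rightarrow> 'a \<Rightarrow> complex"
  where "partial_deriv b u x = frechet_derivative u (at x) b"

primrec C_k_on :: "nat \<Rightarrow> 'a::euclidean_space set \<Rightarrow> ('a \<Rightarrow> complex) \<Rightarrow> bool"
  where
    "C_k_on 0 S u \<longleftrightarrow> continuous_on S u"
  | "C_k_on (Suc k) S u \<longleftrightarrow>
       (\<forall>x\<in>S. u differentiable (at x)) \<and> (\<forall>b\<in>Basis. C_k_on k S (partial_deriv b u))"

definition laplacian :: "('a::euclidean_space \<Rightarrow> complex) \<Rightarrow> 'a \<Rightarrow> complex"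
  where "laplacian u x = (\<Sum>b\<in>Basis. partial_deriv b (partial_deriv b u) x)"

definition N_harmonic :: "nat \<Rightarrow> ('a::euclidean_space \<Rightarrow> complex) \<Rightarrow> bool"
  where "N_harmonic N u \<longleftrightarrow>
    C_k_on (2 * N) (ball 0 1) u \<and> (\<forall>x\<in>ball 0 1. (laplacian ^^ N) u x = 0)"

definition PH :: "nat \<Rightarrow> real \<Rightarrow> real \<Rightarrow> ('a::euclidean_space \<Rightarrow> complex) set"
  where "PH N p \<alpha> = {u. N_harmonic N u \<and>
    (\<integral>\<^sup>+x\<in>ball 0 1. ennreal (norm (u x) powr p * infdist x (frontier (ball 0 1)) powr \<alpha>) \<partial>lborel)
      < \<infinity>}"

definition M_op :: "nat \<Rightarrow> ('a::euclidean_space \<Rightarrow> complex) \<Rightarrow> 'a \<Rightarrow> complex"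
  where "M_op j w x = (1 - (norm x)\<^sup>2) ^ j *\<^sub>R w x"

definition R_op :: "('a::euclidean_space \<Rightarrow> complex) \<Rightarrow> 'a \<Rightarrow> complex"
  where "R_op u x = (\<Sum>b\<in>Basis. (x \<bullet> b) *\<^sub>R partial_deriv b u x)"

definition L_op :: "real \<Rightarrow> ('a::euclidean_space \<Rightarrow> complex) \<Rightarrow> 'a \<Rightarrow> complex"
  where "L_op \<theta> u x =
    (1 - (norm x)\<^sup>2) *\<^sub>R laplacian u x + (4 * \<theta>) *\<^sub>R R_op u x
      + (2 * \<theta> * (real DIM('a) - 2 - 2 * \<theta>)) *\<^sub>R u x"

definition cellular_decomposition ::
    "nat \<Rightarrow> real \<Rightarrow> real \<Rightarrow> ('a::euclidean_space \<Rightarrow> complex)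
      \<Rightarrow> (nat \<Rightarrow> 'a \<Rightarrow> complex) \<Rightarrow> bool"
  where "cellular_decomposition N p \<alpha> u w \<longleftrightarrow>
    (\<forall>x\<in>ball 0 1. u x = (\<Sum>j<N. M_op j (w j) x)) \<and>
    (\<forall>j<N. M_op j (w j) \<in> PH N p \<alpha> \<and> N_harmonic (N - j) (w j) \<and>
       (\<forall>x\<in>ball 0 1. L_op (real N - real j - 1) (w j) x = 0))"

end

theory Submission
  imports Defs
begin

text \<open>
  Write \<open>\<rho> x = 1 - (norm x)\<^sup>2\<close>. The operators satisfy
  \<open>L\<^sub>\<theta> M\<^sup>j = M\<^sup>j L\<^sub>\<theta>\<^sub>-\<^sub>j + 4 j (j - 1 - 2 \<theta>) M\<^sup>j\<^sup>-\<^sup>1\<close>, and \<open>L\<^sub>N\<^sub>-\<^sub>1\<close> maps \<open>N\<close>-harmonic functions to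
  \<open>(N - 1)\<close>-harmonic ones. Hence \<open>L\<^sub>N\<^sub>-\<^sub>1\<close> kills the term \<open>w\<^sub>0\<close> of a decomposition of \<open>u\<close> and turns the
  remaining terms into nonzero multiples of the terms of a decomposition of \<open>L\<^sub>N\<^sub>-\<^sub>1 u\<close>; existence and
  uniqueness follow by induction on \<open>N\<close>, provided that \<open>L\<^sub>N\<^sub>-\<^sub>1\<close> maps the weight exponent \<open>\<alpha>\<close> to
  \<open>\<alpha> + p\<close>.

  That is an interior estimate: if \<open>\<psi>\<^sub>m = (1 - (norm y)\<^sup>2)\<^sub>+\<^sup>m\<close>, then \<open>t \<mapsto> \<integral> u (x + t y) \<psi>\<^sub>m y dy\<close> has derivative
  \<open>t / (2 (m + 1)) \<integral> \<Delta>u (x + t y) \<psi>\<^sub>m\<^sub>+\<^sub>1 y dy\<close>, so it is a polynomial in \<open>t\<^sup>2\<close> of degree below \<open>N\<close> when \<open>u\<close>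
  is \<open>N\<close>-harmonic, and \<open>u x\<close> is recovered from finitely many scales \<open>t\<close> by extrapolation to \<open>t = 0\<close>.
  This reproducing formula yields smoothness, a bound for derivatives and, by a maximum argument,
  a mean value inequality for \<open>(norm u) powr p\<close> for every \<open>p > 0\<close>.
\<close>

subsection \<open>Functions of class \<open>C\<^sup>k\<close>\<close>

text \<open>The operators are tuned to the induction. Moving powers of \<open>laplacian\<close> past
  \<open>rho\<close> produces terms in \<open>R_op\<close>; the summand with
  \<open>4 * \<theta>\<close> cancels them exactly when \<theta> is one less than the order of
  harmonicity, and the zeroth-order constant of \<open>L_op\<close> cancels the rest. The weights
  balance likewise: each derivative costs one power of the distance to the sphere, so
  \<open>rho\<close> times the Laplacian and \<open>R_op\<close> both lose one power, that is
  \<open>p\<close> in the exponent, and the extra factor \<open>rho\<close> of the next term gives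
  it back.

  Two obstacles shape the analysis. The exponent \<alpha> is any real number and \<open>p\<close>
  may be below 1, so neither boundary values nor convexity can be used; everything is estimated on
  balls of radius proportional to the distance to the sphere, where the weight is comparable to a
  constant. And \<open>N_harmonic N\<close> grants only \<open>2 * N\<close> derivatives, while
  bounding second derivatives means treating \<open>partial_deriv b u\<close> as
  \<open>N\<close>-harmonic again; the missing smoothness comes from the reproducing
  formula.\<close>

lemma partial_deriv_eq: "(f has_derivative f') (at x) \<Longrightarrow> partial_deriv b f x = f' b"
  unfolding partial_deriv_def by (simp add: frechet_derivative_at[symmetric])

lemma has_derivative_partial_deriv:
  fixes f :: "'a::euclidean_space \<Rightarrow> complex"
  assumes "f differentiable (at x)"
  shows "(f has_derivative (\<lambda>h. \<Sum>b\<in>Basis. (h \<bullet> b) *\<^sub>R partial_deriv b f x)) (at x)"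
proof -
  have D: "(f has_derivative frechet_derivative f (at x)) (at x)"
    using assms by (simp add: frechet_derivative_works)
  then have lin: "linear (frechet_derivative f (at x))"
    by (rule has_derivative_linear)
  have "frechet_derivative f (at x) = (\<lambda>h. \<Sum>b\<in>Basis. (h \<bullet> b) *\<^sub>R partial_deriv b f x)"
  proof
    fix h
    have "frechet_derivative f (at x) h = frechet_derivative f (at x) (\<Sum>b\<in>Basis. (h \<bullet> b) *\<^sub>R b)"
      by (simp add: euclidean_representation)
    also have "\<dots> = (\<Sum>b\<in>Basis. (h \<bullet> b) *\<^sub>R partial_deriv b f x)"
      using lin by (simp add: linear_sum linear_cmul partial_deriv_def)
    finally show "frechet_derivative f (at x) h = \<dots>" .
  qed
  with D show ?thesis by simp
qed

lemma partial_deriv_has_vector_derivative: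
  fixes f :: "'a::euclidean_space \<Rightarrow> complex"
  assumes "f differentiable (at (x + s *\<^sub>R b))"
  shows "((\<lambda>s. f (x + s *\<^sub>R b)) has_vector_derivative partial_deriv b f (x + s *\<^sub>R b)) (at s)"
proof -
  have "((\<lambda>s. x + s *\<^sub>R b) has_derivative (\<lambda>h. h *\<^sub>R b)) (at s)"
    by (auto intro!: derivative_eq_intros)
  moreover have D: "(f has_derivative frechet_derivative f (at (x + s *\<^sub>R b))) (at (x + s *\<^sub>R b))"
    using assms by (simp add: frechet_derivative_works)
  ultimately have "((\<lambda>s. f (x + s *\<^sub>R b)) has_derivative
      (\<lambda>h. frechet_derivative f (at (x + s *\<^sub>R b)) (h *\<^sub>R b))) (at s)"
    by (rule has_derivative_compose)
  then show ?thesis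
    unfolding has_vector_derivative_def partial_deriv_def
    by (simp add: linear_cmul[OF has_derivative_linear[OF D]])
qed

section \<open>Locality of derivatives and operators on open sets\<close>

lemma differentiable_cong_open:
  assumes "open S" "x \<in> S" "\<And>y. y \<in> S \<Longrightarrow> f y = g y"
  shows "f differentiable (at x) \<longleftrightarrow> g differentiable (at x)"
  unfolding differentiable_def
  using assms has_derivative_transform_within_open by (metis (no_types, lifting))

text \<open>No differentiability is assumed: both functions have the same derivatives at
  \<open>x\<close>, so the choice behind \<open>frechet_derivative\<close> returns the same value
  even where there is none.\<close>

lemma partial_deriv_cong:
  assumes "open S" "x \<in> S" "\<And>y. y \<in> S \<Longrightarrow> f y = g y"
  shows "partial_deriv b f x = partial_deriv b g x"
proof -
  have "(f has_derivative f') (at x) \<longleftrightarrow> (g has_derivative f') (at x)" for f'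
    using assms has_derivative_transform_within_open by (metis (no_types, lifting))
  then show ?thesis
    by (simp add: partial_deriv_def frechet_derivative_def)
qed

lemma laplacian_cong:
  assumes "open S" "x \<in> S" "\<And>y. y \<in> S \<Longrightarrow> f y = g y"
  shows "laplacian f x = laplacian g x"
  unfolding laplacian_def
  by (intro sum.cong refl partial_deriv_cong[OF assms(1,2)]) (rule partial_deriv_cong[OF assms(1) _ assms(3)])

lemma R_op_cong:
  assumes "open S" "x \<in> S" "\<And>y. y \<in> S \<Longrightarrow> f y = g y"
  shows "R_op f x = R_op g x"
  using partial_deriv_cong[OF assms] by (simp add: R_op_def)

lemma L_op_cong:
  assumes "open S" "x \<in> S" "\<And>y. y \<in> S \<Longrightarrow> f y = g y"
  shows "L_op \<theta> f x = L_op \<theta> g x"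
  using laplacian_cong[OF assms] R_op_cong[OF assms] assms(2,3) by (simp add: L_op_def)

lemma laplacian_pow_cong:
  assumes "open S" "x \<in> S" "\<And>y. y \<in> S \<Longrightarrow> f y = g y"
  shows "(laplacian ^^ k) f x = (laplacian ^^ k) g x"
  using assms(2)
proof (induction k arbitrary: x)
  case 0
  then show ?case using assms(3) by simp
next
  case (Suc k)
  show ?case
    unfolding funpow.simps o_apply by (rule laplacian_cong[OF assms(1) Suc.prems Suc.IH])
qed

lemma C_k_on_cong:
  assumes "open S" "\<And>y. y \<in> S \<Longrightarrow> f y = g y"
  shows "C_k_on k S f \<longleftrightarrow> C_k_on k S g"
  using assms(2)
proof (induction k arbitrary: f g)
  case 0
  then show ?case by (simp cong: continuous_on_cong)
next
  case (Suc k)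
  have "C_k_on k S (partial_deriv b f) \<longleftrightarrow> C_k_on k S (partial_deriv b g)" for b
    by (rule Suc.IH) (rule partial_deriv_cong[OF assms(1) _ Suc.prems])
  moreover have "f differentiable (at x) \<longleftrightarrow> g differentiable (at x)" if "x \<in> S" for x
    using differentiable_cong_open[OF assms(1) that Suc.prems] .
  ultimately show ?case by simp
qed

section \<open>Closure properties of the classes \<open>C_k_on\<close>\<close>

text \<open>\<open>C_k_on (Suc k)\<close> does not ask for continuity of \<open>u\<close> itself; at
  the bottom of the induction it follows from differentiability.\<close>

lemma C_k_on_SucD: "C_k_on (Suc k) S u \<Longrightarrow> C_k_on k S u"
proof (induction k arbitrary: u)
  case 0
  then show ?case
    by (auto intro!: continuous_at_imp_continuous_on differentiable_imp_continuous_within)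
next
  case (Suc k)
  then show ?case by simp
qed

lemma C_k_on_le: "C_k_on k S u \<Longrightarrow> l \<le> k \<Longrightarrow> C_k_on l S u"
proof (induction k)
  case (Suc k)
  then show ?case by (metis C_k_on_SucD le_Suc_eq)
qed simp

lemma C_k_on_subset: "C_k_on k S u \<Longrightarrow> T \<subseteq> S \<Longrightarrow> C_k_on k T u"
  by (induction k arbitrary: u) (auto intro: continuous_on_subset)

text \<open>Serves to glue a function that is regular for different reasons on different open sets,
  and to prove regularity near one point at a time.\<close>

lemma C_k_on_local:
  assumes "\<And>x. x \<in> S \<Longrightarrow> \<exists>U. open U \<and> x \<in> U \<and> C_k_on k U f"
  shows "C_k_on k S f"
  using assms
proof (induction k arbitrary: f)
  case 0
  then show ?case
    by (force intro!: continuous_at_imp_continuous_on simp: continuous_on_eq_continuous_at)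
next
  case (Suc k)
  have "f differentiable (at x)" if "x \<in> S" for x
    using Suc.prems[OF that] by auto
  moreover have "C_k_on k S (partial_deriv b f)" if "b \<in> Basis" for b
    by (rule Suc.IH) (use Suc.prems that in fastforce)
  ultimately show ?case by simp
qed

lemma C_k_on_imp_continuous_on: "C_k_on k S u \<Longrightarrow> continuous_on S u"
  using C_k_on_le[of k S u 0] by simp

lemma partial_deriv_const [simp]: "partial_deriv b (\<lambda>x. c) = (\<lambda>x. 0)"
  by (rule ext) (rule partial_deriv_eq[where f'="\<lambda>h. 0", simplified], simp)

lemma C_k_on_const: "C_k_on k S (\<lambda>x. c)"
  by (induction k arbitrary: c) auto

lemma partial_deriv_add:
  "f differentiable (at x) \<Longrightarrow> g differentiable (at x) \<Longrightarrow>
    partial_deriv b (\<lambda>x. f x + g x) x = partial_deriv b f x + partial_deriv b g x"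
  by (rule trans[OF partial_deriv_eq[OF has_derivative_add]])
    (auto simp: frechet_derivative_works partial_deriv_def)

lemma partial_deriv_mult:
  "f differentiable (at x) \<Longrightarrow> g differentiable (at x) \<Longrightarrow>
    partial_deriv b (\<lambda>x. f x * g x) x = f x * partial_deriv b g x + partial_deriv b f x * g x"
  by (rule trans[OF partial_deriv_eq[OF has_derivative_mult]])
    (auto simp: frechet_derivative_works partial_deriv_def)

lemma partial_deriv_cmult:
  "f differentiable (at x) \<Longrightarrow> partial_deriv b (\<lambda>x. c * f x) x = c * partial_deriv b f x"
  by (subst partial_deriv_mult) auto

lemma partial_deriv_sum:
  assumes "finite I" "\<And>i. i \<in> I \<Longrightarrow> f i differentiable (at x)"
  shows "partial_deriv b (\<lambda>x. \<Sum>i\<in>I. f i x) x = (\<Sum>i\<in>I. partial_deriv b (f i) x)"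
  by (rule trans[OF partial_deriv_eq[OF has_derivative_sum]])
    (use assms in \<open>auto simp: frechet_derivative_works partial_deriv_def\<close>)

lemma C_k_on_add:
  assumes "open S" "C_k_on k S f" "C_k_on k S g"
  shows "C_k_on k S (\<lambda>x. f x + g x)"
  using assms(2,3)
proof (induction k arbitrary: f g)
  case (Suc k)
  have "C_k_on k S (partial_deriv b (\<lambda>x. f x + g x))" if "b \<in> Basis" for b
    using Suc that by (subst C_k_on_cong[OF assms(1)], subst partial_deriv_add) auto
  then show ?case using Suc.prems by auto
qed (auto intro: continuous_intros)

lemma C_k_on_mult:
  assumes "open S" "C_k_on k S f" "C_k_on k S g"
  shows "C_k_on k S (\<lambda>x. f x * g x)"
  using assms(2,3)
proof (induction k arbitrary: f g)
  case (Suc k)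
  have "C_k_on k S (partial_deriv b (\<lambda>x. f x * g x))" if "b \<in> Basis" for b
  proof (subst C_k_on_cong[OF assms(1)])
    show "partial_deriv b (\<lambda>x. f x * g x) y = f y * partial_deriv b g y + partial_deriv b f y * g y"
      if "y \<in> S" for y
      using Suc.prems that by (intro partial_deriv_mult) auto
    show "C_k_on k S (\<lambda>y. f y * partial_deriv b g y + partial_deriv b f y * g y)"
      using Suc that C_k_on_SucD[OF Suc.prems(1)] C_k_on_SucD[OF Suc.prems(2)]
      by (intro C_k_on_add[OF assms(1)] Suc.IH) auto
  qed
  then show ?case using Suc.prems by (auto intro!: differentiable_mult)
qed (auto intro: continuous_intros)

lemma C_k_on_cmult: "open S \<Longrightarrow> C_k_on k S f \<Longrightarrow> C_k_on k S (\<lambda>x. c * f x)"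
  by (intro C_k_on_mult C_k_on_const)

lemma C_k_on_sum:
  assumes "open S" "finite I" "\<And>i. i \<in> I \<Longrightarrow> C_k_on k S (f i)"
  shows "C_k_on k S (\<lambda>x. \<Sum>i\<in>I. f i x)"
  using assms(2,3)
  by (induction I) (auto intro!: C_k_on_const C_k_on_add assms(1))

lemma C_k_on_laplacian:
  assumes "open S" "C_k_on (Suc (Suc k)) S f"
  shows "C_k_on k S (laplacian f)"
  unfolding laplacian_def[abs_def] using assms by (intro C_k_on_sum) auto

lemma coord_has_derivative:
  "((\<lambda>x. complex_of_real (x \<bullet> b)) has_derivative (\<lambda>h. complex_of_real (h \<bullet> b))) (at x)"
  by (auto intro!: derivative_eq_intros)

lemma coord_differentiable [simp]: "(\<lambda>x. complex_of_real (x \<bullet> b)) differentiable (at x)"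
  using coord_has_derivative differentiable_def by blast

lemma partial_deriv_coord [simp]:
  "partial_deriv c (\<lambda>x. complex_of_real (x \<bullet> b)) = (\<lambda>x. complex_of_real (c \<bullet> b))"
  by (rule ext) (rule partial_deriv_eq[OF coord_has_derivative])

lemma C_k_on_coord: "C_k_on k S (\<lambda>x. complex_of_real (x \<bullet> b))"
  by (cases k) (auto intro!: continuous_intros C_k_on_const)

text \<open>Schwarz's theorem by differentiation under the integral: the increment of
  \<open>u\<close> in direction \<open>b\<close> is the integral of
  \<open>partial_deriv b u\<close>. Its derivative in direction \<open>c\<close> is the integral of
  the mixed derivative, and the fundamental theorem of calculus then recovers the integrand at
  0.\<close>

lemma partial_deriv_commute:
  fixes u :: "'a::euclidean_space \<Rightarrow> complex"
  assumes S: "open S" and u: "C_k_on 2 S u" and x: "x \<in> S" and b: "b \<in> Basis" "c \<in> Basis"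
  shows "partial_deriv b (partial_deriv c u) x = partial_deriv c (partial_deriv b u) x"
proof -
  obtain e where e: "e > 0" "ball x e \<subseteq> S"
    using S x openE by blast
  \<comment> \<open>A third of the radius leaves room for two displacements of length at most
    \<open>d\<close>.\<close>
  define d where "d = e / 3"
  have d: "d > 0" using e by (simp add: d_def)
  have inS: "x + s *\<^sub>R b + t *\<^sub>R c \<in> S" if "\<bar>s\<bar> \<le> d" "\<bar>t\<bar> \<le> d" for s t
  proof -
    have "norm (s *\<^sub>R b + t *\<^sub>R c) \<le> norm (s *\<^sub>R b) + norm (t *\<^sub>R c)"
      by (rule norm_triangle_ineq)
    also have "\<dots> < e" using that b d by (simp add: d_def)
    finally have "dist x (x + s *\<^sub>R b + t *\<^sub>R c) < e"
      by (metis add.assoc add_diff_cancel_left' dist_commute dist_norm)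
    then show ?thesis using e by auto
  qed
  have du: "u differentiable (at y)" "partial_deriv b u differentiable (at y)"
    "partial_deriv c u differentiable (at y)" if "y \<in> S" for y
    using u that b by (auto simp: numeral_2_eq_2)
  have cont: "continuous_on S (partial_deriv c (partial_deriv b u))"
    "continuous_on S (partial_deriv b u)"
    using u b C_k_on_imp_continuous_on[of "Suc 0" S "partial_deriv b u"]
    by (auto simp: numeral_2_eq_2)
  have ftc: "((\<lambda>\<sigma>. partial_deriv b u (x + \<sigma> *\<^sub>R b + t *\<^sub>R c)) has_integral
      u (x + s *\<^sub>R b + t *\<^sub>R c) - u (x + t *\<^sub>R c)) {0..s}" if "0 \<le> s" "s \<le> d" "\<bar>t\<bar> \<le> d" for s t
  proof -
    have "((\<lambda>\<sigma>. partial_deriv b u (x + \<sigma> *\<^sub>R b + t *\<^sub>R c)) has_integral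
      u (x + s *\<^sub>R b + t *\<^sub>R c) - u (x + 0 *\<^sub>R b + t *\<^sub>R c)) {0..s}"
    proof (rule fundamental_theorem_of_calculus)
      fix \<sigma> assume "\<sigma> \<in> {0..s}"
      then have "((\<lambda>\<sigma>. u ((x + t *\<^sub>R c) + \<sigma> *\<^sub>R b)) has_vector_derivative
          partial_deriv b u ((x + t *\<^sub>R c) + \<sigma> *\<^sub>R b)) (at \<sigma>)"
        using inS[of \<sigma> t] that
        by (intro partial_deriv_has_vector_derivative du) (auto simp: algebra_simps)
      then show "((\<lambda>\<sigma>. u (x + \<sigma> *\<^sub>R b + t *\<^sub>R c)) has_vector_derivative
          partial_deriv b u (x + \<sigma> *\<^sub>R b + t *\<^sub>R c)) (at \<sigma> within {0..s})"
        by (auto simp: algebra_simps intro: has_vector_derivative_at_within)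
    qed (use that in auto)
    then show ?thesis by simp
  qed
  have eq: "partial_deriv c u (x + s *\<^sub>R b) - partial_deriv c u x =
      integral {0..s} (\<lambda>\<sigma>. partial_deriv c (partial_deriv b u) (x + \<sigma> *\<^sub>R b))"
    if s: "0 \<le> s" "s \<le> d" for s
  proof -
    have "((\<lambda>t. integral (cbox 0 s) (\<lambda>\<sigma>. partial_deriv b u (x + \<sigma> *\<^sub>R b + t *\<^sub>R c)))
      has_vector_derivative
      integral (cbox 0 s) (\<lambda>\<sigma>. partial_deriv c (partial_deriv b u) (x + \<sigma> *\<^sub>R b + 0 *\<^sub>R c)))
      (at 0 within {-d..d})"
    proof (rule leibniz_rule_vector_derivative)
      show "((\<lambda>t. partial_deriv b u (x + \<sigma> *\<^sub>R b + t *\<^sub>R c)) has_vector_derivative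
          partial_deriv c (partial_deriv b u) (x + \<sigma> *\<^sub>R b + t *\<^sub>R c)) (at t within {-d..d})"
        if "t \<in> {-d..d}" "\<sigma> \<in> cbox 0 s" for t \<sigma>
        using that s inS[of \<sigma> t]
        by (intro has_vector_derivative_at_within[OF partial_deriv_has_vector_derivative] du) auto
      show "(\<lambda>\<sigma>. partial_deriv b u (x + \<sigma> *\<^sub>R b + t *\<^sub>R c)) integrable_on cbox 0 s"
        if "t \<in> {-d..d}" for t
        using has_integral_integrable[OF ftc[of s t]] s that by auto
      show "continuous_on ({-d..d} \<times> cbox 0 s)
          (\<lambda>(t, \<sigma>). partial_deriv c (partial_deriv b u) (x + \<sigma> *\<^sub>R b + t *\<^sub>R c))"
        unfolding split_beta
        by (rule continuous_on_compose2[OF cont(1)]) (use s inS in \<open>auto intro!: continuous_intros\<close>)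
    qed (use d in auto)
    then have "((\<lambda>t. integral {0..s} (\<lambda>\<sigma>. partial_deriv b u (x + \<sigma> *\<^sub>R b + t *\<^sub>R c)))
      has_vector_derivative
      integral {0..s} (\<lambda>\<sigma>. partial_deriv c (partial_deriv b u) (x + \<sigma> *\<^sub>R b)))
      (at 0 within {-d..d})"
      by simp
    then have "((\<lambda>t. u (x + s *\<^sub>R b + t *\<^sub>R c) - u (x + t *\<^sub>R c)) has_vector_derivative
       integral {0..s} (\<lambda>\<sigma>. partial_deriv c (partial_deriv b u) (x + \<sigma> *\<^sub>R b)))
      (at 0 within {-d..d})"
      by (rule has_vector_derivative_transform[rotated 2])
        (use d s integral_unique[OF ftc[of s]] in auto)
    then have 1: "((\<lambda>t. u (x + s *\<^sub>R b + t *\<^sub>R c) - u (x + t *\<^sub>R c)) has_vector_derivative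
       integral {0..s} (\<lambda>\<sigma>. partial_deriv c (partial_deriv b u) (x + \<sigma> *\<^sub>R b))) (at 0)"
      using d by (subst (asm) at_within_interior) auto
    have 2: "((\<lambda>t. u (x + s *\<^sub>R b + t *\<^sub>R c) - u (x + t *\<^sub>R c)) has_vector_derivative
       partial_deriv c u (x + s *\<^sub>R b + 0 *\<^sub>R c) - partial_deriv c u (x + 0 *\<^sub>R c)) (at 0)"
      using inS[of s 0] inS[of 0 0] s d
      by (intro has_vector_derivative_diff partial_deriv_has_vector_derivative du) auto
    show ?thesis using vector_derivative_unique_at[OF 1 2] by simp
  qed
  have "((\<lambda>s. integral {0..s} (\<lambda>\<sigma>. partial_deriv c (partial_deriv b u) (x + \<sigma> *\<^sub>R b)))
      has_vector_derivative partial_deriv c (partial_deriv b u) (x + 0 *\<^sub>R b)) (at 0 within {0..d})"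
    (is "(?I has_vector_derivative _) _")
    by (rule integral_has_vector_derivative, rule continuous_on_compose2[OF cont(1)])
      (use d inS[of _ 0] in \<open>auto intro!: continuous_intros\<close>)
  then have "(?I has_vector_derivative partial_deriv c (partial_deriv b u) x) (at 0 within {0..d})"
    by simp
  then have 1: "((\<lambda>s. partial_deriv c u (x + s *\<^sub>R b) - partial_deriv c u x)
      has_vector_derivative partial_deriv c (partial_deriv b u) x) (at 0 within {0..d})"
    by (rule has_vector_derivative_transform[rotated 2]) (use d eq in auto)
  have 2: "((\<lambda>s. partial_deriv c u (x + s *\<^sub>R b) - partial_deriv c u x)
      has_vector_derivative partial_deriv b (partial_deriv c u) (x + 0 *\<^sub>R b) - 0) (at 0 within {0..d})"
    using x by (intro has_vector_derivative_diff has_vector_derivative_at_within[OF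
          partial_deriv_has_vector_derivative] has_vector_derivative_const du) auto
  \<comment> \<open>Both derivatives are one-sided; they agree because 0 is a limit point of
    \<open>{0..d}\<close>.\<close>
  show ?thesis
    using vector_derivative_unique_within[OF _ 1 2] d
    by (simp add: trivial_limit_within islimpt_Icc)
qed

subsection \<open>Bump functions\<close>

text \<open>Powers are used because the gradient of \<open>bump (Suc m)\<close> is a constant times
  \<open>y\<close> times \<open>bump m\<close> once \<open>m\<close> is positive, which lets a
  factor \<open>y\<close> be integrated by parts. Each derivative costs one exponent, so
  \<open>bump m\<close> is only of class C^(m-1) and \<open>m\<close> stays a parameter.\<close>

definition bump :: "nat \<Rightarrow> 'a::euclidean_space \<Rightarrow> complex"
  where "bump m y = complex_of_real ((max 0 (1 - (norm y)\<^sup>2)) ^ m)"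

lemma DERIV_pos_part_power:
  "((\<lambda>s::real. (max 0 s) ^ Suc (Suc m)) has_field_derivative
     real (Suc (Suc m)) * (max 0 s) ^ Suc m) (at s)"
proof -
  consider "s > 0" | "s < 0" | "s = 0" by linarith
  then show ?thesis
  proof cases
    case 1
    have "((\<lambda>s::real. s ^ Suc (Suc m)) has_field_derivative
        real (Suc (Suc m)) * (max 0 s) ^ Suc m) (at s)"
      using DERIV_pow[of "Suc (Suc m)" s] 1 by simp
    then show ?thesis
      by (rule has_field_derivative_transform_within_open[of _ _ _ "{0<..}"]) (use 1 in auto)
  next
    case 2
    have "((\<lambda>s::real. 0) has_field_derivative real (Suc (Suc m)) * (max 0 s) ^ Suc m) (at s)"
      using 2 by simp
    then show ?thesis
      by (rule has_field_derivative_transform_within_open[of _ _ _ "{..<0}"]) (use 2 in auto)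
  next
    case 3
    have "isCont (\<lambda>s::real. (max 0 s) ^ Suc m) 0"
      by (intro continuous_intros)
    \<comment> \<open>At the kink the difference quotient is itself a power of the positive part,
      hence continuous.\<close>
    moreover have "(max 0 z) ^ Suc (Suc m) = (max 0 z) ^ Suc m * z" for z :: real
      by (cases "z \<ge> 0") auto
    ultimately show ?thesis
      unfolding 3 CARAT_DERIV by (intro exI[of _ "\<lambda>s. (max 0 s) ^ Suc m"]) auto
  qed
qed

lemma bump_has_derivative:
  "(bump (Suc (Suc m)) has_derivative
     (\<lambda>h. complex_of_real (- (2 * real (Suc (Suc m)) * (h \<bullet> y))) * bump (Suc m) y)) (at y)"
proof -
  have "((\<lambda>y::'a. 1 - (norm y)\<^sup>2) has_derivative (\<lambda>h. - (2 * (h \<bullet> y)))) (at y)"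
    unfolding power2_norm_eq_inner by (auto intro!: derivative_eq_intros simp: inner_commute)
  from has_derivative_compose[OF this DERIV_pos_part_power[unfolded has_field_derivative_def]]
  have "((\<lambda>y::'a. (max 0 (1 - (norm y)\<^sup>2)) ^ Suc (Suc m)) has_derivative
     (\<lambda>h. real (Suc (Suc m)) * (max 0 (1 - (norm y)\<^sup>2)) ^ Suc m * (- (2 * (h \<bullet> y))))) (at y)" .
  from has_derivative_of_real[OF this] show ?thesis
    unfolding bump_def[abs_def] by (rule has_derivative_eq_rhs) (auto simp: algebra_simps)
qed

lemma partial_deriv_bump:
  "partial_deriv b (bump (Suc (Suc m))) =
    (\<lambda>y. (- of_nat (2 * Suc (Suc m))) * (complex_of_real (y \<bullet> b) * bump (Suc m) y))"
  by (rule ext, subst partial_deriv_eq[OF bump_has_derivative]) (simp add: inner_commute algebra_simps)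

lemma C_k_on_bump: "k < m \<Longrightarrow> C_k_on k UNIV (bump m)"
proof (induction k arbitrary: m)
  case 0
  then show ?case by (auto simp: bump_def[abs_def] intro!: continuous_intros)
next
  case (Suc k)
  define l where "l = m - 2"
  have l: "m = Suc (Suc l)" "k < Suc l" using Suc.prems by (auto simp: l_def)
  have "C_k_on k UNIV (partial_deriv b (bump m))" for b :: 'a
    unfolding l(1) partial_deriv_bump
    by (intro C_k_on_cmult C_k_on_mult C_k_on_coord Suc.IH open_UNIV l(2))
  moreover have "bump m differentiable (at x)" for x :: 'a
    unfolding l(1) differentiable_def using bump_has_derivative by blast
  ultimately show ?case by simp
qed

lemma bump_eq_0: "0 < m \<Longrightarrow> 1 \<le> norm y \<Longrightarrow> bump m y = 0"
  by (simp add: bump_def)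

lemma norm_bump_le_1: "norm (bump m y) \<le> 1"
  by (auto simp: bump_def norm_power intro!: power_le_one)

subsection \<open>Integrals over a cube\<close>

text \<open>A box, because the gauge integral and its Leibniz rules are stated over boxes. Half-side
  2 leaves a margin around the unit ball, which carries the kernels, for shifts by up to 1.\<close>

definition cube :: "'a::euclidean_space set"
  where "cube = cbox (- (2 *\<^sub>R One)) (2 *\<^sub>R One)"

lemma compact_cube [simp]: "compact cube"
  by (simp add: cube_def)

lemma cball_subset_cube: "cball 0 2 \<subseteq> cube"
proof
  fix y :: 'a assume "y \<in> cball 0 2"
  then have "\<bar>y \<bullet> b\<bar> \<le> 2" if "b \<in> Basis" for b
    using Basis_le_norm[OF that, of y] by simp
  then show "y \<in> cube"
    unfolding cube_def mem_box by (fastforce simp: abs_le_iff)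
qed

text \<open>A crude bound through the l1 norm; its factor \<open>2 * DIM('a)\<close> returns in
  every condition that keeps \<open>x + t *\<^sub>R y\<close> inside the unit ball.\<close>

lemma norm_cube: "y \<in> cube \<Longrightarrow> norm (y::'a::euclidean_space) \<le> 2 * DIM('a)"
proof -
  assume "y \<in> cube"
  then have "\<bar>y \<bullet> b\<bar> \<le> 2" if "b \<in> Basis" for b
    using that unfolding cube_def mem_box by (force simp: abs_le_iff)
  then have "(\<Sum>b\<in>Basis. \<bar>y \<bullet> b\<bar>) \<le> of_nat (card (Basis::'a set)) * 2"
    by (intro sum_bounded_above) auto
  with norm_le_l1[of y] show ?thesis by simp
qed

lemma integrable_on_cube: "continuous_on cube f \<Longrightarrow> (f :: 'a::euclidean_space \<Rightarrow> 'b::banach) integrable_on cube"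
  unfolding cube_def by (rule integrable_continuous)

text \<open>Integration by parts in disguise: by translation invariance the integral of
  \<open>\<lambda>y. g (y + s *\<^sub>R b)\<close> over the cube does not depend on \<open>s\<close>; differentiate at \<open>s = 0\<close>.\<close>

lemma integral_partial_deriv_eq_0:
  fixes g :: "'a::euclidean_space \<Rightarrow> complex"
  assumes g: "C_k_on 1 UNIV g" and supp: "\<And>y. 1 < norm y \<Longrightarrow> g y = 0" and b: "b \<in> Basis"
  shows "integral cube (partial_deriv b g) = 0"
proof -
  have cont: "continuous_on UNIV g" "continuous_on UNIV (partial_deriv b g)"
    using g b C_k_on_imp_continuous_on[OF g] by auto
  have "((\<lambda>s. integral (cbox (- (2 *\<^sub>R One)) (2 *\<^sub>R One)) (\<lambda>y. g (y + s *\<^sub>R b))) has_vector_derivative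
      integral (cbox (- (2 *\<^sub>R One)) (2 *\<^sub>R One)) (\<lambda>y. partial_deriv b g (y + 0 *\<^sub>R b)))
      (at 0 within {-1..1})"
  proof (rule leibniz_rule_vector_derivative)
    show "((\<lambda>s. g (y + s *\<^sub>R b)) has_vector_derivative partial_deriv b g (y + s *\<^sub>R b))
        (at s within {-1..1})" for s y
      using g by (intro has_vector_derivative_at_within[OF partial_deriv_has_vector_derivative]) auto
    show "(\<lambda>y. g (y + s *\<^sub>R b)) integrable_on cbox (- (2 *\<^sub>R One)) (2 *\<^sub>R One)" for s
      by (intro integrable_continuous continuous_on_compose2[OF cont(1)]) (auto intro!: continuous_intros)
    show "continuous_on ({-1..1} \<times> cbox (- (2 *\<^sub>R One)) (2 *\<^sub>R One))
        (\<lambda>(s, y). partial_deriv b g (y + s *\<^sub>R b))"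
      unfolding split_beta
      by (rule continuous_on_compose2[OF cont(2)]) (auto intro!: continuous_intros)
  qed auto
  then have D: "((\<lambda>s. integral cube (\<lambda>y. g (y + s *\<^sub>R b))) has_vector_derivative
      integral cube (partial_deriv b g)) (at 0 within {-1..1})"
    by (simp add: cube_def)
  obtain I where I: "(g has_integral I) (cbox (- One) One)"
    using integrable_continuous[OF continuous_on_subset[OF cont(1)]] by blast
  \<comment> \<open>For \<open>\<bar>s\<bar> \<le> 1\<close> the shifted cube still contains
    \<open>cbox (- One) One\<close>, off which \<open>g\<close> vanishes.\<close>
  have "integral cube (\<lambda>y. g (y + s *\<^sub>R b)) = I" if "s \<in> {-1..1}" for s
  proof -
    have "(g has_integral I) (cbox (- (2 *\<^sub>R One) + s *\<^sub>R b) (2 *\<^sub>R One + s *\<^sub>R b))"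
    proof (rule has_integral_on_superset[OF I])
      show "g y = 0" if "y \<notin> cbox (- One) One" for y
      proof (rule supp, rule ccontr)
        assume "\<not> 1 < norm y"
        then have "\<bar>y \<bullet> c\<bar> \<le> 1" if "c \<in> Basis" for c
          using Basis_le_norm[OF that, of y] by simp
        then have "y \<in> cbox (- One) One"
          unfolding mem_box by (fastforce simp: abs_le_iff)
        with that show False by blast
      qed
      show "cbox (- One) One \<subseteq> cbox (- (2 *\<^sub>R One) + s *\<^sub>R b) (2 *\<^sub>R One + s *\<^sub>R b)"
      proof
        fix y :: 'a assume y: "y \<in> cbox (- One) One"
        have "\<bar>s * (b \<bullet> c)\<bar> \<le> 1" if "c \<in> Basis" for c
          using \<open>s \<in> {-1..1}\<close> b that by (auto simp: inner_Basis)
        then show "y \<in> cbox (- (2 *\<^sub>R One) + s *\<^sub>R b) (2 *\<^sub>R One + s *\<^sub>R b)"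
          using y unfolding mem_box by (fastforce simp: inner_simps abs_le_iff)
      qed
    qed
    then have "((g \<circ> (+) (s *\<^sub>R b)) has_integral I) cube"
      unfolding cube_def has_integral_shift_cbox_iff .
    then show ?thesis
      by (simp add: integral_unique o_def add.commute)
  qed
  then have "((\<lambda>s. integral cube (\<lambda>y. g (y + s *\<^sub>R b))) has_vector_derivative 0) (at 0 within {-1..1})"
    by (intro has_vector_derivative_transform[OF _ _ has_vector_derivative_const[of I]]) auto
  from vector_derivative_unique_within[OF _ D this] show ?thesis
    by (simp add: trivial_limit_within islimpt_Icc)
qed

section \<open>Weighted means at scale \<open>t\<close>\<close>

text \<open>The scale sits in the argument of \<open>u\<close>, with no normalising power of
  \<open>t\<close>. Thus \<open>t = 0\<close> is allowed and gives \<open>u x\<close> times the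
  integral of \<open>K\<close>, and derivatives in \<open>x\<close> and in \<open>t\<close> both
  fall on \<open>u\<close>.\<close>

definition conv :: "('a::euclidean_space \<Rightarrow> complex) \<Rightarrow> real \<Rightarrow> ('a \<Rightarrow> complex) \<Rightarrow> 'a \<Rightarrow> complex"
  where "conv K t u x = integral cube (\<lambda>y. u (x + t *\<^sub>R y) * K y)"

lemma affine_has_derivative:
  "((\<lambda>y. x + t *\<^sub>R y) has_derivative (\<lambda>h. t *\<^sub>R h)) (at y)"
  by (auto intro!: derivative_eq_intros)

lemma partial_deriv_affine:
  assumes "v differentiable (at (x + t *\<^sub>R y))"
  shows "(\<lambda>y. v (x + t *\<^sub>R y)) differentiable (at y)"
    and "partial_deriv b (\<lambda>y. v (x + t *\<^sub>R y)) y = of_real t * partial_deriv b v (x + t *\<^sub>R y)"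
proof -
  have D: "(v has_derivative frechet_derivative v (at (x + t *\<^sub>R y))) (at (x + t *\<^sub>R y))"
    using assms by (simp add: frechet_derivative_works)
  note C = has_derivative_compose[OF affine_has_derivative D]
  show "(\<lambda>y. v (x + t *\<^sub>R y)) differentiable (at y)"
    using C differentiable_def by blast
  show "partial_deriv b (\<lambda>y. v (x + t *\<^sub>R y)) y = of_real t * partial_deriv b v (x + t *\<^sub>R y)"
    using partial_deriv_eq[OF C, of b] linear_cmul[OF has_derivative_linear[OF D]]
    by (simp add: partial_deriv_def scaleR_conv_of_real)
qed

lemma open_affine_vimage:
  fixes x :: "'a::real_normed_vector"
  shows "open S \<Longrightarrow> open {y. x + t *\<^sub>R y \<in> S}"
  unfolding vimage_def[symmetric, of "\<lambda>y. x + t *\<^sub>R y"]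
  by (intro open_vimage continuous_intros)

lemma C_k_on_affine:
  assumes S: "open S" and "C_k_on k S v"
  shows "C_k_on k {y. x + t *\<^sub>R y \<in> S} (\<lambda>y. v (x + t *\<^sub>R y))"
  using assms(2)
proof (induction k arbitrary: v)
  case 0
  then show ?case
    by (auto intro!: continuous_intros intro: continuous_on_compose2[of S v])
next
  case (Suc k)
  note O = open_affine_vimage[OF S, of x t]
  have "C_k_on k {y. x + t *\<^sub>R y \<in> S} (partial_deriv b (\<lambda>y. v (x + t *\<^sub>R y)))" if "b \<in> Basis" for b
  proof (subst C_k_on_cong[OF O])
    show "partial_deriv b (\<lambda>y. v (x + t *\<^sub>R y)) y = of_real t * partial_deriv b v (x + t *\<^sub>R y)"
      if "y \<in> {y. x + t *\<^sub>R y \<in> S}" for y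
      using Suc.prems that by (intro partial_deriv_affine) auto
    show "C_k_on k {y. x + t *\<^sub>R y \<in> S} (\<lambda>y. of_real t * partial_deriv b v (x + t *\<^sub>R y))"
      using Suc that by (intro C_k_on_cmult O Suc.IH) auto
  qed
  then show ?case using Suc.prems by (auto intro!: partial_deriv_affine(1))
qed

lemma partial_deriv_supp:
  assumes "\<And>y. 1 < norm y \<Longrightarrow> K y = 0" "1 < norm y"
  shows "partial_deriv b K y = 0"
proof -
  have "partial_deriv b K y = partial_deriv b (\<lambda>y. 0) y"
    by (rule partial_deriv_cong[of "- cball 0 1"]) (use assms in auto)
  then show ?thesis by simp
qed

lemma continuous_on_conv_integrand:
  fixes v K :: "'a::euclidean_space \<Rightarrow> complex"
  assumes v: "continuous_on S v" and K: "continuous_on UNIV K"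
    and inS: "\<And>y. y \<in> cube \<Longrightarrow> x + t *\<^sub>R y \<in> S"
  shows "continuous_on cube (\<lambda>y. v (x + t *\<^sub>R y) * K y)"
  by (intro continuous_on_mult continuous_on_compose2[OF v] continuous_on_subset[OF K])
    (use inS in \<open>auto intro!: continuous_intros\<close>)

text \<open>Integration by parts: the derivative of the product has integral 0, and the chain rule
  contributes the factor \<open>t\<close>.\<close>

lemma conv_partial_deriv:
  fixes v :: "'a::euclidean_space \<Rightarrow> complex"
  assumes S: "open S" and v: "C_k_on 1 S v" and K: "C_k_on 1 UNIV K"
    and supp: "\<And>y. 1 < norm y \<Longrightarrow> K y = 0" and b: "b \<in> Basis"
    and inS: "\<And>y. y \<in> cube \<Longrightarrow> x + t *\<^sub>R y \<in> S"
  shows "conv (partial_deriv b K) t v x = - of_real t * conv K t (partial_deriv b v) x"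
proof -
  define g where "g = (\<lambda>y. v (x + t *\<^sub>R y) * K y)"
  define W where "W = {y. x + t *\<^sub>R y \<in> S}"
  have W: "open W" unfolding W_def using S by (rule open_affine_vimage)
  have "cball 0 1 \<subseteq> (cube :: 'a set)"
    using cball_subset_cube by (rule order_trans[rotated]) auto
  then have "cball 0 1 \<subseteq> W"
    using inS by (auto simp: W_def)
  have "C_k_on 1 W g"
    unfolding g_def W_def
    by (intro C_k_on_mult C_k_on_affine S v C_k_on_subset[OF K] open_affine_vimage) auto
  moreover have "C_k_on 1 (- cball 0 1) g"
    by (subst C_k_on_cong[where g="\<lambda>y. 0"]) (auto simp: g_def supp intro!: C_k_on_const)
  \<comment> \<open>\<open>v\<close> is controlled on \<open>S\<close> only. Near the closed unit
    ball \<open>g\<close> is a product of C^1 functions, off that ball it is 0, and the two open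
    sets cover the space.\<close>
  ultimately have g: "C_k_on 1 UNIV g"
    using W \<open>cball 0 1 \<subseteq> W\<close>
    by (intro C_k_on_local) (metis ComplI closed_cball open_Compl subsetD)
  have dg: "partial_deriv b g y = v (x + t *\<^sub>R y) * partial_deriv b K y +
      of_real t * (partial_deriv b v (x + t *\<^sub>R y) * K y)" if "y \<in> cube" for y
    unfolding g_def using v K inS[OF that]
    by (subst partial_deriv_mult) (auto simp: partial_deriv_affine)
  have i1: "(\<lambda>y. v (x + t *\<^sub>R y) * partial_deriv b K y) integrable_on cube"
    using v K b C_k_on_imp_continuous_on[OF v] inS
    by (intro integrable_on_cube continuous_on_conv_integrand[of S]) auto
  have i2: "(\<lambda>y. partial_deriv b v (x + t *\<^sub>R y) * K y) integrable_on cube"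
    using v K b C_k_on_imp_continuous_on[OF K] inS
    by (intro integrable_on_cube continuous_on_conv_integrand[of S]) auto
  have "0 = integral cube (partial_deriv b g)"
    using integral_partial_deriv_eq_0[OF g _ b] supp by (simp add: g_def)
  also have "\<dots> = integral cube (\<lambda>y. v (x + t *\<^sub>R y) * partial_deriv b K y +
      of_real t * (partial_deriv b v (x + t *\<^sub>R y) * K y))"
    using dg by (rule integral_cong)
  also have "\<dots> = conv (partial_deriv b K) t v x + of_real t * conv K t (partial_deriv b v) x"
    unfolding conv_def using i1 i2
    by (subst integral_add) (auto intro: integrable_on_mult_right)
  finally show ?thesis by (simp add: add_eq_0_iff2)
qed

lemma conv_has_derivative:
  fixes v :: "'a::euclidean_space \<Rightarrow> complex"
  assumes v: "C_k_on 1 S v" and K: "continuous_on UNIV K"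
    and U: "open U" "convex U" and inS: "\<And>x y. x \<in> U \<Longrightarrow> y \<in> cube \<Longrightarrow> x + t *\<^sub>R y \<in> S"
    and x: "x \<in> U"
  shows "(conv K t v has_derivative (\<lambda>h. \<Sum>b\<in>Basis. (h \<bullet> b) *\<^sub>R conv K t (partial_deriv b v) x)) (at x)"
proof -
  \<comment> \<open>The Leibniz rule wants the derivative as a continuous map into bounded linear
    functions, hence the blinfun form of the gradient.\<close>
  define F where "F x y = (\<Sum>b\<in>Basis. blinfun_scaleR_left (partial_deriv b v (x + t *\<^sub>R y) * K y) o\<^sub>L
      blinfun_inner_left b)" for x y
  have dv: "continuous_on S (partial_deriv b v)" if "b \<in> Basis" for b
    using v that by auto
  have F_apply: "blinfun_apply (F x y) h =
      (\<Sum>b\<in>Basis. (h \<bullet> b) *\<^sub>R (partial_deriv b v (x + t *\<^sub>R y) * K y))" for x y h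
    by (simp add: F_def blinfun.sum_left)
  have contF: "continuous_on (U \<times> cube) (\<lambda>(x, y). F x y)"
    unfolding split_beta F_def
    by (intro continuous_intros bounded_bilinear.continuous_on[OF bounded_bilinear_blinfun_compose]
        bounded_linear.continuous_on[OF bounded_linear_blinfun_scaleR_left]
        continuous_on_compose2[OF dv] continuous_on_compose2[OF K])
      (use inS in \<open>auto intro!: continuous_intros\<close>)
  have intF: "F x integrable_on cube"
  proof (rule integrable_on_cube)
    have "continuous_on cube (Pair x)" "Pair x ` cube \<subseteq> U \<times> cube"
      using x by (auto intro!: continuous_intros)
    from continuous_on_compose2[OF contF this] show "continuous_on cube (F x)" by simp
  qed
  have "((\<lambda>x. integral (cbox (- (2 *\<^sub>R One)) (2 *\<^sub>R One)) (\<lambda>y. v (x + t *\<^sub>R y) * K y)) has_derivative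
      blinfun_apply (integral (cbox (- (2 *\<^sub>R One)) (2 *\<^sub>R One)) (F x))) (at x within U)"
  proof (rule leibniz_rule)
    fix x y :: 'a assume "x \<in> U" "y \<in> cbox (- (2 *\<^sub>R One)) (2 *\<^sub>R One)"
    then have "v differentiable (at (x + t *\<^sub>R y))"
      using v inS by (auto simp: cube_def)
    from has_derivative_partial_deriv[OF this]
    have D: "(v has_derivative (\<lambda>h. \<Sum>b\<in>Basis. (h \<bullet> b) *\<^sub>R partial_deriv b v (x + t *\<^sub>R y))) (at (x + t *\<^sub>R y))" .
    have "((\<lambda>x. x + t *\<^sub>R y) has_derivative (\<lambda>h. h)) (at x)"
      by (auto intro!: derivative_eq_intros)
    from has_derivative_mult_left[OF has_derivative_compose[OF this D], of "K y"]
    show "((\<lambda>x. v (x + t *\<^sub>R y) * K y) has_derivative blinfun_apply (F x y)) (at x within U)"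
      by (rule has_derivative_eq_rhs[OF has_derivative_at_withinI])
        (simp add: fun_eq_iff F_apply sum_distrib_right)
  next
    fix x assume "x \<in> U"
    then have "continuous_on cube (\<lambda>y. v (x + t *\<^sub>R y) * K y)"
      using C_k_on_imp_continuous_on[OF v] K inS by (intro continuous_on_conv_integrand) auto
    from integrable_on_cube[OF this]
    show "(\<lambda>y. v (x + t *\<^sub>R y) * K y) integrable_on cbox (- (2 *\<^sub>R One)) (2 *\<^sub>R One)"
      by (simp add: cube_def)
  qed (use contF U x in \<open>auto simp: cube_def\<close>)
  then have D: "(conv K t v has_derivative blinfun_apply (integral cube (F x))) (at x)"
    using at_within_open[OF x U(1)] by (simp add: cube_def conv_def[abs_def])
  have "(\<lambda>y. partial_deriv b v (x + t *\<^sub>R y) * K y) integrable_on cube" if "b \<in> Basis" for b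
    using dv[OF that] K inS x by (intro integrable_on_cube continuous_on_conv_integrand) auto
  then have "blinfun_apply (integral cube (F x)) h =
      (\<Sum>b\<in>Basis. (h \<bullet> b) *\<^sub>R conv K t (partial_deriv b v) x)" for h
    using intF by (simp add: blinfun_apply_integral F_apply integral_sum integrable_cmul conv_def)
  then have "blinfun_apply (integral cube (F x)) =
      (\<lambda>h. \<Sum>b\<in>Basis. (h \<bullet> b) *\<^sub>R conv K t (partial_deriv b v) x)"
    by blast
  with D show ?thesis by simp
qed

lemma partial_deriv_conv:
  assumes "C_k_on 1 S v" "continuous_on UNIV K"
    and "open U" "convex U" "\<And>x y. x \<in> U \<Longrightarrow> y \<in> cube \<Longrightarrow> x + t *\<^sub>R y \<in> S"
    and "x \<in> U" "b \<in> Basis"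
  shows "partial_deriv b (conv K t v) x = conv K t (partial_deriv b v) x"
proof -
  have "partial_deriv b (conv K t v) x = (\<Sum>c\<in>Basis. (b \<bullet> c) *\<^sub>R conv K t (partial_deriv c v) x)"
    by (rule partial_deriv_eq[OF conv_has_derivative[OF assms(1-6)]])
  also have "\<dots> = (\<Sum>c\<in>Basis. if b = c then conv K t (partial_deriv c v) x else 0)"
    using assms(7) by (intro sum.cong) (auto simp: inner_Basis)
  finally show ?thesis using assms(7) by simp
qed

text \<open>The mean is as smooth as \<open>K\<close>, whatever the regularity of \<open>v\<close>
  beyond C^1: a derivative is taken on \<open>v\<close> and moved to \<open>K\<close> at the price
  of \<open>- 1 / t\<close>. In the induction \<open>v\<close> stays fixed and \<open>K\<close> is
  replaced by its derivatives.\<close>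

lemma C_k_on_conv:
  fixes v :: "'a::euclidean_space \<Rightarrow> complex"
  assumes S: "open S" and v: "C_k_on 1 S v" and t: "t \<noteq> 0"
    and U: "open U" "convex U" and inS: "\<And>x y. x \<in> U \<Longrightarrow> y \<in> cube \<Longrightarrow> x + t *\<^sub>R y \<in> S"
    and "C_k_on k UNIV K" and "\<And>y. 1 < norm y \<Longrightarrow> K y = 0"
  shows "C_k_on k U (conv K t v)"
  using assms(7,8)
proof (induction k arbitrary: K)
  case 0
  then show ?case
    using has_derivative_continuous[OF conv_has_derivative[OF v _ U inS]]
    by (auto intro!: continuous_at_imp_continuous_on)
next
  case (Suc k)
  have K: "continuous_on UNIV K" "C_k_on 1 UNIV K"
    using C_k_on_imp_continuous_on[OF Suc.prems(1)] C_k_on_le[OF Suc.prems(1), of 1] by auto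
  have "C_k_on k U (partial_deriv b (conv K t v))" if b: "b \<in> Basis" for b
  proof (subst C_k_on_cong[OF U(1)])
    show "partial_deriv b (conv K t v) x = - 1 / of_real t * conv (partial_deriv b K) t v x"
      if "x \<in> U" for x
      using partial_deriv_conv[OF v K(1) U inS that b]
        conv_partial_deriv[OF S v K(2) Suc.prems(2) b inS[OF that]] t
      by simp
    show "C_k_on k U (\<lambda>x. - 1 / of_real t * conv (partial_deriv b K) t v x)"
      using Suc.prems b partial_deriv_supp[OF Suc.prems(2)]
      by (intro C_k_on_cmult U Suc.IH) auto
  qed
  moreover have "conv K t v differentiable (at x)" if "x \<in> U" for x
    using conv_has_derivative[OF v K(1) U inS that] differentiable_def by blast
  ultimately show ?case by simp
qed

subsection \<open>A reproducing formula for polyharmonic functions\<close>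

lemma conv_has_vector_derivative_scale:
  fixes v :: "'a::euclidean_space \<Rightarrow> complex"
  assumes v: "C_k_on 1 S v" and K: "continuous_on UNIV K"
    and inS: "\<And>t y. t \<in> {0..T} \<Longrightarrow> y \<in> cube \<Longrightarrow> x + t *\<^sub>R y \<in> S"
    and t: "t \<in> {0..T}"
  shows "((\<lambda>t. conv K t v x) has_vector_derivative
    (\<Sum>b\<in>Basis. conv (\<lambda>y. complex_of_real (y \<bullet> b) * K y) t (partial_deriv b v) x)) (at t within {0..T})"
proof -
  define F where "F t y = (\<Sum>b\<in>Basis. partial_deriv b v (x + t *\<^sub>R y) * (complex_of_real (y \<bullet> b) * K y))" for t y
  have dv: "continuous_on S (partial_deriv b v)" if "b \<in> Basis" for b
    using v that by auto
  have contF: "continuous_on ({0..T} \<times> cube) (\<lambda>(t, y). F t y)"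
    unfolding split_beta F_def
    by (intro continuous_on_sum continuous_on_mult continuous_on_compose2[OF dv] continuous_on_compose2[OF K])
      (use inS in \<open>auto intro!: continuous_intros\<close>)
  have "((\<lambda>t. integral (cbox (- (2 *\<^sub>R One)) (2 *\<^sub>R One)) (\<lambda>y. v (x + t *\<^sub>R y) * K y)) has_vector_derivative
      integral (cbox (- (2 *\<^sub>R One)) (2 *\<^sub>R One)) (F t)) (at t within {0..T})"
  proof (rule leibniz_rule_vector_derivative)
    fix t :: real and y :: 'a assume ty: "t \<in> {0..T}" "y \<in> cbox (- (2 *\<^sub>R One)) (2 *\<^sub>R One)"
    then have "v differentiable (at (x + t *\<^sub>R y))"
      using v inS by (auto simp: cube_def)
    from has_derivative_partial_deriv[OF this]
    have D: "(v has_derivative (\<lambda>h. \<Sum>b\<in>Basis. (h \<bullet> b) *\<^sub>R partial_deriv b v (x + t *\<^sub>R y))) (at (x + t *\<^sub>R y))" .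
    have "((\<lambda>t. x + t *\<^sub>R y) has_derivative (\<lambda>h. h *\<^sub>R y)) (at t)"
      by (auto intro!: derivative_eq_intros)
    from has_derivative_mult_left[OF has_derivative_compose[OF this D], of "K y"]
    have "((\<lambda>t. v (x + t *\<^sub>R y) * K y) has_vector_derivative F t y) (at t)"
      unfolding has_vector_derivative_def
      by (rule has_derivative_eq_rhs)
        (simp add: fun_eq_iff F_def sum_distrib_right sum_distrib_left scaleR_conv_of_real mult_ac)
    then show "((\<lambda>t. v (x + t *\<^sub>R y) * K y) has_vector_derivative F t y) (at t within {0..T})"
      by (rule has_vector_derivative_at_within)
  next
    fix t assume "t \<in> {0..T}"
    then have "continuous_on cube (\<lambda>y. v (x + t *\<^sub>R y) * K y)"
      using C_k_on_imp_continuous_on[OF v] K inS by (intro continuous_on_conv_integrand) auto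
    from integrable_on_cube[OF this]
    show "(\<lambda>y. v (x + t *\<^sub>R y) * K y) integrable_on cbox (- (2 *\<^sub>R One)) (2 *\<^sub>R One)"
      by (simp add: cube_def)
  qed (use contF t in \<open>auto simp: cube_def\<close>)
  then have "((\<lambda>t. conv K t v x) has_vector_derivative integral cube (F t)) (at t within {0..T})"
    by (simp add: cube_def conv_def[abs_def])
  moreover have "integral cube (F t) =
      (\<Sum>b\<in>Basis. conv (\<lambda>y. complex_of_real (y \<bullet> b) * K y) t (partial_deriv b v) x)"
    unfolding F_def conv_def
  proof (rule integral_sum)
    show "(\<lambda>y. partial_deriv b v (x + t *\<^sub>R y) * (complex_of_real (y \<bullet> b) * K y)) integrable_on cube"
      if "b \<in> Basis" for b
      using dv[OF that] inS t
      by (intro integrable_on_cube continuous_on_conv_integrand) (auto intro!: continuous_intros K)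
  qed simp
  ultimately show ?thesis by simp
qed

text \<open>Differentiating in the scale brings down \<open>y\<close> times the gradient of
  \<open>u\<close>. Since \<open>y\<close> times the kernel is again a gradient, one integration by
  parts produces the Laplacian, with the next kernel of the family.\<close>

lemma conv_bump_has_vector_derivative:
  fixes u :: "'a::euclidean_space \<Rightarrow> complex"
  assumes S: "open S" and u: "C_k_on 2 S u"
    and inS: "\<And>t y. t \<in> {0..T} \<Longrightarrow> y \<in> cube \<Longrightarrow> x + t *\<^sub>R y \<in> S"
    and t: "t \<in> {0..T}"
  shows "((\<lambda>t. conv (bump (Suc m)) t u x) has_vector_derivative
    of_real t / of_nat (2 * Suc (Suc m)) * conv (bump (Suc (Suc m))) t (laplacian u) x) (at t within {0..T})"
proof -
  have du: "C_k_on 1 S (partial_deriv b u)" if "b \<in> Basis" for b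
    using u that by (simp add: numeral_2_eq_2)
  have cb: "continuous_on UNIV (bump (Suc m) :: 'a \<Rightarrow> complex)" for m
    using C_k_on_bump[of 0 "Suc m"] by simp
  \<comment> \<open>\<open>partial_deriv_bump\<close> contributes the constant
    \<open>- 2 * (m + 2)\<close> and integration by parts the factor \<open>- t\<close>; the signs
    cancel.\<close>
  have *: "conv (\<lambda>y. complex_of_real (y \<bullet> b) * bump (Suc m) y) t (partial_deriv b u) x =
      of_real t / of_nat (2 * Suc (Suc m)) * conv (bump (Suc (Suc m))) t (partial_deriv b (partial_deriv b u)) x"
    (is "?C = _") if b: "b \<in> Basis" for b
  proof -
    have "conv (partial_deriv b (bump (Suc (Suc m)))) t (partial_deriv b u) x =
        - of_real t * conv (bump (Suc (Suc m))) t (partial_deriv b (partial_deriv b u)) x"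
      by (rule conv_partial_deriv[OF S du[OF b] C_k_on_bump _ b]) (auto intro: bump_eq_0 inS t)
    moreover have "conv (partial_deriv b (bump (Suc (Suc m)))) t (partial_deriv b u) x =
        - of_nat (2 * Suc (Suc m)) * ?C"
      unfolding conv_def integral_mult_right[symmetric] partial_deriv_bump
      by (rule integral_cong) (simp add: algebra_simps)
    ultimately have "of_nat (2 * Suc (Suc m)) * ?C =
        of_real t * conv (bump (Suc (Suc m))) t (partial_deriv b (partial_deriv b u)) x"
      by (metis add.inverse_inverse minus_mult_left)
    moreover have "(of_nat (2 * Suc (Suc m)) :: complex) \<noteq> 0"
      unfolding of_nat_eq_0_iff by simp
    moreover have "X = z / C * Y" if "C * X = z * Y" "C \<noteq> 0" for C X Y z :: complex
      using that by (simp add: field_simps)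
    ultimately show ?thesis by blast
  qed
  have int: "(\<lambda>y. partial_deriv b (partial_deriv b u) (x + t *\<^sub>R y) * bump (Suc (Suc m)) y) integrable_on cube"
    if "b \<in> Basis" for b
    using u that inS t by (intro integrable_on_cube continuous_on_conv_integrand[of S] cb)
      (auto simp: numeral_2_eq_2)
  have "conv (bump (Suc (Suc m))) t (laplacian u) x =
      (\<Sum>b\<in>Basis. conv (bump (Suc (Suc m))) t (partial_deriv b (partial_deriv b u)) x)"
    unfolding conv_def laplacian_def sum_distrib_right by (intro integral_sum int) auto
  with * conv_has_vector_derivative_scale[OF C_k_on_le[OF u] cb inS t, of m]
  show ?thesis by (simp add: sum_distrib_left)
qed

lemma N_harmonic_laplacian:
  assumes "N_harmonic (Suc N) u"
  shows "N_harmonic N (laplacian u)"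
proof -
  have "C_k_on (2 * N) (ball 0 1) (laplacian u)"
    using assms by (intro C_k_on_laplacian) (auto simp: N_harmonic_def)
  then show ?thesis using assms by (simp add: N_harmonic_def funpow_swap1)
qed

text \<open>\<open>c\<close> is fixed before \<open>u\<close>, \<open>x\<close> and
  \<open>T\<close>, which makes all later constants uniform. \<open>m\<close> is free in the
  induction because passing to \<open>laplacian u\<close> raises the exponent of the bump. Both
  sides have the same derivative in \<open>t\<close> and agree at \<open>t = 0\<close>.\<close>

lemma conv_bump_polyharmonic:
  "\<exists>c :: nat \<Rightarrow> complex. c 0 = integral cube (bump (Suc m) :: 'a::euclidean_space \<Rightarrow> complex) \<and>
    (\<forall>(u :: 'a \<Rightarrow> complex) x T. N_harmonic N u \<longrightarrow> 0 \<le> T \<longrightarrow>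
      (\<forall>t\<in>{0..T}. \<forall>y\<in>cube. x + t *\<^sub>R y \<in> ball 0 1) \<longrightarrow>
      (\<forall>t\<in>{0..T}. conv (bump (Suc m)) t u x = (\<Sum>k<N. c k * of_real t ^ (2 * k) * (laplacian ^^ k) u x)))"
proof (induction N arbitrary: m)
  case 0
  have "conv (bump (Suc m)) t u x = 0"
    if "N_harmonic 0 u" "\<forall>t\<in>{0..T}. \<forall>y\<in>cube. x + t *\<^sub>R y \<in> ball 0 1" "t \<in> {0..T}"
    for u :: "'a \<Rightarrow> complex" and x T t
  proof -
    have "conv (bump (Suc m)) t u x = integral cube (\<lambda>y :: 'a. 0)"
      unfolding conv_def using that by (intro integral_cong) (auto simp: N_harmonic_def)
    then show ?thesis by simp
  qed
  then show ?case
    by (intro exI[of _ "\<lambda>_. integral cube (bump (Suc m))"]) auto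
next
  case (Suc N)
  obtain c' :: "nat \<Rightarrow> complex" where c': "\<And>(u :: 'a \<Rightarrow> complex) x T t. N_harmonic N u \<Longrightarrow> 0 \<le> T \<Longrightarrow>
      (\<forall>t\<in>{0..T}. \<forall>y\<in>cube. x + t *\<^sub>R y \<in> ball 0 1) \<Longrightarrow> t \<in> {0..T} \<Longrightarrow>
      conv (bump (Suc (Suc m))) t u x = (\<Sum>k<N. c' k * of_real t ^ (2 * k) * (laplacian ^^ k) u x)"
    using Suc.IH[of "Suc m"] by blast
  \<comment> \<open>Integrating \<open>t ^ (2 * k + 1)\<close> divides by
    \<open>2 * (k + 1)\<close>; the other divisor is the constant of the derivative formula.\<close>
  define c where "c k = (case k of 0 \<Rightarrow> integral cube (bump (Suc m) :: 'a \<Rightarrow> complex)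
      | Suc k \<Rightarrow> c' k / of_nat (2 * Suc (Suc m)) / of_nat (2 * Suc k))" for k
  have "conv (bump (Suc m)) t u x = (\<Sum>k<Suc N. c k * of_real t ^ (2 * k) * (laplacian ^^ k) u x)"
    if u: "N_harmonic (Suc N) u" and T: "0 \<le> T"
      and inS: "\<forall>t\<in>{0..T}. \<forall>y\<in>cube. x + t *\<^sub>R y \<in> ball 0 1" and t: "t \<in> {0..T}"
    for u :: "'a \<Rightarrow> complex" and x T t
  proof -
    define P where "P t = (\<Sum>k<Suc N. c k * of_real t ^ (2 * k) * (laplacian ^^ k) u x)" for t :: real
    have P_eq: "P t = c 0 * u x + (\<Sum>k<N. c (Suc k) * of_real t ^ (2 * Suc k) * (laplacian ^^ Suc k) u x)" for t
      unfolding P_def by (subst sum.lessThan_Suc_shift) simp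
    have "((\<lambda>t. of_real t ^ (2 * Suc k) :: complex) has_vector_derivative
        of_nat (2 * Suc k) * of_real t ^ (2 * k + 1)) (at t within A)" for k t A
    proof -
      have "((\<lambda>t. t ^ (2 * Suc k)) has_field_derivative real (2 * Suc k) * t ^ (2 * k + 1)) (at t within A)"
        using DERIV_pow[of "2 * Suc k" t A] by simp
      from has_vector_derivative_of_real[OF this, where ?'a=complex] show ?thesis
        by simp
    qed
    then have dP0: "(P has_vector_derivative 0 + (\<Sum>k<N. c (Suc k) * (of_nat (2 * Suc k) * of_real t ^ (2 * k + 1))
         * (laplacian ^^ Suc k) u x)) (at t within {0..T})" for t
      unfolding P_eq[abs_def]
      by (intro has_vector_derivative_add has_vector_derivative_const has_vector_derivative_sum
          has_vector_derivative_mult_left has_vector_derivative_mult_right)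
    have deq: "0 + (\<Sum>k<N. c (Suc k) * (of_nat (2 * Suc k) * of_real t ^ (2 * k + 1)) * (laplacian ^^ Suc k) u x)
        = of_real t / of_nat (2 * Suc (Suc m)) * conv (bump (Suc (Suc m))) t (laplacian u) x"
      if "t \<in> {0..T}" for t
    proof -
      have c: "c (Suc k) * of_nat (2 * Suc k) = c' k / of_nat (2 * Suc (Suc m))" for k
        by (simp add: c_def del: mult_Suc_right of_nat_Suc of_nat_mult)
      show ?thesis
        unfolding c'[OF N_harmonic_laplacian[OF u] T inS that] sum_distrib_left add_0
      proof (intro sum.cong refl)
        fix k
        have *: "a * (n * p) * L = z / M * (b * q * L)" if "a * n = b / M" "p = z * q"
          for a n p L z M b q :: complex
        proof -
          have "a * (n * p) * L = (a * n) * p * L" by (simp only: mult.assoc)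
          then show ?thesis unfolding that by simp
        qed
        have **: "(laplacian ^^ Suc k) u x = (laplacian ^^ k) (laplacian u) x"
          by (simp add: funpow_swap1)
        show "c (Suc k) * (of_nat (2 * Suc k) * of_real t ^ (2 * k + 1)) * (laplacian ^^ Suc k) u x =
          of_real t / of_nat (2 * Suc (Suc m)) * (c' k * of_real t ^ (2 * k) * (laplacian ^^ k) (laplacian u) x)"
          unfolding ** by (rule *[OF c]) simp
      qed
    qed
    have dP: "(P has_vector_derivative
        of_real t / of_nat (2 * Suc (Suc m)) * conv (bump (Suc (Suc m))) t (laplacian u) x) (at t within {0..T})"
      if "t \<in> {0..T}" for t
      using dP0[of t] unfolding deq[OF that] .
    have D: "((\<lambda>t. conv (bump (Suc m)) t u x - P t) has_vector_derivative 0) (at t within {0..T})"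
      if "t \<in> {0..T}" for t
    proof -
      have "C_k_on 2 (ball 0 1) u"
        using u C_k_on_le[of "2 * Suc N" "ball 0 1" u 2] unfolding N_harmonic_def by simp
      then have "((\<lambda>t. conv (bump (Suc m)) t u x) has_vector_derivative
          of_real t / of_nat (2 * Suc (Suc m)) * conv (bump (Suc (Suc m))) t (laplacian u) x)
          (at t within {0..T})"
        using inS that by (intro conv_bump_has_vector_derivative) auto
      from has_vector_derivative_diff[OF this dP[OF that]] show ?thesis by simp
    qed
    obtain C where C: "\<And>t. t \<in> {0..T} \<Longrightarrow> conv (bump (Suc m)) t u x - P t = C"
      using has_vector_derivative_zero_constant[OF _ D] by auto
    \<comment> \<open>Scale 0 gives \<open>u x\<close> times the integral of the bump, which is why
      \<open>c 0\<close> has this value.\<close>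
    have "conv (bump (Suc m)) 0 u x = P 0"
      by (simp add: P_eq conv_def c_def)
    then have "conv (bump (Suc m)) t u x = P t"
      using C[of 0] C[OF t] T by simp
    then show ?thesis unfolding P_def .
  qed
  then show ?case
    by (intro exI[of _ c]) (auto simp: c_def)
qed

text \<open>A continuous nonnegative function with integral 0 vanishes, but the bump is 1 at the
  origin. Needed to divide by \<open>c 0\<close>.\<close>

lemma integral_bump_neq_0: "integral cube (bump (Suc m) :: 'a::euclidean_space \<Rightarrow> complex) \<noteq> 0"
proof
  define f where "f y = (max 0 (1 - (norm y)\<^sup>2)) ^ Suc m" for y :: 'a
  have cont: "continuous_on A f" for A
    unfolding f_def[abs_def] by (intro continuous_intros)
  assume "integral cube (bump (Suc m) :: 'a \<Rightarrow> complex) = 0"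
  moreover have "integral cube (bump (Suc m) :: 'a \<Rightarrow> complex) = of_real (integral cube f)"
    using integral_linear[OF integrable_on_cube[OF cont] bounded_linear_of_real]
    by (simp add: bump_def[abs_def] f_def o_def)
  ultimately have "(f has_integral 0) cube"
    using integrable_integral[OF integrable_on_cube[OF cont]] by simp
  then have "f 0 = 0"
    unfolding cube_def
    by (rule has_integral_0_cbox_imp_0[OF cont, rotated 1]) (auto simp: f_def mem_box box_eq_empty)
  then show False by (simp add: f_def)
qed

section \<open>Extrapolation to scale 0\<close>

text \<open>The \<open>a i\<close> are the coefficients of the polynomial with value 1 at 1 and
  zeros at \<open>1/4, ..., (1/4)^N\<close>. Quarters occur because halving the scale multiplies
  \<open>t ^ (2 * k)\<close> by \<open>(1/4) ^ k\<close>.\<close>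

lemma extrapolation_weights:
  "\<exists>a :: nat \<Rightarrow> real. \<forall>k\<le>N. (\<Sum>i\<le>N. a i * ((1/4) ^ k) ^ i) = (if k = 0 then 1 else 0)"
proof (induction N)
  case 0
  show ?case by (intro exI[of _ "\<lambda>_. 1"]) simp
next
  case (Suc N)
  then obtain a :: "nat \<Rightarrow> real"
    where a: "\<And>k. k \<le> N \<Longrightarrow> (\<Sum>i\<le>N. a i * ((1/4) ^ k) ^ i) = (if k = 0 then 1 else 0)"
    by blast
  define q :: real where "q = (1/4) ^ Suc N"
  have q: "q \<noteq> 1" unfolding q_def using power_less_one_iff[of "1/4::real" "Suc N"] by simp
  \<comment> \<open>Coefficients of the old polynomial times \<open>(x - q) / (1 - q)\<close>, which
    adds the zero \<open>q\<close> and keeps the value at 1.\<close>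
  define a' where "a' i = ((case i of 0 \<Rightarrow> 0 | Suc j \<Rightarrow> a j) - (if i \<le> N then q * a i else 0)) / (1 - q)" for i
  have *: "(\<Sum>i\<le>Suc N. a' i * x ^ i) = (x - q) / (1 - q) * (\<Sum>i\<le>N. a i * x ^ i)" for x :: real
  proof -
    have "(\<Sum>i\<le>Suc N. a' i * x ^ i) * (1 - q) =
        (\<Sum>i\<le>Suc N. (case i of 0 \<Rightarrow> 0 | Suc j \<Rightarrow> a j) * x ^ i) - (\<Sum>i\<le>Suc N. (if i \<le> N then q * a i else 0) * x ^ i)"
      unfolding sum_distrib_right sum_subtractf[symmetric]
      by (intro sum.cong) (use q in \<open>auto simp: a'_def field_simps\<close>)
    also have "(\<Sum>i\<le>Suc N. (case i of 0 \<Rightarrow> 0 | Suc j \<Rightarrow> a j) * x ^ i) = x * (\<Sum>i\<le>N. a i * x ^ i)"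
      by (subst sum.atMost_Suc_shift) (simp add: sum_distrib_left mult_ac)
    also have "(\<Sum>i\<le>Suc N. (if i \<le> N then q * a i else 0) * x ^ i) = q * (\<Sum>i\<le>N. a i * x ^ i)"
      by (simp add: sum_distrib_left mult_ac)
    finally show ?thesis using q by (simp add: field_simps)
  qed
  have "(\<Sum>i\<le>Suc N. a' i * ((1/4) ^ k) ^ i) = (if k = 0 then 1 else 0)" if "k \<le> Suc N" for k
  proof (cases "k = Suc N")
    case True
    show ?thesis unfolding True q_def[symmetric] * by simp
  next
    case False
    with that have "k \<le> N" by simp
    with a q show ?thesis unfolding * by (auto simp: divide_simps)
  qed
  then show ?case by blast
qed

text \<open>Weighting the scales \<open>T / 2 ^ i\<close> kills every positive power of
  \<open>T\<close> and leaves \<open>c 0 * u x\<close>. The coefficients depend on neither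
  \<open>u\<close>, \<open>x\<close> nor \<open>T\<close>, so estimates for the means carry over to
  \<open>u\<close> uniformly.\<close>

lemma reproducing_formula:
  "\<exists>a :: nat \<Rightarrow> complex. \<forall>(u :: 'a::euclidean_space \<Rightarrow> complex) x T. N_harmonic N u \<longrightarrow> 0 \<le> T \<longrightarrow>
      (\<forall>t\<in>{0..T}. \<forall>y\<in>cube. x + t *\<^sub>R y \<in> ball 0 1) \<longrightarrow>
      u x = (\<Sum>i\<le>N. a i * conv (bump (Suc m)) (T / 2 ^ i) u x)"
proof -
  obtain c :: "nat \<Rightarrow> complex" where c0: "c 0 = integral cube (bump (Suc m) :: 'a \<Rightarrow> complex)"
    and c: "\<And>(u :: 'a \<Rightarrow> complex) x T t. N_harmonic N u \<Longrightarrow> 0 \<le> T \<Longrightarrow>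
      (\<forall>t\<in>{0..T}. \<forall>y\<in>cube. x + t *\<^sub>R y \<in> ball 0 1) \<Longrightarrow> t \<in> {0..T} \<Longrightarrow>
      conv (bump (Suc m)) t u x = (\<Sum>k<N. c k * of_real t ^ (2 * k) * (laplacian ^^ k) u x)"
    using conv_bump_polyharmonic[of m N] by blast
  obtain a :: "nat \<Rightarrow> real"
    where a: "\<And>k. k \<le> N \<Longrightarrow> (\<Sum>i\<le>N. a i * ((1/4) ^ k) ^ i) = (if k = 0 then 1 else 0)"
    using extrapolation_weights[of N] by blast
  have "u x = (\<Sum>i\<le>N. (of_real (a i) / c 0) * conv (bump (Suc m)) (T / 2 ^ i) u x)"
    if u: "N_harmonic N u" and T: "0 \<le> T"
      and inS: "\<forall>t\<in>{0..T}. \<forall>y\<in>cube. x + t *\<^sub>R y \<in> ball 0 1"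
    for u :: "'a \<Rightarrow> complex" and x T
  proof (cases N)
    \<comment> \<open>The polynomial is empty for \<open>N = 0\<close> and has no constant term to
      extract; both sides vanish separately.\<close>
    case 0
    have "0 \<in> (cube :: 'a set)" using cball_subset_cube by force
    then have "x + 0 *\<^sub>R 0 \<in> ball 0 1" using inS T by (metis atLeastAtMost_iff order_refl)
    then have "u x = 0" using u 0 by (simp add: N_harmonic_def)
    moreover have "conv (bump (Suc m)) (T / 2 ^ 0) u x = 0"
      using c[OF u T inS, of "T / 2 ^ 0"] T 0 by simp
    ultimately show ?thesis using 0 by simp
  next
    case (Suc M)
    have "conv (bump (Suc m)) (T / 2 ^ i) u x =
        (\<Sum>k<N. c k * of_real (((1/4) ^ k) ^ i * T ^ (2 * k)) * (laplacian ^^ k) u x)" for i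
    proof -
      have "T / 2 ^ i \<le> T / 1" using T by (intro divide_left_mono) auto
      then have "T / 2 ^ i \<in> {0..T}" using T by auto
      moreover have "(T / 2 ^ i) ^ (2 * k) = ((1/4) ^ k) ^ i * T ^ (2 * k)" for k
      proof -
        have "(2 ^ i) ^ (2 * k) = (4 :: real) ^ (k * i)"
        proof -
          have "(4 :: real) = 2 ^ 2" by simp
          then show ?thesis by (simp only: power_mult[symmetric] mult_ac)
        qed
        then show ?thesis by (simp add: power_divide power_mult[symmetric])
      qed
      ultimately show ?thesis
        using c[OF u T inS] by (simp flip: of_real_power)
    qed
    then have "(\<Sum>i\<le>N. of_real (a i) * conv (bump (Suc m)) (T / 2 ^ i) u x) =
        (\<Sum>k<N. \<Sum>i\<le>N. of_real (a i) * (c k * of_real (((1/4) ^ k) ^ i * T ^ (2 * k)) * (laplacian ^^ k) u x))"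
      by (simp add: sum_distrib_left) (rule sum.swap)
    also have "\<dots> = (\<Sum>k<N. of_real (\<Sum>i\<le>N. a i * ((1/4) ^ k) ^ i) * (c k * of_real (T ^ (2 * k)) * (laplacian ^^ k) u x))"
      by (intro sum.cong refl) (simp add: sum_distrib_left sum_distrib_right mult_ac)
    also have "\<dots> = (\<Sum>k<N. if k = 0 then c 0 * u x else 0)"
      by (intro sum.cong refl) (simp add: a del: of_real_sum)
    also have "\<dots> = c 0 * u x" using Suc by simp
    finally have "c 0 * u x = (\<Sum>i\<le>N. of_real (a i) * conv (bump (Suc m)) (T / 2 ^ i) u x)" by simp
    moreover have "c 0 \<noteq> 0" using c0 integral_bump_neq_0 by simp
    ultimately have "u x = (\<Sum>i\<le>N. of_real (a i) * conv (bump (Suc m)) (T / 2 ^ i) u x) / c 0"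
      by (simp add: field_simps)
    then show ?thesis by (simp add: sum_divide_distrib)
  qed
  then show ?thesis by (intro exI[of _ "\<lambda>i. of_real (a i) / c 0"]) blast
qed

lemma add_scaleR_cube_in_ball:
  fixes x y :: "'a::euclidean_space" and t :: real
  assumes "y \<in> cube" "0 \<le> t" "norm x + t * (2 * DIM('a)) < r"
  shows "x + t *\<^sub>R y \<in> ball 0 r"
proof -
  have "norm (x + t *\<^sub>R y) \<le> norm x + t * norm y"
    using norm_triangle_ineq[of x "t *\<^sub>R y"] assms by simp
  also have "\<dots> \<le> norm x + t * (2 * DIM('a))"
    using norm_cube[OF assms(1)] assms(2) by (intro add_mono mult_left_mono) auto
  finally show ?thesis using assms by simp
qed

text \<open>In the reproducing formula derivatives can be moved onto the bump functions, which
  may be chosen as smooth as desired.\<close>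

lemma N_harmonic_C_k_on:
  fixes u :: "'a::euclidean_space \<Rightarrow> complex"
  assumes u: "N_harmonic N u"
  shows "C_k_on k (ball 0 1) u"
proof (cases N)
  \<comment> \<open>Here the hypothesis gives mere continuity, not the C^1 required by
    \<open>C_k_on_conv\<close>, but \<open>u\<close> is 0 on the ball.\<close>
  case 0
  then have "\<And>x. x \<in> ball 0 1 \<Longrightarrow> u x = 0" using u by (simp add: N_harmonic_def)
  then show ?thesis
    by (subst C_k_on_cong[where g="\<lambda>x. 0"]) (auto intro: C_k_on_const)
next
  case (Suc M)
  obtain a :: "nat \<Rightarrow> complex" where a: "\<And>x T. 0 \<le> T \<Longrightarrow>
      (\<forall>t\<in>{0..T}. \<forall>y\<in>cube. x + t *\<^sub>R y \<in> ball 0 1) \<Longrightarrow>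
      u x = (\<Sum>i\<le>N. a i * conv (bump (Suc k)) (T / 2 ^ i) u x)"
    using reproducing_formula[of N k] u by blast
  show ?thesis
  proof (rule C_k_on_local)
    fix x0 :: 'a assume "x0 \<in> ball 0 1"
    \<comment> \<open>The distance to the sphere is split in two halves: one for moving
      \<open>x\<close> away from \<open>x0\<close>, one for the shift by \<open>T\<close> times the
      cube.\<close>
    define r where "r = (1 - norm x0) / 2"
    have r: "r > 0" using \<open>x0 \<in> ball 0 1\<close> by (simp add: r_def)
    define T where "T = r / (2 * DIM('a))"
    have T: "T > 0" using r by (simp add: T_def)
    have inS: "x + t *\<^sub>R y \<in> ball 0 1" if "x \<in> ball x0 r" "t \<in> {0..T}" "y \<in> cube" for x t y
    proof (rule add_scaleR_cube_in_ball)
      have "norm x < norm x0 + r"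
        using that(1) norm_triangle_ineq[of x0 "x - x0"] by (simp add: dist_norm norm_minus_commute)
      moreover have "t * (2 * DIM('a)) \<le> T * (2 * DIM('a))"
        using that(2) by (intro mult_right_mono) auto
      moreover have "T * (2 * DIM('a)) = r" by (simp add: T_def)
      moreover have "a + p < 1" if "a < norm x0 + r" "p \<le> q" "q = r" for a p q
        using that by (simp add: r_def field_simps)
      ultimately show "norm x + t * (2 * DIM('a)) < 1" by blast
    qed (use that in auto)
    have "C_k_on k (ball x0 r) (\<lambda>x. \<Sum>i\<le>N. a i * conv (bump (Suc k)) (T / 2 ^ i) u x)"
    proof (intro C_k_on_sum C_k_on_cmult C_k_on_conv)
      show "C_k_on 1 (ball 0 1) u"
        using u Suc C_k_on_le[of "2 * N" "ball 0 1" u 1] unfolding N_harmonic_def by simp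
      show "x + (T / 2 ^ i) *\<^sub>R y \<in> ball 0 1" if "x \<in> ball x0 r" "y \<in> cube" for x y i
      proof -
        have "T / 2 ^ i \<le> T / 1" using T by (intro divide_left_mono) auto
        then show ?thesis using that inS T by simp
      qed
    qed (use T in \<open>auto intro: C_k_on_bump bump_eq_0\<close>)
    moreover have "u x = (\<Sum>i\<le>N. a i * conv (bump (Suc k)) (T / 2 ^ i) u x)" if "x \<in> ball x0 r" for x
      using a[of T x] T inS that by auto
    ultimately have "C_k_on k (ball x0 r) u"
      by (subst C_k_on_cong) auto
    then show "\<exists>U. open U \<and> x0 \<in> U \<and> C_k_on k U u"
      using r by (intro exI[of _ "ball x0 r"]) auto
  qed
qed

subsection \<open>Interior estimates\<close>

lemma borel_measurable_ennreal_indicator: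
  fixes f :: "'a::topological_space \<Rightarrow> real"
  assumes "A \<in> sets borel" "continuous_on A f"
  shows "(\<lambda>x. ennreal (f x) * indicator A x) \<in> borel_measurable borel"
proof -
  have "(\<lambda>x. ennreal (indicator A x *\<^sub>R f x)) \<in> borel_measurable borel"
    using borel_measurable_continuous_on_indicator[OF assms] by measurable
  moreover have "ennreal (indicator A x *\<^sub>R f x) = ennreal (f x) * indicator A x" for x
    by (auto simp: indicator_def)
  ultimately show ?thesis by simp
qed

text \<open>The bridge between the gauge integral defining \<open>conv\<close> and the Lebesgue
  integral defining the weighted spaces.\<close>

lemma norm_integral_cube_le:
  fixes f :: "'a::euclidean_space \<Rightarrow> complex"
  assumes "continuous_on cube f"
  shows "ennreal (norm (integral cube f)) \<le> (\<integral>\<^sup>+y\<in>cube. ennreal (norm (f y)) \<partial>lborel)"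
proof -
  have "set_integrable lborel cube f"
    unfolding set_integrable_def using assms by (intro borel_integrable_compact) auto
  moreover from this have "integral cube f = (LINT y|lborel. indicator cube y *\<^sub>R f y)"
    using set_borel_integral_eq_integral(2) by (metis set_lebesgue_integral_def)
  ultimately have "ennreal (norm (integral cube f)) \<le> (\<integral>\<^sup>+y. ennreal (norm (indicator cube y *\<^sub>R f y)) \<partial>lborel)"
    unfolding set_integrable_def using integral_norm_bound_ennreal by metis
  also have "\<dots> = (\<integral>\<^sup>+y\<in>cube. ennreal (norm (f y)) \<partial>lborel)"
    by (intro nn_integral_cong) (auto simp: indicator_def)
  finally show ?thesis .
qed

lemma nn_integral_lborel_affine:
  fixes x :: "'a::euclidean_space"
  assumes f: "f \<in> borel_measurable borel" and t: "t > 0"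
  shows "(\<integral>\<^sup>+y. f (x + t *\<^sub>R y) \<partial>lborel) = ennreal (1 / t ^ DIM('a)) * (\<integral>\<^sup>+z. f z \<partial>lborel)"
proof -
  have "(\<integral>\<^sup>+z. f z \<partial>lborel) = (\<integral>\<^sup>+z. f z \<partial>density (distr lborel borel (\<lambda>y. x + t *\<^sub>R y)) (\<lambda>_. ennreal (\<bar>t\<bar> ^ DIM('a))))"
    using lborel_affine[of t x] t by simp
  also have "\<dots> = ennreal (t ^ DIM('a)) * (\<integral>\<^sup>+y. f (x + t *\<^sub>R y) \<partial>lborel)"
    using f t by (simp add: nn_integral_density nn_integral_distr nn_integral_cmult)
  finally have "ennreal (1 / t ^ DIM('a)) * (\<integral>\<^sup>+z. f z \<partial>lborel) =
      ennreal (1 / t ^ DIM('a) * t ^ DIM('a)) * (\<integral>\<^sup>+y. f (x + t *\<^sub>R y) \<partial>lborel)"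
    using t by (simp add: mult.assoc[symmetric] ennreal_mult[symmetric])
  then show ?thesis using t by simp
qed

text \<open>The bump is dominated by the indicator of the closed unit ball, and the power of
  \<open>t\<close> is the Jacobian of \<open>z = x + t *\<^sub>R y\<close>.\<close>

lemma norm_conv_bump_le:
  fixes u :: "'a::euclidean_space \<Rightarrow> complex"
  assumes u: "continuous_on S u" and inS: "\<And>y. y \<in> cube \<Longrightarrow> x + t *\<^sub>R y \<in> S" and t: "t > 0"
  shows "ennreal (norm (conv (bump (Suc m)) t u x))
    \<le> ennreal (1 / t ^ DIM('a)) * (\<integral>\<^sup>+z\<in>cball x t. ennreal (norm (u z)) \<partial>lborel)"
proof -
  have sub: "cball x t \<subseteq> S"
  proof
    fix z assume "z \<in> cball x t"
    then have "(1 / t) *\<^sub>R (z - x) \<in> cball 0 2"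
      using t by (simp add: dist_norm norm_minus_commute divide_simps)
    then have "x + t *\<^sub>R ((1 / t) *\<^sub>R (z - x)) \<in> S"
      using cball_subset_cube inS by blast
    then show "z \<in> S" using t by simp
  qed
  have cb: "continuous_on UNIV (bump (Suc m) :: 'a \<Rightarrow> complex)"
    using C_k_on_bump[of 0 "Suc m"] by simp
  have "ennreal (norm (conv (bump (Suc m)) t u x))
      \<le> (\<integral>\<^sup>+y\<in>cube. ennreal (norm (u (x + t *\<^sub>R y) * bump (Suc m) y)) \<partial>lborel)"
    unfolding conv_def using continuous_on_conv_integrand[OF u cb inS] by (rule norm_integral_cube_le)
  also have "\<dots> \<le> (\<integral>\<^sup>+y. ennreal (norm (u (x + t *\<^sub>R y))) * indicator (cball x t) (x + t *\<^sub>R y) \<partial>lborel)"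
  proof (rule nn_integral_mono)
    fix y :: 'a
    show "ennreal (norm (u (x + t *\<^sub>R y) * bump (Suc m) y)) * indicator cube y
        \<le> ennreal (norm (u (x + t *\<^sub>R y))) * indicator (cball x t) (x + t *\<^sub>R y)"
    proof (cases "norm y \<le> 1")
      case True
      then have "x + t *\<^sub>R y \<in> cball x t" using t by (simp add: dist_norm)
      moreover have "norm (u (x + t *\<^sub>R y) * bump (Suc m) y) \<le> norm (u (x + t *\<^sub>R y))"
        using norm_bump_le_1[of "Suc m" y] by (simp add: norm_mult mult_left_le)
      ultimately show ?thesis by (auto simp: indicator_def ennreal_leI)
    next
      case False
      then show ?thesis using bump_eq_0[of "Suc m" y] by simp
    qed
  qed
  also have "\<dots> = ennreal (1 / t ^ DIM('a)) * (\<integral>\<^sup>+z\<in>cball x t. ennreal (norm (u z)) \<partial>lborel)"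
    using continuous_on_subset[OF u sub] t
    by (intro nn_integral_lborel_affine borel_measurable_ennreal_indicator continuous_on_norm) auto
  finally show ?thesis .
qed

text \<open>The mean value inequality for exponent 1: every scale \<open>T / 2 ^ i\<close> of the
  reproducing formula only sees \<open>cball x T\<close>.\<close>

lemma N_harmonic_le_integral:
  "\<exists>C>0. \<forall>(u :: 'a::euclidean_space \<Rightarrow> complex) x (T :: real). N_harmonic N u \<longrightarrow> 0 < T \<longrightarrow>
      norm x + T * (2 * DIM('a)) < 1 \<longrightarrow>
      ennreal (norm (u x)) \<le> ennreal (C / T ^ DIM('a)) * (\<integral>\<^sup>+z\<in>cball x T. ennreal (norm (u z)) \<partial>lborel)"
proof -
  obtain a :: "nat \<Rightarrow> complex" where a: "\<And>(u :: 'a \<Rightarrow> complex) x T. N_harmonic N u \<Longrightarrow> 0 \<le> T \<Longrightarrow>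
      (\<forall>t\<in>{0..T}. \<forall>y\<in>cube. x + t *\<^sub>R y \<in> ball 0 1) \<Longrightarrow>
      u x = (\<Sum>i\<le>N. a i * conv (bump (Suc 0)) (T / 2 ^ i) u x)"
    using reproducing_formula[of N 0] by blast
  \<comment> \<open>The Jacobian at scale \<open>T / 2 ^ i\<close> accounts for
    \<open>(2 ^ i) ^ DIM('a)\<close>; the summand 1 makes \<open>C\<close> positive.\<close>
  define C where "C = (\<Sum>i\<le>N. norm (a i) * (2 ^ i) ^ DIM('a)) + 1"
  have "C > 0" unfolding C_def by (intro add_nonneg_pos sum_nonneg) auto
  moreover have "ennreal (norm (u x)) \<le> ennreal (C / T ^ DIM('a)) * (\<integral>\<^sup>+z\<in>cball x T. ennreal (norm (u z)) \<partial>lborel)"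
    if u: "N_harmonic N u" and T: "0 < T" and x: "norm x + T * (2 * DIM('a)) < 1"
    for u :: "'a \<Rightarrow> complex" and x and T :: real
  proof -
    let ?I = "\<integral>\<^sup>+z\<in>cball x T. ennreal (norm (u z)) \<partial>lborel"
    have inS: "x + t *\<^sub>R y \<in> ball 0 1" if "t \<in> {0..T}" "y \<in> cube" for t y
    proof (rule add_scaleR_cube_in_ball)
      have "t * (2 * DIM('a)) \<le> T * (2 * DIM('a))"
        using that by (intro mult_right_mono) auto
      with x show "norm x + t * (2 * DIM('a)) < 1" by linarith
    qed (use that in auto)
    have Ti: "T / 2 ^ i > 0" "T / 2 ^ i \<le> T" for i
    proof -
      have "T / 2 ^ i \<le> T / 1" using T by (intro divide_left_mono) auto
      then show "T / 2 ^ i > 0" "T / 2 ^ i \<le> T" using T by auto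
    qed
    have cont: "continuous_on (ball 0 1) u"
      using u C_k_on_imp_continuous_on unfolding N_harmonic_def by blast
    have term_le: "ennreal (norm (a i * conv (bump (Suc 0)) (T / 2 ^ i) u x)) \<le>
        ennreal (norm (a i) * (2 ^ i) ^ DIM('a) / T ^ DIM('a)) * ?I" for i
    proof -
      have "ennreal (norm (a i * conv (bump (Suc 0)) (T / 2 ^ i) u x)) =
          ennreal (norm (a i)) * ennreal (norm (conv (bump (Suc 0)) (T / 2 ^ i) u x))"
        by (simp add: norm_mult ennreal_mult)
      also have "ennreal (norm (conv (bump (Suc 0)) (T / 2 ^ i) u x)) \<le>
          ennreal (1 / (T / 2 ^ i) ^ DIM('a)) * (\<integral>\<^sup>+z\<in>cball x (T / 2 ^ i). ennreal (norm (u z)) \<partial>lborel)"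
        using Ti[of i] by (intro norm_conv_bump_le[OF cont inS]) auto
      also have "(\<integral>\<^sup>+z\<in>cball x (T / 2 ^ i). ennreal (norm (u z)) \<partial>lborel) \<le> ?I"
        using Ti(2)[of i] by (intro nn_integral_mono) (auto simp: indicator_def)
      also have "ennreal (norm (a i)) * (ennreal (1 / (T / 2 ^ i) ^ DIM('a)) * ?I) =
          ennreal (norm (a i) * (2 ^ i) ^ DIM('a) / T ^ DIM('a)) * ?I"
        using T by (simp add: mult.assoc[symmetric] ennreal_mult[symmetric] power_divide)
      finally show ?thesis by (simp add: mult_left_mono)
    qed
    have "u x = (\<Sum>i\<le>N. a i * conv (bump (Suc 0)) (T / 2 ^ i) u x)"
      using a[OF u] T inS by auto
    then have "norm (u x) \<le> (\<Sum>i\<le>N. norm (a i * conv (bump (Suc 0)) (T / 2 ^ i) u x))"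
      by (metis norm_sum)
    then have "ennreal (norm (u x)) \<le> (\<Sum>i\<le>N. ennreal (norm (a i * conv (bump (Suc 0)) (T / 2 ^ i) u x)))"
      by (simp add: ennreal_leI)
    also have "\<dots> \<le> (\<Sum>i\<le>N. ennreal (norm (a i) * (2 ^ i) ^ DIM('a) / T ^ DIM('a)) * ?I)"
      by (intro sum_mono term_le)
    also have "\<dots> = ennreal (\<Sum>i\<le>N. norm (a i) * (2 ^ i) ^ DIM('a) / T ^ DIM('a)) * ?I"
      using T by (simp add: sum_distrib_right[symmetric] sum_ennreal)
    also have "\<dots> \<le> ennreal (C / T ^ DIM('a)) * ?I"
      using T by (intro mult_right_mono ennreal_leI)
        (auto simp: C_def sum_divide_distrib[symmetric] divide_simps)
    finally show ?thesis .
  qed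
  ultimately show ?thesis by blast
qed

text \<open>A Cauchy-type estimate. One derivative has to go onto the kernel, so the exponent is 2,
  the smallest that makes the bump C^1.\<close>

lemma partial_deriv_le_sup:
  "\<exists>C>0. \<forall>(u :: 'a::euclidean_space \<Rightarrow> complex) x (T :: real) M b. N_harmonic N u \<longrightarrow> 0 < T \<longrightarrow>
      norm x + T * (2 * DIM('a)) < 1 \<longrightarrow> b \<in> Basis \<longrightarrow> (\<forall>z\<in>cball x T. norm (u z) \<le> M) \<longrightarrow>
      norm (partial_deriv b u x) \<le> C * M / T"
proof -
  obtain a :: "nat \<Rightarrow> complex" where a: "\<And>(u :: 'a \<Rightarrow> complex) x T. N_harmonic N u \<Longrightarrow> 0 \<le> T \<Longrightarrow>
      (\<forall>t\<in>{0..T}. \<forall>y\<in>cube. x + t *\<^sub>R y \<in> ball 0 1) \<Longrightarrow>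
      u x = (\<Sum>i\<le>N. a i * conv (bump (Suc 1)) (T / 2 ^ i) u x)"
    using reproducing_formula[of N 1] by blast
  define A where "A = measure lborel (cube :: 'a set)"
  \<comment> \<open>\<open>2 ^ i\<close> comes from moving the derivative at scale
    \<open>T / 2 ^ i\<close>, 4 bounds the partial derivatives of \<open>bump 2\<close>, and
    \<open>A\<close> is the volume of the cube.\<close>
  define C where "C = (\<Sum>i\<le>N. norm (a i) * 2 ^ i * 4 * A) + 1"
  have A: "A \<ge> 0" by (simp add: A_def)
  have "C > 0" unfolding C_def by (intro add_nonneg_pos sum_nonneg) (auto simp: A)
  moreover have "norm (partial_deriv b u x) \<le> C * M / T"
    if u: "N_harmonic N u" and T: "0 < T" and x: "norm x + T * (2 * DIM('a)) < 1" and b: "b \<in> Basis"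
      and M: "\<forall>z\<in>cball x T. norm (u z) \<le> M"
    for u :: "'a \<Rightarrow> complex" and x b and T M :: real
  proof -
    \<comment> \<open>Before it can be differentiated, the formula must hold with the same
      \<open>T\<close> at all points near \<open>x\<close>; on \<open>U\<close> every scale up to
      \<open>T\<close> is admissible.\<close>
    define U where "U = ball (0::'a) (1 - T * (2 * DIM('a)))"
    have U: "open U" "convex U" "x \<in> U" using x by (auto simp: U_def)
    have "x \<in> cball x T" using T by simp
    then have M0: "M \<ge> 0" using M norm_ge_zero order_trans by blast
    have inS: "x + t *\<^sub>R y \<in> ball 0 1" if "x \<in> U" "t \<in> {0..T}" "y \<in> cube" for x t y
    proof (rule add_scaleR_cube_in_ball)
      have "t * (2 * DIM('a)) \<le> T * (2 * DIM('a))"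
        using that by (intro mult_right_mono) auto
      moreover have "norm x < 1 - T * (2 * DIM('a))" using that(1) by (simp add: U_def)
      ultimately show "norm x + t * (2 * DIM('a)) < 1" by linarith
    qed (use that in auto)
    have Ti: "T / 2 ^ i > 0" "T / 2 ^ i \<le> T" for i
    proof -
      have "T / 2 ^ i \<le> T / 1" using T by (intro divide_left_mono) auto
      then show "T / 2 ^ i > 0" "T / 2 ^ i \<le> T" using T by auto
    qed
    have inS': "x + (T / 2 ^ i) *\<^sub>R y \<in> ball 0 1" if "x \<in> U" "y \<in> cube" for x y i
      using inS[OF that(1) _ that(2)] Ti[of i] by auto
    have u1: "C_k_on 1 (ball 0 1) u" using u by (rule N_harmonic_C_k_on)
    have cb: "C_k_on 1 UNIV (bump (Suc 1) :: 'a \<Rightarrow> complex)" by (intro C_k_on_bump) auto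
    note cb0 = C_k_on_imp_continuous_on[OF cb]
    have diff: "conv (bump (Suc 1)) (T / 2 ^ i) u differentiable (at x)" for i
      using conv_has_derivative[OF u1 cb0 U(1,2) inS' U(3)] differentiable_def by blast
    have eq: "partial_deriv b (conv (bump (Suc 1)) (T / 2 ^ i) u) x =
        - of_real (2 ^ i / T) * conv (partial_deriv b (bump (Suc 1))) (T / 2 ^ i) u x" for i
    proof -
      have "partial_deriv b (conv (bump (Suc 1)) (T / 2 ^ i) u) x = conv (bump (Suc 1)) (T / 2 ^ i) (partial_deriv b u) x"
        by (rule partial_deriv_conv[OF u1 cb0 U(1,2) inS' U(3) b])
      moreover have "conv (partial_deriv b (bump (Suc 1))) (T / 2 ^ i) u x =
          - of_real (T / 2 ^ i) * conv (bump (Suc 1)) (T / 2 ^ i) (partial_deriv b u) x"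
        by (rule conv_partial_deriv[OF _ u1 cb _ b]) (use inS' U in \<open>auto intro: bump_eq_0\<close>)
      ultimately show ?thesis using T by simp
    qed
    have bound: "norm (conv (partial_deriv b (bump (Suc 1))) (T / 2 ^ i) u x) \<le> 4 * M * A" for i
    proof -
      let ?f = "\<lambda>y. u (x + (T / 2 ^ i) *\<^sub>R y) * partial_deriv b (bump (Suc 1)) y"
      have "continuous_on cube ?f"
        using C_k_on_imp_continuous_on[OF u1] cb b inS' U
        by (intro continuous_on_conv_integrand) auto
      then have "(?f has_integral conv (partial_deriv b (bump (Suc 1))) (T / 2 ^ i) u x) cube"
        unfolding conv_def by (intro integrable_integral integrable_on_cube)
      moreover have "norm (?f y) \<le> 4 * M" for y
      proof (cases "norm y \<le> 1")
        case True
        have "dist x (x + (T / 2 ^ i) *\<^sub>R y) = (T / 2 ^ i) * norm y"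
          using T by (simp add: dist_norm)
        also have "\<dots> \<le> T * 1"
          using Ti[of i] True T by (intro mult_mono) auto
        finally have "norm (u (x + (T / 2 ^ i) *\<^sub>R y)) \<le> M" using M by simp
        moreover have "norm (partial_deriv b (bump (Suc 1)) y) \<le> 4 * (1 * 1)"
        proof -
          have "\<bar>y \<bullet> b\<bar> \<le> 1" using Basis_le_norm[OF b, of y] True by simp
          then have "\<bar>y \<bullet> b\<bar> * norm (bump (Suc 0) y) \<le> 1 * 1"
            using norm_bump_le_1[of "Suc 0" y] by (intro mult_mono) auto
          then show ?thesis
            using partial_deriv_bump[of b 0] by (simp add: norm_mult)
        qed
        ultimately have "norm (u (x + (T / 2 ^ i) *\<^sub>R y)) * norm (partial_deriv b (bump (Suc 1)) y) \<le> M * (4 * (1 * 1))"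
          using M0 by (intro mult_mono) auto
        then show ?thesis by (simp add: norm_mult)
      next
        case False
        then have "bump (Suc 0) y = 0" by (intro bump_eq_0) auto
        then show ?thesis using partial_deriv_bump[of b 0] M0 by simp
      qed
      ultimately show ?thesis
        using has_integral_bound[of "4 * M" ?f _ "- (2 *\<^sub>R One)" "2 *\<^sub>R One"] M0
        by (simp add: cube_def A_def)
    qed
    have "partial_deriv b u x = partial_deriv b (\<lambda>x. \<Sum>i\<le>N. a i * conv (bump (Suc 1)) (T / 2 ^ i) u x) x"
      by (rule partial_deriv_cong[OF U(1,3)]) (use a[OF u] T inS in auto)
    also have "\<dots> = (\<Sum>i\<le>N. a i * partial_deriv b (conv (bump (Suc 1)) (T / 2 ^ i) u) x)"
      using diff by (subst partial_deriv_sum) (auto simp: partial_deriv_cmult)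
    also have "\<dots> = (\<Sum>i\<le>N. a i * (- of_real (2 ^ i / T) * conv (partial_deriv b (bump (Suc 1))) (T / 2 ^ i) u x))"
      unfolding eq ..
    finally have eq2: "partial_deriv b u x =
        (\<Sum>i\<le>N. a i * (- of_real (2 ^ i / T) * conv (partial_deriv b (bump (Suc 1))) (T / 2 ^ i) u x))" .
    have "norm (partial_deriv b u x) \<le>
        (\<Sum>i\<le>N. norm (a i * (- of_real (2 ^ i / T) * conv (partial_deriv b (bump (Suc 1))) (T / 2 ^ i) u x)))"
      unfolding eq2 by (rule norm_sum)
    also have "\<dots> \<le> (\<Sum>i\<le>N. norm (a i) * (2 ^ i / T * (4 * M * A)))"
    proof (rule sum_mono)
      fix i
      have "norm (a i) * (2 ^ i / T * norm (conv (partial_deriv b (bump (Suc 1))) (T / 2 ^ i) u x))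
          \<le> norm (a i) * (2 ^ i / T * (4 * M * A))"
        using T bound by (intro mult_left_mono) auto
      then show "norm (a i * (- of_real (2 ^ i / T) * conv (partial_deriv b (bump (Suc 1))) (T / 2 ^ i) u x))
          \<le> norm (a i) * (2 ^ i / T * (4 * M * A))"
        using T by (simp add: norm_mult norm_divide norm_power)
    qed
    also have "\<dots> = (\<Sum>i\<le>N. norm (a i) * 2 ^ i * 4 * A) * M / T"
      by (simp add: sum_distrib_left sum_distrib_right sum_divide_distrib mult_ac)
    also have "\<dots> \<le> C * M / T"
      using T M0 by (intro divide_right_mono mult_right_mono) (auto simp: C_def)
    finally show ?thesis .
  qed
  ultimately show ?thesis by blast
qed

section \<open>From exponent 1 to exponent \<open>p\<close>\<close>

text \<open>Above \<open>\<eta> * c\<close>, write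
  \<open>a = (a / c) powr (1 - p) * c powr (1 - p) * a powr p\<close>; the first factor is bounded
  by its value at \<open>\<kappa>\<close> if \<open>p \<le> 1\<close> and at \<open>\<eta>\<close>
  otherwise. This trades \<open>a\<close> for \<open>a powr p\<close> plus a small multiple of
  \<open>c\<close> that can be absorbed later.\<close>

lemma le_split_powr:
  fixes p \<eta> \<kappa> :: real
  assumes "\<eta> > 0" "\<kappa> > 0"
  obtains C where "C \<ge> 0" and "\<And>c a. 0 < c \<Longrightarrow> 0 \<le> a \<Longrightarrow> a \<le> \<kappa> * c \<Longrightarrow>
    a \<le> \<eta> * c + C * c powr (1 - p) * a powr p"
proof
  let ?C = "\<eta> powr (1 - p) + \<kappa> powr (1 - p)"
  show "?C \<ge> 0" by simp
  fix c a :: real assume c: "0 < c" and a: "0 \<le> a" "a \<le> \<kappa> * c"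
  show "a \<le> \<eta> * c + ?C * c powr (1 - p) * a powr p"
  proof (cases "a \<le> \<eta> * c")
    case True
    then show ?thesis by (simp add: add_increasing2)
  next
    case False
    then have a0: "a > 0" using assms c by (smt (verit) mult_pos_pos)
    have q: "\<eta> \<le> a / c" "a / c \<le> \<kappa>" using False a c by (auto simp: field_simps)
    have "(a / c) powr (1 - p) \<le> ?C"
    proof (cases "p \<le> 1")
      case True
      then have "(a / c) powr (1 - p) \<le> \<kappa> powr (1 - p)"
        using q a0 c by (intro powr_mono2) auto
      then show ?thesis by (simp add: add_increasing)
    next
      case False
      then have "(a / c) powr (1 - p) \<le> \<eta> powr (1 - p)"
        using q assms by (intro powr_mono2') auto
      then show ?thesis by (simp add: add_increasing2)
    qed
    then have "(a / c) powr (1 - p) * c powr (1 - p) * a powr p \<le> ?C * c powr (1 - p) * a powr p"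
      by (intro mult_right_mono) auto
    moreover have "(a / c) powr (1 - p) * c powr (1 - p) * a powr p = a"
      using a0 c by (simp add: powr_divide powr_add[symmetric])
    moreover have "0 \<le> \<eta> * c" using assms c by simp
    ultimately show ?thesis by linarith
  qed
qed


lemma continuous_on_norm_powr:
  "continuous_on A u \<Longrightarrow> 0 < p \<Longrightarrow> continuous_on A (\<lambda>z. norm (u z) powr p)"
  by (intro continuous_on_powr' continuous_on_norm continuous_on_const) auto

lemma powr_le_imp_le:
  fixes a b p :: real
  assumes "a powr p \<le> b powr p" "0 < p" "0 \<le> b"
  shows "a \<le> b"
proof (rule ccontr)
  assume "\<not> a \<le> b"
  then have "b powr p < a powr p" using assms by (intro powr_less_mono2) auto
  with assms(1) show False by simp
qed

text \<open>Evaluate at a point \<open>y\<^sub>0\<close> maximising \<open>\<lambda>y. (r - dist x y) ^ n * norm (u y) powr p\<close>: near \<open>y\<^sub>0\<close> the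
  function is at most a constant times \<open>norm (u y\<^sub>0)\<close>, so the mean value inequality for \<open>p = 1\<close>
  implies the one for \<open>p\<close>.\<close>

lemma N_harmonic_powr_le_integral:
  fixes p :: real
  assumes p: "p > 0"
  shows "\<exists>C>0. \<forall>(u :: 'a::euclidean_space \<Rightarrow> complex) x (r :: real). N_harmonic N u \<longrightarrow> 0 < r \<longrightarrow>
      norm x + r < 1 \<longrightarrow> (\<forall>y\<in>cball x r.
      ennreal ((r - dist x y) ^ DIM('a) * norm (u y) powr p) \<le>
        ennreal C * (\<integral>\<^sup>+z\<in>cball x r. ennreal (norm (u z) powr p) \<partial>lborel))"
proof -
  obtain C1 where C1: "C1 > 0" and sub: "\<And>(u :: 'a \<Rightarrow> complex) x (T::real). N_harmonic N u \<Longrightarrow> 0 < T \<Longrightarrow>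
      norm x + T * (2 * DIM('a)) < 1 \<Longrightarrow>
      ennreal (norm (u x)) \<le> ennreal (C1 / T ^ DIM('a)) * (\<integral>\<^sup>+z\<in>cball x T. ennreal (norm (u z)) \<partial>lborel)"
    using N_harmonic_le_integral[of N, where ?'a='a] by blast
  define n where "n = DIM('a)"
  have n: "n > 0" by (simp add: n_def)
  define V where "V = unit_ball_vol (real n)"
  have V: "V > 0" by (simp add: V_def)
  \<comment> \<open>\<open>\<kappa> powr p = 2 ^ n\<close> is the loss from halving the distance to
    the boundary of \<open>cball x r\<close>, and \<eta> gives
    \<open>C1 * \<eta> * V = 1 / 2\<close>, small enough for absorption.\<close>
  define \<kappa> where "\<kappa> = 2 powr (real n / p)"
  define \<eta> where "\<eta> = 1 / (2 * C1 * V)"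
  have "\<eta> > 0" "\<kappa> > 0" using C1 V by (auto simp: \<eta>_def \<kappa>_def)
  then obtain C2 where C2: "C2 \<ge> 0" and split: "\<And>c a. 0 < c \<Longrightarrow> 0 \<le> a \<Longrightarrow> a \<le> \<kappa> * c \<Longrightarrow>
    a \<le> \<eta> * c + C2 * c powr (1 - p) * a powr p"
    using le_split_powr[of \<eta> \<kappa> p] by blast
  \<comment> \<open>\<open>(4 * n) ^ n\<close> undoes \<open>s = d / (4 * n)\<close> and the 2 comes
    from absorbing \<open>c / 2\<close>; the summand 1 keeps \<open>C\<close> positive if
    \<open>C2 = 0\<close>.\<close>
  define C where "C = (4 * n) ^ n * (2 * C1 * C2) + 1"
  have C: "C > 0" using C1 C2 by (auto simp: C_def intro!: add_nonneg_pos mult_nonneg_nonneg)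
  have "ennreal ((r - dist x y) ^ n * norm (u y) powr p) \<le>
        ennreal C * (\<integral>\<^sup>+z\<in>cball x r. ennreal (norm (u z) powr p) \<partial>lborel)"
    if u: "N_harmonic N u" and r: "0 < r" and x: "norm x + r < 1" and y: "y \<in> cball x r"
    for u :: "'a \<Rightarrow> complex" and x y and r :: real
  proof -
    define I where "I = (\<integral>\<^sup>+z\<in>cball x r. ennreal (norm (u z) powr p) \<partial>lborel)"
    define \<phi> where "\<phi> y = (r - dist x y) ^ n * norm (u y) powr p" for y
    have in_ball: "z \<in> ball 0 1" if "z \<in> cball x r" for z
      using that x norm_triangle_ineq[of x "z - x"] by (auto simp: dist_norm norm_minus_commute)
    have contu: "continuous_on (ball 0 1) u"
      using u C_k_on_imp_continuous_on unfolding N_harmonic_def by blast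
    have cont: "continuous_on (cball x r) u"
      by (rule continuous_on_subset[OF contu]) (use in_ball in auto)
    have "continuous_on (cball x r) \<phi>"
      unfolding \<phi>_def[abs_def]
      by (intro continuous_on_mult continuous_on_norm_powr[OF cont p] continuous_intros)
    then obtain y0 where y0: "y0 \<in> cball x r" and max: "\<And>y. y \<in> cball x r \<Longrightarrow> \<phi> y \<le> \<phi> y0"
      using continuous_attains_sup[of "cball x r" \<phi>] r by auto
    have "ennreal (\<phi> y0) \<le> ennreal C * I"
    proof (cases "\<phi> y0 \<le> 0 \<or> I = \<infinity>")
      case True
      then show ?thesis using C by (auto simp: ennreal_neg ennreal_mult_top)
    next
      case False
      then obtain J where J: "I = ennreal J" "J \<ge> 0"
        by (cases I) auto
      define c where "c = norm (u y0)"
      define d where "d = r - dist x y0"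
      have "d \<ge> 0" using y0 by (simp add: d_def)
      have \<phi>0: "\<phi> y0 = d ^ n * c powr p" by (simp add: \<phi>_def c_def d_def)
      with False have "d ^ n * c powr p > 0" by simp
      then have "c \<noteq> 0" "d \<noteq> 0" using n by (auto simp: power_0_left)
      then have c: "c > 0" and d: "d > 0"
        using \<open>d \<ge> 0\<close> by (auto simp: c_def)
      \<comment> \<open>\<open>s * (2 * n) = d / 2\<close> leaves the room required by the mean
        value inequality. As \<open>s \<le> d / 2\<close>, points of \<open>cball y0 s\<close> keep
        at least half of the distance \<open>d\<close>, so maximality at \<open>y0\<close> bounds
        \<open>u\<close> there.\<close>
      define s where "s = d / (4 * n)"
      have s: "s > 0" using d n by (simp add: s_def)
      have sd: "s \<le> d / 2"
      proof -
        have "d / (4 * real n) \<le> d / 2" using d n by (intro divide_left_mono) auto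
        then show ?thesis by (simp add: s_def)
      qed
      have in_cball: "z \<in> cball x r" if "z \<in> cball y0 s" for z
        using that sd d dist_triangle[of x z y0] by (simp add: d_def)
      have near: "norm (u z) \<le> \<kappa> * c" if z: "z \<in> cball y0 s" for z
      proof -
        have "d / 2 \<le> r - dist x z"
          using z sd dist_triangle[of x z y0] by (simp add: d_def)
        then have "(d / 2) ^ n * norm (u z) powr p \<le> \<phi> z"
          unfolding \<phi>_def using d by (intro mult_right_mono power_mono) auto
        also have "\<dots> \<le> d ^ n * c powr p"
          using max[OF in_cball[OF z]] \<phi>0 by simp
        finally have "norm (u z) powr p \<le> 2 ^ n * c powr p"
          using d by (simp add: power_divide field_simps)
        also have "\<dots> = (\<kappa> * c) powr p"
          using c p by (simp add: \<kappa>_def powr_mult powr_powr powr_realpow)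
        finally show ?thesis
          by (rule powr_le_imp_le) (use p c in \<open>auto simp: \<kappa>_def\<close>)
      qed
      have cont0: "continuous_on (cball y0 s) u"
        by (rule continuous_on_subset[OF cont]) (use in_cball in auto)
      have [measurable]: "(\<lambda>z. ennreal (norm (u z) powr p) * indicator (cball y0 s) z) \<in> borel_measurable lborel"
        using borel_measurable_ennreal_indicator[OF _ continuous_on_norm_powr[OF cont0 p]] by simp
      have "(\<integral>\<^sup>+z\<in>cball y0 s. ennreal (norm (u z)) \<partial>lborel) \<le>
          (\<integral>\<^sup>+z. ennreal (\<eta> * c) * indicator (cball y0 s) z +
             ennreal (C2 * c powr (1 - p)) * (ennreal (norm (u z) powr p) * indicator (cball y0 s) z) \<partial>lborel)"
      proof (rule nn_integral_mono)
        fix z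
        show "ennreal (norm (u z)) * indicator (cball y0 s) z \<le> ennreal (\<eta> * c) * indicator (cball y0 s) z +
             ennreal (C2 * c powr (1 - p)) * (ennreal (norm (u z) powr p) * indicator (cball y0 s) z)"
        proof (cases "z \<in> cball y0 s")
          case True
          have "ennreal (norm (u z)) \<le> ennreal (\<eta> * c + C2 * c powr (1 - p) * norm (u z) powr p)"
            using split[OF c _ near[OF True]] by (intro ennreal_leI) auto
          also have "\<dots> = ennreal (\<eta> * c) + ennreal (C2 * c powr (1 - p)) * ennreal (norm (u z) powr p)"
            using \<open>\<eta> > 0\<close> c C2 by (simp add: ennreal_plus ennreal_mult)
          finally show ?thesis using True by simp
        qed auto
      qed
      also have "\<dots> = ennreal (\<eta> * c) * emeasure lborel (cball y0 s) +
          ennreal (C2 * c powr (1 - p)) * (\<integral>\<^sup>+z\<in>cball y0 s. ennreal (norm (u z) powr p) \<partial>lborel)"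
      proof -
        have [measurable]: "cball y0 s \<in> sets borel" by simp
        show ?thesis by (simp add: nn_integral_add nn_integral_cmult nn_integral_cmult_indicator)
      qed
      also have "\<dots> \<le> ennreal (\<eta> * c) * ennreal (V * s ^ n) + ennreal (C2 * c powr (1 - p)) * ennreal J"
      proof (intro add_mono mult_left_mono)
        show "emeasure lborel (cball y0 s) \<le> ennreal (V * s ^ n)"
          using s by (simp add: emeasure_cball V_def n_def)
        have "(\<integral>\<^sup>+z\<in>cball y0 s. ennreal (norm (u z) powr p) \<partial>lborel) \<le> I"
          unfolding I_def using in_cball by (intro nn_integral_mono) (auto simp: indicator_def)
        then show "(\<integral>\<^sup>+z\<in>cball y0 s. ennreal (norm (u z) powr p) \<partial>lborel) \<le> ennreal J"
          using J by simp
      qed auto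
      also have "\<dots> = ennreal (\<eta> * c * (V * s ^ n) + C2 * c powr (1 - p) * J)"
        using \<open>\<eta> > 0\<close> c C2 V s J by (simp add: ennreal_plus ennreal_mult)
      finally have "(\<integral>\<^sup>+z\<in>cball y0 s. ennreal (norm (u z)) \<partial>lborel) \<le>
          ennreal (\<eta> * c * (V * s ^ n) + C2 * c powr (1 - p) * J)" .
      moreover have "ennreal c \<le> ennreal (C1 / s ^ n) * (\<integral>\<^sup>+z\<in>cball y0 s. ennreal (norm (u z)) \<partial>lborel)"
        unfolding c_def n_def
      proof (rule sub[OF u s])
        have "s * real (2 * DIM('a)) = d / 2" using n by (simp add: s_def n_def)
        then show "norm y0 + s * real (2 * DIM('a)) < 1"
          using x d norm_triangle_ineq[of x "y0 - x"]
          by (simp add: d_def dist_norm norm_minus_commute)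
      qed
      ultimately have "ennreal c \<le> ennreal (C1 / s ^ n) * ennreal (\<eta> * c * (V * s ^ n) + C2 * c powr (1 - p) * J)"
        by (meson mult_left_mono order_trans zero_le)
      also have "\<dots> = ennreal (C1 / s ^ n * (\<eta> * c * (V * s ^ n) + C2 * c powr (1 - p) * J))"
        using \<open>\<eta> > 0\<close> c C2 V s J C1 by (intro ennreal_mult[symmetric] add_nonneg_nonneg mult_nonneg_nonneg) auto
      finally have "c \<le> C1 / s ^ n * (\<eta> * c * (V * s ^ n) + C2 * c powr (1 - p) * J)"
        using \<open>\<eta> > 0\<close> c C2 V s J C1 by (subst (asm) ennreal_le_iff) auto
      \<comment> \<open>The choice of \<eta> turns the first term into \<open>c / 2\<close>, which
        moves to the left; dividing by \<open>c powr (1 - p)\<close> leaves a bound for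
        \<open>c powr p\<close>.\<close>
      also have "\<dots> = c / 2 + C1 * C2 * J * c powr (1 - p) / s ^ n"
        using C1 V s by (simp add: \<eta>_def field_simps)
      finally have "c * s ^ n \<le> 2 * C1 * C2 * J * c powr (1 - p)"
        using s by (simp add: field_simps)
      moreover have "c = c powr (1 - p) * c powr p"
        using c by (simp add: powr_add[symmetric])
      ultimately have "c powr (1 - p) * (c powr p * s ^ n) \<le> c powr (1 - p) * (2 * C1 * C2 * J)"
        by (simp add: mult_ac)
      then have *: "c powr p * s ^ n \<le> 2 * C1 * C2 * J"
        using c by simp
      have "\<phi> y0 = (4 * n) ^ n * (c powr p * s ^ n)"
        using n \<phi>0 by (simp add: s_def power_divide power_mult_distrib)
      also have "\<dots> \<le> (4 * n) ^ n * (2 * C1 * C2 * J)"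
        using * by (intro mult_left_mono) auto
      also have "\<dots> \<le> C * J"
        using J by (simp add: C_def algebra_simps)
      finally have "ennreal (\<phi> y0) \<le> ennreal (C * J)" by (rule ennreal_leI)
      then show ?thesis using C J by (simp add: ennreal_mult)
    qed
    moreover have "ennreal (\<phi> y) \<le> ennreal (\<phi> y0)" using max[OF y] by (rule ennreal_leI)
    ultimately show ?thesis by (simp add: \<phi>_def I_def)
  qed
  with C show ?thesis unfolding n_def by blast
qed

text \<open>At the scale of the distance \<open>D\<close> to the sphere, \<open>u\<close> is bounded
  on radius \<open>D / 4\<close> by its integral over radius \<open>D / 2\<close>, and the
  Cauchy-type estimate passes to the derivative.\<close>

lemma partial_deriv_powr_le_integral:
  fixes p :: real
  assumes p: "p > 0"
  shows "\<exists>C>0. \<forall>(u :: 'a::euclidean_space \<Rightarrow> complex) x b. N_harmonic N u \<longrightarrow> x \<in> ball 0 1 \<longrightarrow>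
      b \<in> Basis \<longrightarrow>
      ennreal ((1 - norm x) ^ DIM('a) * (1 - norm x) powr p * norm (partial_deriv b u x) powr p) \<le>
        ennreal C * (\<integral>\<^sup>+z\<in>cball x ((1 - norm x) / 2). ennreal (norm (u z) powr p) \<partial>lborel)"
proof -
  obtain C1 where C1: "C1 > 0" and sub: "\<And>(u :: 'a \<Rightarrow> complex) x (r::real) y. N_harmonic N u \<Longrightarrow> 0 < r \<Longrightarrow>
      norm x + r < 1 \<Longrightarrow> y \<in> cball x r \<Longrightarrow>
      ennreal ((r - dist x y) ^ DIM('a) * norm (u y) powr p) \<le>
        ennreal C1 * (\<integral>\<^sup>+z\<in>cball x r. ennreal (norm (u z) powr p) \<partial>lborel)"
    using N_harmonic_powr_le_integral[OF p, of N, where ?'a='a] by blast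
  obtain C2 where C2: "C2 > 0" and deriv: "\<And>(u :: 'a \<Rightarrow> complex) x (T :: real) M b. N_harmonic N u \<Longrightarrow> 0 < T \<Longrightarrow>
      norm x + T * (2 * DIM('a)) < 1 \<Longrightarrow> b \<in> Basis \<Longrightarrow> (\<forall>z\<in>cball x T. norm (u z) \<le> M) \<Longrightarrow>
      norm (partial_deriv b u x) \<le> C2 * M / T"
    using partial_deriv_le_sup[of N, where ?'a='a] by blast
  define n where "n = DIM('a)"
  have n: "n > 0" by (simp add: n_def)
  define C where "C = (C2 * (8 * n)) powr p * (4 ^ n * C1)"
  have C: "C > 0" using C1 C2 n by (simp add: C_def)
  have "ennreal ((1 - norm x) ^ n * (1 - norm x) powr p * norm (partial_deriv b u x) powr p) \<le>
        ennreal C * (\<integral>\<^sup>+z\<in>cball x ((1 - norm x) / 2). ennreal (norm (u z) powr p) \<partial>lborel)"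
    if u: "N_harmonic N u" and x: "x \<in> ball 0 1" and b: "b \<in> Basis"
    for u :: "'a \<Rightarrow> complex" and x b
  proof -
    define D where "D = 1 - norm x"
    have D: "D > 0" using x by (simp add: D_def)
    define I where "I = (\<integral>\<^sup>+z\<in>cball x (D / 2). ennreal (norm (u z) powr p) \<partial>lborel)"
    have "ennreal (D ^ n * D powr p * norm (partial_deriv b u x) powr p) \<le> ennreal C * I"
    proof (cases "I = \<infinity>")
      case True
      then show ?thesis using C by (simp add: ennreal_mult_top)
    next
      case False
      then obtain J where J: "I = ennreal J" "J \<ge> 0"
        by (cases I) auto
      \<comment> \<open>On \<open>cball x (D / 4)\<close> the factor \<open>D / 2 - dist x z\<close>
        is at least \<open>D / 4\<close>, whence \<open>4 ^ n\<close>.\<close>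
      define M where "M = (4 ^ n * C1 * J / D ^ n) powr (1 / p)"
      have Mp: "M powr p = 4 ^ n * C1 * J / D ^ n"
        using p J C1 D by (simp add: M_def powr_powr)
      have bound: "norm (u z) \<le> M" if z: "z \<in> cball x (D / 4)" for z
      proof -
        have "ennreal ((D / 4) ^ n * norm (u z) powr p) \<le> ennreal ((D / 2 - dist x z) ^ n * norm (u z) powr p)"
          using z D by (intro ennreal_leI mult_right_mono power_mono) auto
        also have "\<dots> \<le> ennreal C1 * I"
          unfolding n_def I_def using z D by (intro sub[OF u]) (auto simp: D_def field_simps)
        finally have "ennreal ((D / 4) ^ n * norm (u z) powr p) \<le> ennreal (C1 * J)"
          using C1 J by (simp add: ennreal_mult)
        then have "(D / 4) ^ n * norm (u z) powr p \<le> C1 * J"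
          using C1 J by (subst (asm) ennreal_le_iff) auto
        then have "norm (u z) powr p \<le> M powr p"
          using D unfolding Mp by (simp add: power_divide field_simps)
        then show ?thesis
          by (rule powr_le_imp_le) (use p in \<open>auto simp: M_def\<close>)
      qed
      \<comment> \<open>Gives \<open>T * (2 * n) = D / 4\<close>, so the scaled cube stays in the
        unit ball, and \<open>T \<le> D / 4\<close>, where \<open>M\<close> is a bound.\<close>
      define T where "T = D / (8 * n)"
      have T: "T > 0" using D n by (simp add: T_def)
      have "D / (8 * real n) \<le> D / 4" using D n by (intro divide_left_mono) auto
      then have "T \<le> D / 4" by (simp add: T_def)
      moreover have "T * (2 * real DIM('a)) = D / 4" using n by (simp add: T_def n_def)
      ultimately have "norm (partial_deriv b u x) \<le> C2 * M / T"
        using bound D by (intro deriv[OF u T _ b]) (auto simp: D_def)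
      also have "\<dots> = C2 * (8 * n) * M / D" by (simp add: T_def)
      finally have "D * norm (partial_deriv b u x) \<le> C2 * (8 * n) * M"
        using D by (simp add: field_simps)
      then have "(D * norm (partial_deriv b u x)) powr p \<le> (C2 * (8 * n) * M) powr p"
        using p D by (intro powr_mono2) auto
      then have "D powr p * norm (partial_deriv b u x) powr p \<le> (C2 * (8 * n)) powr p * M powr p"
        using D C2 by (simp add: powr_mult M_def)
      then have "D ^ n * (D powr p * norm (partial_deriv b u x) powr p) \<le> D ^ n * ((C2 * (8 * n)) powr p * M powr p)"
        using D by (intro mult_left_mono) auto
      also have "\<dots> = C * J"
        using D by (simp add: Mp C_def)
      finally have "ennreal (D ^ n * D powr p * norm (partial_deriv b u x) powr p) \<le> ennreal (C * J)"
        by (intro ennreal_leI) (simp add: mult.assoc)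
      then show ?thesis using C J by (simp add: ennreal_mult)
    qed
    then show ?thesis by (simp add: D_def I_def)
  qed
  with C show ?thesis unfolding n_def by blast
qed


subsection \<open>Weighted integrability of derivatives\<close>

text \<open>Separates integrability from polyharmonicity, so that products with \<open>rho\<close>
  or a coordinate can be handled; \<open>1 - norm x\<close> is the distance to the sphere.\<close>

definition weighted_integral :: "real \<Rightarrow> real \<Rightarrow> ('a::euclidean_space \<Rightarrow> complex) \<Rightarrow> ennreal"
  where "weighted_integral p \<alpha> u =
    (\<integral>\<^sup>+x\<in>ball 0 1. ennreal (norm (u x) powr p * (1 - norm x) powr \<alpha>) \<partial>lborel)"

lemma infdist_frontier_ball:
  fixes x :: "'a::euclidean_space"
  assumes "x \<in> ball 0 1"
  shows "infdist x (frontier (ball 0 1)) = 1 - norm x"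
proof (rule antisym)
  \<comment> \<open>The boundary point nearest to \<open>x\<close> is its radial projection; at the
    origin any unit vector serves.\<close>
  obtain e :: 'a where e: "norm e = 1" "x = norm x *\<^sub>R e"
  proof (cases "x = 0")
    case True
    then show ?thesis using that[of "SOME b. b \<in> Basis"] by (simp add: some_in_eq norm_Basis)
  next
    case False
    then show ?thesis using that[of "x /\<^sub>R norm x"] by simp
  qed
  have "dist x e = norm ((1 - norm x) *\<^sub>R e)"
    by (subst e(2)) (simp add: dist_norm norm_minus_commute algebra_simps)
  then have "dist x e = 1 - norm x"
    using e(1) assms by simp
  then show "infdist x (frontier (ball 0 1)) \<le> 1 - norm x"
    using e(1) by (intro infdist_le2[of e]) (auto simp: frontier_ball)
  have "sphere (0::'a) 1 \<noteq> {}" using e(1) by auto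
  then show "1 - norm x \<le> infdist x (frontier (ball 0 1))"
    unfolding frontier_ball[OF zero_less_one] infdist_notempty[OF \<open>sphere 0 1 \<noteq> {}\<close>]
  proof (rule cINF_greatest)
    fix z :: 'a assume "z \<in> sphere 0 1"
    then show "1 - norm x \<le> dist x z"
      using norm_triangle_sub[of z x] by (simp add: dist_norm norm_minus_commute)
  qed
qed

lemma PH_iff: "u \<in> PH N p \<alpha> \<longleftrightarrow> N_harmonic N u \<and> weighted_integral p \<alpha> u < \<infinity>"
proof -
  have "weighted_integral p \<alpha> u = (\<integral>\<^sup>+x\<in>ball 0 1. ennreal (norm (u x) powr p *
      infdist x (frontier (ball 0 1)) powr \<alpha>) \<partial>lborel)"
    unfolding weighted_integral_def
    by (intro nn_integral_cong) (auto simp: indicator_def infdist_frontier_ball simp del: frontier_ball)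
  then show ?thesis by (simp add: PH_def)
qed

text \<open>Comparable distances have comparable weights for either sign of the exponent; the sign
  decides which of the two comparisons is used.\<close>

lemma powr_le_two_powr_abs:
  fixes s t \<beta> :: real
  assumes "0 < t" "s \<le> 2 * t" "t \<le> 2 * s"
  shows "s powr \<beta> \<le> 2 powr \<bar>\<beta>\<bar> * t powr \<beta>"
proof (cases "\<beta> \<ge> 0")
  case True
  then have "s powr \<beta> \<le> (2 * t) powr \<beta>" using assms by (intro powr_mono2) auto
  then show ?thesis using True assms by (simp add: powr_mult)
next
  case False
  then have "s powr \<beta> \<le> (t / 2) powr \<beta>" using assms by (intro powr_mono2') auto
  then show ?thesis using False assms by (simp add: powr_divide powr_minus divide_simps)
qed

text \<open>The pointwise estimate is integrated against the weight and the order of integration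
  exchanged: each \<open>z\<close> is then counted only by points \<open>x\<close> at a comparable
  distance to the sphere.\<close>

lemma weighted_integral_partial_deriv:
  fixes u :: "'a::euclidean_space \<Rightarrow> complex"
  assumes p: "p > 0" and u: "N_harmonic N u" and b: "b \<in> Basis" and fin: "weighted_integral p \<alpha> u < \<infinity>"
  shows "weighted_integral p (\<alpha> + p) (partial_deriv b u) < \<infinity>"
proof -
  obtain C where C: "C > 0" and deriv: "\<And>x. x \<in> ball 0 1 \<Longrightarrow>
      ennreal ((1 - norm x) ^ DIM('a) * (1 - norm x) powr p * norm (partial_deriv b u x) powr p) \<le>
        ennreal C * (\<integral>\<^sup>+z\<in>cball x ((1 - norm x) / 2). ennreal (norm (u z) powr p) \<partial>lborel)"
    using partial_deriv_powr_le_integral[OF p, of N] u b by blast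
  define n where "n = DIM('a)"
  define V where "V = unit_ball_vol (real n)"
  have V: "V > 0" by (simp add: V_def)
  define v where "v z = ennreal (norm (u z) powr p) * indicator (ball 0 1) z" for z :: 'a
  have "continuous_on (ball 0 1) u"
    using u C_k_on_imp_continuous_on unfolding N_harmonic_def by blast
  then have [measurable]: "v \<in> borel_measurable borel"
    unfolding v_def[abs_def] by (intro borel_measurable_ennreal_indicator continuous_on_norm_powr p) auto
  \<comment> \<open>The exponent is \<open>\<alpha> + p\<close> less the powers \<open>n\<close> and
    \<open>p\<close> of the distance on the left of the pointwise estimate.\<close>
  define k :: "'a \<Rightarrow> 'a \<Rightarrow> ennreal" where "k x z = (if norm x < 1 \<and> dist x z \<le> (1 - norm x) / 2
      then ennreal ((1 - norm x) powr (\<alpha> - n)) else 0)" for x z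
  have k_measurable [measurable]: "case_prod k \<in> borel_measurable (borel \<Otimes>\<^sub>M borel)"
    unfolding k_def[abs_def] by measurable
  have 1: "ennreal (norm (partial_deriv b u x) powr p * (1 - norm x) powr (\<alpha> + p)) * indicator (ball 0 1) x
      \<le> ennreal C * (\<integral>\<^sup>+z. k x z * v z \<partial>lborel)" for x
  proof (cases "x \<in> ball 0 1")
    case True
    define D where "D = 1 - norm x"
    have D: "D > 0" using True by (simp add: D_def)
    have "D powr (\<alpha> + p) = D powr (\<alpha> - n) * (D ^ n * D powr p)"
      using D by (simp add: powr_realpow[symmetric] powr_add[symmetric])
    then have "ennreal (norm (partial_deriv b u x) powr p * D powr (\<alpha> + p)) =
        ennreal (D powr (\<alpha> - n)) * ennreal (D ^ n * D powr p * norm (partial_deriv b u x) powr p)"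
      using D by (simp add: ennreal_mult[symmetric] mult_ac)
    also have "\<dots> \<le> ennreal (D powr (\<alpha> - n)) *
        (ennreal C * (\<integral>\<^sup>+z\<in>cball x (D / 2). ennreal (norm (u z) powr p) \<partial>lborel))"
      using deriv[OF True] unfolding D_def n_def by (rule mult_left_mono) simp
    also have "(\<integral>\<^sup>+z\<in>cball x (D / 2). ennreal (norm (u z) powr p) \<partial>lborel) =
        (\<integral>\<^sup>+z. v z * indicator (cball x (D / 2)) z \<partial>lborel)"
    proof (rule nn_integral_cong)
      fix z
      have "z \<in> ball 0 1" if "z \<in> cball x (D / 2)"
        using that D norm_triangle_ineq[of x "z - x"] unfolding D_def
        by (simp add: dist_norm norm_minus_commute field_simps)
      then show "ennreal (norm (u z) powr p) * indicator (cball x (D / 2)) z = v z * indicator (cball x (D / 2)) z"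
        by (auto simp: v_def indicator_def)
    qed
    also have "ennreal (D powr (\<alpha> - n)) * (ennreal C * (\<integral>\<^sup>+z. v z * indicator (cball x (D / 2)) z \<partial>lborel)) =
        ennreal C * (\<integral>\<^sup>+z. ennreal (D powr (\<alpha> - n)) * (v z * indicator (cball x (D / 2)) z) \<partial>lborel)"
    proof -
      have [measurable]: "cball x (D / 2) \<in> sets borel" by simp
      show ?thesis by (subst nn_integral_cmult) (measurable, rule mult.left_commute)
    qed
    also have "(\<integral>\<^sup>+z. ennreal (D powr (\<alpha> - n)) * (v z * indicator (cball x (D / 2)) z) \<partial>lborel) =
        (\<integral>\<^sup>+z. k x z * v z \<partial>lborel)"
      using True by (intro nn_integral_cong) (auto simp: k_def D_def indicator_def)
    finally show ?thesis using True by (simp add: D_def)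
  qed simp
  \<comment> \<open>Where \<open>k x z\<close> is nonzero, \<open>1 - norm x\<close> and
    \<open>1 - norm z\<close> differ at most by a factor 2 and \<open>x\<close> lies in
    \<open>cball z (1 - norm z)\<close>. The volume of that ball cancels the \<open>- n\<close> in
    the exponent.\<close>
  have 2: "(\<integral>\<^sup>+x. k x z \<partial>lborel) \<le> ennreal (2 powr \<bar>\<alpha> - n\<bar> * V * (1 - norm z) powr \<alpha>)" if z: "z \<in> ball 0 1" for z
  proof -
    define E where "E = 1 - norm z"
    have E: "E > 0" using z by (simp add: E_def)
    have "(\<integral>\<^sup>+x. k x z \<partial>lborel) \<le> (\<integral>\<^sup>+x. ennreal (2 powr \<bar>\<alpha> - n\<bar> * E powr (\<alpha> - n)) * indicator (cball z E) x \<partial>lborel)"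
    proof (rule nn_integral_mono)
      fix x
      show "k x z \<le> ennreal (2 powr \<bar>\<alpha> - n\<bar> * E powr (\<alpha> - n)) * indicator (cball z E) x"
      proof (cases "norm x < 1 \<and> dist x z \<le> (1 - norm x) / 2")
        case True
        have "norm z \<le> norm x + dist x z" "norm x \<le> norm z + dist x z"
          using norm_triangle_sub[of z x] norm_triangle_sub[of x z] by (auto simp: dist_norm norm_minus_commute)
        then have "1 - norm x \<le> 2 * E" "E \<le> 2 * (1 - norm x)" "dist z x \<le> E"
          using True by (auto simp: E_def dist_commute field_simps)
        then show ?thesis
          using True E powr_le_two_powr_abs[of E "1 - norm x" "\<alpha> - n"] by (auto simp: k_def intro: ennreal_leI)
      qed (auto simp: k_def)
    qed
    also have "\<dots> = ennreal (2 powr \<bar>\<alpha> - n\<bar> * E powr (\<alpha> - n)) * ennreal (V * E ^ n)"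
      using E by (simp add: nn_integral_cmult_indicator emeasure_cball V_def n_def)
    also have "\<dots> = ennreal (2 powr \<bar>\<alpha> - n\<bar> * V * (E powr (\<alpha> - n) * E powr n))"
      using E V by (simp add: ennreal_mult[symmetric] powr_realpow mult_ac)
    finally show ?thesis by (simp add: E_def powr_add[symmetric])
  qed
  have "weighted_integral p (\<alpha> + p) (partial_deriv b u) \<le> (\<integral>\<^sup>+x. ennreal C * (\<integral>\<^sup>+z. k x z * v z \<partial>lborel) \<partial>lborel)"
    unfolding weighted_integral_def using 1 by (rule nn_integral_mono)
  also have "\<dots> = ennreal C * (\<integral>\<^sup>+x. (\<integral>\<^sup>+z. k x z * v z \<partial>lborel) \<partial>lborel)"
    by (rule nn_integral_cmult) measurable
  also have "(\<integral>\<^sup>+x. (\<integral>\<^sup>+z. k x z * v z \<partial>lborel) \<partial>lborel) = (\<integral>\<^sup>+z. (\<integral>\<^sup>+x. k x z * v z \<partial>lborel) \<partial>lborel)"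
    by (rule lborel_pair.Fubini'[symmetric]) measurable
  also have "\<dots> = (\<integral>\<^sup>+z. (\<integral>\<^sup>+x. k x z \<partial>lborel) * v z \<partial>lborel)"
    by (intro nn_integral_cong nn_integral_multc) measurable
  also have "\<dots> \<le> (\<integral>\<^sup>+z. ennreal (2 powr \<bar>\<alpha> - n\<bar> * V) *
      (ennreal (norm (u z) powr p * (1 - norm z) powr \<alpha>) * indicator (ball 0 1) z) \<partial>lborel)"
  proof (rule nn_integral_mono)
    fix z :: 'a
    show "(\<integral>\<^sup>+x. k x z \<partial>lborel) * v z \<le> ennreal (2 powr \<bar>\<alpha> - n\<bar> * V) *
      (ennreal (norm (u z) powr p * (1 - norm z) powr \<alpha>) * indicator (ball 0 1) z)"
    proof (cases "z \<in> ball 0 1")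
      case True
      have "(\<integral>\<^sup>+x. k x z \<partial>lborel) * v z \<le> ennreal (2 powr \<bar>\<alpha> - n\<bar> * V * (1 - norm z) powr \<alpha>) * v z"
        using 2[OF True] by (rule mult_right_mono) simp
      then show ?thesis using True V by (simp add: v_def ennreal_mult[symmetric] mult_ac)
    qed (simp add: v_def)
  qed
  also have "\<dots> = ennreal (2 powr \<bar>\<alpha> - n\<bar> * V) * weighted_integral p \<alpha> u"
    unfolding weighted_integral_def
  proof (rule nn_integral_cmult)
    have "(\<lambda>x. ennreal (norm (u x) powr p * (1 - norm x) powr \<alpha>) * indicator (ball 0 1) x) =
        (\<lambda>x. v x * ennreal ((1 - norm x) powr \<alpha>))"
      by (auto simp: v_def ennreal_mult indicator_def)
    then show "(\<lambda>x. ennreal (norm (u x) powr p * (1 - norm x) powr \<alpha>) * indicator (ball 0 1) x)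
        \<in> borel_measurable lborel" by simp
  qed
  finally have "weighted_integral p (\<alpha> + p) (partial_deriv b u) \<le>
      ennreal C * (ennreal (2 powr \<bar>\<alpha> - n\<bar> * V) * weighted_integral p \<alpha> u)"
    by (simp add: mult_left_mono)
  also have "\<dots> < \<infinity>"
    using fin by (simp add: ennreal_mult_less_top)
  finally show ?thesis .
qed

subsection \<open>Commutation relations\<close>

text \<open>Spares the operator identities any counting of derivatives.\<close>

definition C_inf_on :: "'a::euclidean_space set \<Rightarrow> ('a \<Rightarrow> complex) \<Rightarrow> bool"
  where "C_inf_on S u \<longleftrightarrow> (\<forall>k. C_k_on k S u)"

lemma C_inf_on_differentiable: "C_inf_on S f \<Longrightarrow> x \<in> S \<Longrightarrow> f differentiable (at x)"
  unfolding C_inf_on_def by (metis C_k_on.simps(2))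

lemma C_inf_on_continuous_on: "C_inf_on S f \<Longrightarrow> continuous_on S f"
  unfolding C_inf_on_def by (metis C_k_on.simps(1))

lemma C_inf_on_partial_deriv: "C_inf_on S f \<Longrightarrow> b \<in> Basis \<Longrightarrow> C_inf_on S (partial_deriv b f)"
  unfolding C_inf_on_def by (metis C_k_on.simps(2))

lemma C_inf_on_const: "C_inf_on S (\<lambda>x. c)"
  by (simp add: C_inf_on_def C_k_on_const)

lemma C_inf_on_coord: "C_inf_on S (\<lambda>x. complex_of_real (x \<bullet> b))"
  by (simp add: C_inf_on_def C_k_on_coord)

lemma C_inf_on_add: "open S \<Longrightarrow> C_inf_on S f \<Longrightarrow> C_inf_on S g \<Longrightarrow> C_inf_on S (\<lambda>x. f x + g x)"
  by (simp add: C_inf_on_def C_k_on_add)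

lemma C_inf_on_mult: "open S \<Longrightarrow> C_inf_on S f \<Longrightarrow> C_inf_on S g \<Longrightarrow> C_inf_on S (\<lambda>x. f x * g x)"
  by (simp add: C_inf_on_def C_k_on_mult)

lemma C_inf_on_cmult: "open S \<Longrightarrow> C_inf_on S f \<Longrightarrow> C_inf_on S (\<lambda>x. c * f x)"
  by (intro C_inf_on_mult C_inf_on_const)

lemma C_inf_on_sum:
  "open S \<Longrightarrow> finite I \<Longrightarrow> (\<And>i. i \<in> I \<Longrightarrow> C_inf_on S (f i)) \<Longrightarrow> C_inf_on S (\<lambda>x. \<Sum>i\<in>I. f i x)"
  by (simp add: C_inf_on_def C_k_on_sum)

lemma C_inf_on_laplacian: "open S \<Longrightarrow> C_inf_on S f \<Longrightarrow> C_inf_on S (laplacian f)"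
  by (simp add: C_inf_on_def C_k_on_laplacian)

lemma C_inf_on_laplacian_pow: "open S \<Longrightarrow> C_inf_on S f \<Longrightarrow> C_inf_on S ((laplacian ^^ k) f)"
  by (induction k) (auto intro: C_inf_on_laplacian)

lemma R_op_eq: "R_op f = (\<lambda>x. \<Sum>b\<in>Basis. complex_of_real (x \<bullet> b) * partial_deriv b f x)"
  by (simp add: R_op_def fun_eq_iff scaleR_conv_of_real)

lemma C_inf_on_R_op: "open S \<Longrightarrow> C_inf_on S f \<Longrightarrow> C_inf_on S (R_op f)"
  unfolding R_op_eq
  by (intro C_inf_on_sum C_inf_on_mult C_inf_on_coord C_inf_on_partial_deriv) auto

text \<open>Complex-valued, so that \<open>M_op\<close> and \<open>L_op\<close> become products to
  which the Leibniz rules apply.\<close>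

definition rho :: "'a::euclidean_space \<Rightarrow> complex"
  where "rho x = complex_of_real (1 - (norm x)\<^sup>2)"

lemma L_op_eq: "L_op \<theta> f = (\<lambda>x. rho x * laplacian f x + complex_of_real (4 * \<theta>) * R_op f x
    + complex_of_real (2 * \<theta> * (real DIM('a) - 2 - 2 * \<theta>)) * f x)"
  for f :: "'a::euclidean_space \<Rightarrow> complex"
  unfolding L_op_def[abs_def] rho_def scaleR_conv_of_real ..

lemma M_op_eq: "M_op j w = (\<lambda>x. rho x ^ j * w x)"
  by (simp add: M_op_def fun_eq_iff scaleR_conv_of_real rho_def)

lemma M_op_Suc: "M_op (Suc j) w = (\<lambda>x. rho x * M_op j w x)"
  by (simp add: M_op_eq fun_eq_iff)

lemma rho_has_derivative:
  "(rho has_derivative (\<lambda>h. complex_of_real (- (2 * (h \<bullet> x))))) (at x)"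
proof -
  have "((\<lambda>y::'a. 1 - (norm y)\<^sup>2) has_derivative (\<lambda>h. - (2 * (h \<bullet> x)))) (at x)"
    unfolding power2_norm_eq_inner by (auto intro!: derivative_eq_intros simp: inner_commute)
  then show ?thesis
    unfolding rho_def[abs_def] by (rule has_derivative_of_real)
qed

lemma partial_deriv_rho: "partial_deriv b rho = (\<lambda>x. - 2 * complex_of_real (x \<bullet> b))"
  by (rule ext, subst partial_deriv_eq[OF rho_has_derivative]) (simp add: inner_commute)

lemma C_inf_on_rho: "C_inf_on S rho"
  unfolding C_inf_on_def
proof
  fix k
  have "C_k_on (Suc k) UNIV rho"
    unfolding C_k_on.simps partial_deriv_rho differentiable_def
    using rho_has_derivative C_k_on_cmult[OF open_UNIV C_k_on_coord] by blast
  then show "C_k_on k S rho"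
    using C_k_on_SucD C_k_on_subset by blast
qed

lemma partial_deriv2_rho: "b \<in> Basis \<Longrightarrow> partial_deriv b (partial_deriv b rho) = (\<lambda>x. - 2)"
  unfolding partial_deriv_rho by (rule ext, subst partial_deriv_cmult) auto

lemma C_inf_on_L_op: "open S \<Longrightarrow> C_inf_on S f \<Longrightarrow> C_inf_on S (L_op \<theta> f)"
  unfolding L_op_eq
  by (intro C_inf_on_add C_inf_on_mult C_inf_on_const C_inf_on_rho C_inf_on_laplacian C_inf_on_R_op)

lemma C_inf_on_M_op: "open S \<Longrightarrow> C_inf_on S f \<Longrightarrow> C_inf_on S (M_op j f)"
proof (induction j)
  case 0
  then show ?case by (simp add: M_op_eq)
next
  case (Suc j)
  then show ?case unfolding M_op_Suc by (intro C_inf_on_mult C_inf_on_rho) auto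
qed

section \<open>Linearity and product rules\<close>

context
  fixes S :: "'a::euclidean_space set"
  assumes S: "open S"
begin

lemma partial_deriv_partial_deriv_add:
  assumes "C_inf_on S f" "C_inf_on S g" "x \<in> S" "b \<in> Basis" "c \<in> Basis"
  shows "partial_deriv c (partial_deriv b (\<lambda>x. f x + g x)) x =
    partial_deriv c (partial_deriv b f) x + partial_deriv c (partial_deriv b g) x"
proof -
  have "partial_deriv c (partial_deriv b (\<lambda>x. f x + g x)) x =
      partial_deriv c (\<lambda>x. partial_deriv b f x + partial_deriv b g x) x"
    using assms by (intro partial_deriv_cong[OF S] partial_deriv_add C_inf_on_differentiable) auto
  also have "\<dots> = partial_deriv c (partial_deriv b f) x + partial_deriv c (partial_deriv b g) x"
    using assms by (intro partial_deriv_add C_inf_on_differentiable C_inf_on_partial_deriv) auto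
  finally show ?thesis .
qed

lemma laplacian_add:
  assumes "C_inf_on S f" "C_inf_on S g" "x \<in> S"
  shows "laplacian (\<lambda>x. f x + g x) x = laplacian f x + laplacian g x"
  using assms by (simp add: laplacian_def partial_deriv_partial_deriv_add sum.distrib)

lemma R_op_add:
  assumes "C_inf_on S f" "C_inf_on S g" "x \<in> S"
  shows "R_op (\<lambda>x. f x + g x) x = R_op f x + R_op g x"
  using assms
  by (simp add: R_op_def partial_deriv_add C_inf_on_differentiable sum.distrib scaleR_add_right)

lemma R_op_mult:
  assumes "C_inf_on S f" "C_inf_on S g" "x \<in> S"
  shows "R_op (\<lambda>x. f x * g x) x = f x * R_op g x + R_op f x * g x"
  using assms
  by (simp add: R_op_eq partial_deriv_mult C_inf_on_differentiable sum.distrib sum_distrib_left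
      sum_distrib_right algebra_simps)

lemma laplacian_mult:
  assumes "C_inf_on S f" "C_inf_on S g" "x \<in> S"
  shows "laplacian (\<lambda>x. f x * g x) x = f x * laplacian g x
    + 2 * (\<Sum>b\<in>Basis. partial_deriv b f x * partial_deriv b g x) + laplacian f x * g x"
proof -
  have "partial_deriv b (partial_deriv b (\<lambda>x. f x * g x)) x = f x * partial_deriv b (partial_deriv b g) x
      + 2 * (partial_deriv b f x * partial_deriv b g x) + partial_deriv b (partial_deriv b f) x * g x"
    if "b \<in> Basis" for b
  proof -
    have "partial_deriv b (partial_deriv b (\<lambda>x. f x * g x)) x =
        partial_deriv b (\<lambda>x. f x * partial_deriv b g x + partial_deriv b f x * g x) x"
      using assms by (intro partial_deriv_cong[OF S] partial_deriv_mult C_inf_on_differentiable) auto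
    also have "\<dots> = partial_deriv b (\<lambda>x. f x * partial_deriv b g x) x + partial_deriv b (\<lambda>x. partial_deriv b f x * g x) x"
      using assms that
      by (intro partial_deriv_add differentiable_mult C_inf_on_differentiable[of S] C_inf_on_partial_deriv) auto
    moreover have "f differentiable (at x)" "g differentiable (at x)"
      "partial_deriv b f differentiable (at x)" "partial_deriv b g differentiable (at x)"
      using assms that by (auto intro!: C_inf_on_differentiable[of S] C_inf_on_partial_deriv)
    ultimately show ?thesis
      by (simp add: partial_deriv_mult)
  qed
  then show ?thesis
    by (simp add: laplacian_def sum.distrib sum_distrib_left sum_distrib_right)
qed

lemma laplacian_cmult: "C_inf_on S f \<Longrightarrow> x \<in> S \<Longrightarrow> laplacian (\<lambda>x. c * f x) x = c * laplacian f x"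
  by (subst laplacian_mult) (auto intro: C_inf_on_const simp: laplacian_def)

lemma R_op_cmult: "C_inf_on S f \<Longrightarrow> x \<in> S \<Longrightarrow> R_op (\<lambda>x. c * f x) x = c * R_op f x"
  by (subst R_op_mult) (auto intro: C_inf_on_const simp: R_op_def)

lemma L_op_add:
  assumes "C_inf_on S f" "C_inf_on S g" "x \<in> S"
  shows "L_op \<theta> (\<lambda>x. f x + g x) x = L_op \<theta> f x + L_op \<theta> g x"
  using assms by (simp add: L_op_eq laplacian_add R_op_add distrib_left)

lemma L_op_cmult: "C_inf_on S f \<Longrightarrow> x \<in> S \<Longrightarrow> L_op \<theta> (\<lambda>x. c * f x) x = c * L_op \<theta> f x"
  by (simp add: L_op_eq laplacian_cmult R_op_cmult distrib_left mult.left_commute)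

lemma L_op_sum:
  assumes "finite I" "\<And>i. i \<in> I \<Longrightarrow> C_inf_on S (f i)" "x \<in> S"
  shows "L_op \<theta> (\<lambda>x. \<Sum>i\<in>I. f i x) x = (\<Sum>i\<in>I. L_op \<theta> (f i) x)"
  using assms(1,2)
proof (induction I)
  case empty
  then show ?case by (simp add: L_op_eq laplacian_def R_op_def)
next
  case (insert i I)
  then show ?case
    using L_op_add[of "f i" "\<lambda>x. \<Sum>i\<in>I. f i x" x \<theta>] assms(3) S by (simp add: C_inf_on_sum)
qed

section \<open>Commutators of derivatives, Euler operator and Laplacian\<close>

lemma partial_deriv_laplacian:
  assumes f: "C_inf_on S f" and x: "x \<in> S" and b: "b \<in> Basis"
  shows "laplacian (partial_deriv b f) x = partial_deriv b (laplacian f) x"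
proof -
  have comm: "partial_deriv c (partial_deriv b g) y = partial_deriv b (partial_deriv c g) y"
    if "C_inf_on S g" "y \<in> S" "c \<in> Basis" for c y g
    using that b by (intro partial_deriv_commute[OF S]) (auto simp: C_inf_on_def)
  have "partial_deriv b (laplacian f) x = (\<Sum>c\<in>Basis. partial_deriv b (partial_deriv c (partial_deriv c f)) x)"
    unfolding laplacian_def using f x
    by (intro partial_deriv_sum) (auto intro!: C_inf_on_differentiable C_inf_on_partial_deriv)
  also have "\<dots> = (\<Sum>c\<in>Basis. partial_deriv c (partial_deriv c (partial_deriv b f)) x)"
  proof (rule sum.cong[OF refl])
    fix c :: 'a assume c: "c \<in> Basis"
    have "partial_deriv b (partial_deriv c (partial_deriv c f)) x = partial_deriv c (partial_deriv b (partial_deriv c f)) x"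
      using comm[OF C_inf_on_partial_deriv[OF f c] x c] by simp
    also have "\<dots> = partial_deriv c (partial_deriv c (partial_deriv b f)) x"
      using comm[OF f _ c] by (intro partial_deriv_cong[OF S x]) simp
    finally show "partial_deriv b (partial_deriv c (partial_deriv c f)) x = \<dots>" .
  qed
  finally show ?thesis by (simp add: laplacian_def)
qed

lemma partial_deriv_laplacian_pow:
  assumes f: "C_inf_on S f" and x: "x \<in> S" and b: "b \<in> Basis"
  shows "(laplacian ^^ k) (partial_deriv b f) x = partial_deriv b ((laplacian ^^ k) f) x"
  using x
proof (induction k arbitrary: x)
  case (Suc k)
  have "(laplacian ^^ Suc k) (partial_deriv b f) x = laplacian (partial_deriv b ((laplacian ^^ k) f)) x"
    unfolding funpow.simps o_apply by (rule laplacian_cong[OF S Suc.prems Suc.IH])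
  also have "\<dots> = partial_deriv b ((laplacian ^^ Suc k) f) x"
    using partial_deriv_laplacian[OF C_inf_on_laplacian_pow[OF S f] Suc.prems b] by simp
  finally show ?case .
qed simp

lemma partial_deriv_R_op:
  assumes f: "C_inf_on S f" and x: "x \<in> S" and c: "c \<in> Basis"
  shows "partial_deriv c (R_op f) x = partial_deriv c f x + R_op (partial_deriv c f) x"
proof -
  have d: "partial_deriv b f differentiable (at x)" if "b \<in> Basis" for b
    using that f x C_inf_on_differentiable C_inf_on_partial_deriv by blast
  have "partial_deriv c (R_op f) x =
      (\<Sum>b\<in>Basis. partial_deriv c (\<lambda>x. complex_of_real (x \<bullet> b) * partial_deriv b f x) x)"
    unfolding R_op_eq using d by (intro partial_deriv_sum) auto
  also have "\<dots> = (\<Sum>b\<in>Basis. complex_of_real (x \<bullet> b) * partial_deriv b (partial_deriv c f) x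
      + (if b = c then partial_deriv b f x else 0))"
  proof (rule sum.cong[OF refl])
    fix b :: 'a assume b: "b \<in> Basis"
    have "partial_deriv c (partial_deriv b f) x = partial_deriv b (partial_deriv c f) x"
      using f x b c by (intro partial_deriv_commute[OF S]) (auto simp: C_inf_on_def)
    then show "partial_deriv c (\<lambda>x. complex_of_real (x \<bullet> b) * partial_deriv b f x) x =
        complex_of_real (x \<bullet> b) * partial_deriv b (partial_deriv c f) x + (if b = c then partial_deriv b f x else 0)"
      using d[OF b] b c by (simp add: partial_deriv_mult inner_Basis)
  qed
  finally show ?thesis
    using c by (simp add: sum.distrib R_op_eq)
qed

text \<open>\<open>R_op\<close> multiplies homogeneous polynomials by their degree, which the
  Laplacian lowers by 2; hence the commutator is twice the Laplacian.\<close>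

lemma laplacian_R_op:
  assumes f: "C_inf_on S f" and x: "x \<in> S"
  shows "laplacian (R_op f) x = R_op (laplacian f) x + 2 * laplacian f x"
proof -
  have "partial_deriv c (partial_deriv c (R_op f)) x =
      2 * partial_deriv c (partial_deriv c f) x + R_op (partial_deriv c (partial_deriv c f)) x"
    if c: "c \<in> Basis" for c
  proof -
    note dc = C_inf_on_partial_deriv[OF f c]
    have "partial_deriv c (partial_deriv c (R_op f)) x = partial_deriv c (\<lambda>x. partial_deriv c f x + R_op (partial_deriv c f) x) x"
      using partial_deriv_R_op[OF f _ c] by (intro partial_deriv_cong[OF S x]) simp
    also have "\<dots> = partial_deriv c (partial_deriv c f) x + partial_deriv c (R_op (partial_deriv c f)) x"
      using x by (intro partial_deriv_add C_inf_on_differentiable[OF dc]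
          C_inf_on_differentiable[OF C_inf_on_R_op[OF S dc]])
    finally show ?thesis using partial_deriv_R_op[OF dc x c] by simp
  qed
  then have "laplacian (R_op f) x = 2 * laplacian f x + (\<Sum>c\<in>Basis. R_op (partial_deriv c (partial_deriv c f)) x)"
    by (simp add: laplacian_def sum.distrib sum_distrib_left)
  also have "(\<Sum>c\<in>Basis. R_op (partial_deriv c (partial_deriv c f)) x) = R_op (laplacian f) x"
  proof -
    have "partial_deriv b (laplacian f) x = (\<Sum>c\<in>Basis. partial_deriv b (partial_deriv c (partial_deriv c f)) x)" for b
      unfolding laplacian_def using f x
      by (intro partial_deriv_sum) (auto intro!: C_inf_on_differentiable C_inf_on_partial_deriv)
    then show ?thesis
      by (simp add: R_op_eq sum_distrib_left) (rule sum.swap)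
  qed
  finally show ?thesis by simp
qed

section \<open>Multiplication by \<open>rho\<close>\<close>

lemma laplacian_rho_mult:
  assumes f: "C_inf_on S f" and x: "x \<in> S"
  shows "laplacian (\<lambda>x. rho x * f x) x =
    rho x * laplacian f x - 4 * R_op f x - 2 * of_nat DIM('a) * f x"
proof -
  have "(\<Sum>b\<in>Basis. partial_deriv b rho x * partial_deriv b f x) = - 2 * R_op f x"
    unfolding partial_deriv_rho R_op_eq sum_distrib_left by (simp add: mult.assoc)
  moreover have "laplacian rho x = - 2 * of_nat DIM('a)"
    by (simp add: laplacian_def partial_deriv2_rho)
  ultimately show ?thesis
    by (subst laplacian_mult[OF C_inf_on_rho f x]) (simp add: algebra_simps)
qed

text \<open>Applied to \<open>rho\<close>, the Euler operator gives
  \<open>- 2 * (norm x)\<^sup>2\<close>, rewritten through \<open>rho\<close> so that only powers of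
  \<open>rho\<close> occur.\<close>

lemma R_op_rho_mult:
  assumes f: "C_inf_on S f" and x: "x \<in> S"
  shows "R_op (\<lambda>x. rho x * f x) x = rho x * R_op f x + (2 * rho x - 2) * f x"
proof -
  have "(\<Sum>b\<in>Basis. (x \<bullet> b) * (x \<bullet> b)) = (norm x)\<^sup>2"
    unfolding power2_norm_eq_inner by (rule euclidean_inner[symmetric])
  then have "R_op rho x = 2 * rho x - 2"
    unfolding R_op_eq partial_deriv_rho rho_def
    by (simp add: sum_negf mult.left_commute[of _ 2] sum_distrib_left[symmetric] flip: of_real_mult of_real_sum)
  then show ?thesis
    by (subst R_op_mult[OF C_inf_on_rho f x]) simp
qed

text \<open>The gradient term in the Laplacian of the product lowers \<open>4 * \<theta>\<close> to
  \<open>4 * (\<theta> - 1)\<close>, and the zeroth-order constant follows suit. The leftover comes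
  from the \<open>- 2\<close> in \<open>R_op_rho_mult\<close>.\<close>

lemma L_op_rho_mult:
  assumes f: "C_inf_on S f" and x: "x \<in> S"
  shows "L_op \<theta> (\<lambda>x. rho x * f x) x = rho x * L_op (\<theta> - 1) f x - complex_of_real (8 * \<theta>) * f x"
  unfolding L_op_eq laplacian_rho_mult[OF f x] R_op_rho_mult[OF f x]
  by (simp add: algebra_simps)

text \<open>The factors \<open>rho\<close> are peeled off one by one with parameter
  \<open>\<theta>\<close>, \<open>\<theta> - 1\<close>, and so on; the leftovers
  \<open>- 8 * (\<theta> - i)\<close> for \<open>i \<le> j\<close> add up to the stated
  coefficient.\<close>

lemma L_op_M_op_Suc:
  assumes f: "C_inf_on S f" and x: "x \<in> S"
  shows "L_op \<theta> (M_op (Suc j) f) x = rho x ^ Suc j * L_op (\<theta> - real (Suc j)) f x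
    + complex_of_real (4 * real (Suc j) * (real j - 2 * \<theta>)) * M_op j f x"
proof (induction j arbitrary: \<theta>)
  case 0
  have "M_op 0 f = f" by (simp add: M_op_eq)
  then show ?case
    unfolding M_op_Suc[of 0] using L_op_rho_mult[OF f x, of \<theta>] by simp
next
  case (Suc j)
  have e: "\<theta> - 1 - real (Suc j) = \<theta> - real (Suc (Suc j))" by simp
  have "L_op \<theta> (M_op (Suc (Suc j)) f) x =
      rho x * L_op (\<theta> - 1) (M_op (Suc j) f) x - complex_of_real (8 * \<theta>) * M_op (Suc j) f x"
    unfolding M_op_Suc[of "Suc j"] by (rule L_op_rho_mult[OF C_inf_on_M_op[OF S f] x])
  moreover have "M_op (Suc j) f x = rho x * M_op j f x" by (simp add: M_op_Suc)
  ultimately show ?case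
    unfolding Suc.IH e by (simp add: algebra_simps)
qed

section \<open>Powers of the Laplacian\<close>

lemma laplacian_pow_add:
  assumes f: "C_inf_on S f" and g: "C_inf_on S g" and x: "x \<in> S"
  shows "(laplacian ^^ k) (\<lambda>x. f x + g x) x = (laplacian ^^ k) f x + (laplacian ^^ k) g x"
  using x
proof (induction k arbitrary: x)
  case (Suc k)
  have "(laplacian ^^ Suc k) (\<lambda>x. f x + g x) x = laplacian (\<lambda>x. (laplacian ^^ k) f x + (laplacian ^^ k) g x) x"
    unfolding funpow.simps o_apply by (rule laplacian_cong[OF S Suc.prems Suc.IH])
  also have "\<dots> = (laplacian ^^ Suc k) f x + (laplacian ^^ Suc k) g x"
    using laplacian_add[OF C_inf_on_laplacian_pow[OF S f] C_inf_on_laplacian_pow[OF S g] Suc.prems] by simp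
  finally show ?case .
qed simp

lemma laplacian_pow_cmult:
  assumes f: "C_inf_on S f" and x: "x \<in> S"
  shows "(laplacian ^^ k) (\<lambda>x. c * f x) x = c * (laplacian ^^ k) f x"
  using x
proof (induction k arbitrary: x)
  case (Suc k)
  have "(laplacian ^^ Suc k) (\<lambda>x. c * f x) x = laplacian (\<lambda>x. c * (laplacian ^^ k) f x) x"
    unfolding funpow.simps o_apply by (rule laplacian_cong[OF S Suc.prems Suc.IH])
  also have "\<dots> = c * (laplacian ^^ Suc k) f x"
    using laplacian_cmult[OF C_inf_on_laplacian_pow[OF S f] Suc.prems] by simp
  finally show ?case .
qed simp

lemma laplacian_pow_R_op:
  assumes f: "C_inf_on S f" and x: "x \<in> S"
  shows "(laplacian ^^ k) (R_op f) x = R_op ((laplacian ^^ k) f) x + of_nat (2 * k) * (laplacian ^^ k) f x"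
  using x
proof (induction k arbitrary: x)
  case (Suc k)
  note s = C_inf_on_laplacian_pow[OF S f, of k]
  have "(laplacian ^^ Suc k) (R_op f) x =
      laplacian (\<lambda>x. R_op ((laplacian ^^ k) f) x + of_nat (2 * k) * (laplacian ^^ k) f x) x"
    unfolding funpow.simps o_apply by (rule laplacian_cong[OF S Suc.prems Suc.IH])
  also have "\<dots> = laplacian (R_op ((laplacian ^^ k) f)) x + laplacian (\<lambda>x. of_nat (2 * k) * (laplacian ^^ k) f x) x"
    by (intro laplacian_add Suc.prems C_inf_on_R_op[OF S s] C_inf_on_cmult[OF S s])
  finally show ?case
    unfolding laplacian_R_op[OF s Suc.prems] laplacian_cmult[OF s Suc.prems]
    by (simp add: algebra_simps)
qed simp

lemma laplacian_pow_rho_mult: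
  assumes f: "C_inf_on S f" and x: "x \<in> S"
  shows "(laplacian ^^ Suc k) (\<lambda>x. rho x * f x) x = rho x * (laplacian ^^ Suc k) f x
    - of_nat (4 * Suc k) * R_op ((laplacian ^^ k) f) x
    - of_nat (4 * Suc k * k + 2 * DIM('a) * Suc k) * (laplacian ^^ k) f x"
  using x
proof (induction k arbitrary: x)
  case 0
  then show ?case using laplacian_rho_mult[OF f] by simp
next
  case (Suc k)
  define g where "g = (laplacian ^^ Suc k) f"
  define h where "h = (laplacian ^^ k) f"
  \<comment> \<open>One more Laplacian replaces \<open>a\<close> by \<open>a - 4\<close> and
    \<open>b\<close> by \<open>2 * a + b - 2 * DIM('a)\<close>, the \<open>2 * a\<close> being the
    commutator with \<open>R_op\<close>; the closed forms solve this recurrence.\<close>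
  define a b where "a = - (of_nat (4 * Suc k) :: complex)"
    and "b = - (of_nat (4 * Suc k * k + 2 * DIM('a) * Suc k) :: complex)"
  have s: "C_inf_on S g" "C_inf_on S h"
    unfolding g_def h_def by (rule C_inf_on_laplacian_pow[OF S f])+
  have lap_h: "laplacian h = g" by (simp add: g_def h_def)
  have "(laplacian ^^ Suc (Suc k)) (\<lambda>x. rho x * f x) x =
      laplacian ((laplacian ^^ Suc k) (\<lambda>x. rho x * f x)) x"
    by simp
  also have "\<dots> = laplacian (\<lambda>x. rho x * g x + (a * R_op h x + b * h x)) x"
    using Suc.IH unfolding g_def h_def a_def b_def
    by (intro laplacian_cong[OF S Suc.prems]) (simp add: algebra_simps)
  also have "\<dots> = laplacian (\<lambda>x. rho x * g x) x + laplacian (\<lambda>x. a * R_op h x + b * h x) x"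
    by (intro laplacian_add Suc.prems C_inf_on_add C_inf_on_mult C_inf_on_const C_inf_on_rho C_inf_on_R_op S s)
  also have "laplacian (\<lambda>x. a * R_op h x + b * h x) x = laplacian (\<lambda>x. a * R_op h x) x + laplacian (\<lambda>x. b * h x) x"
    by (intro laplacian_add Suc.prems C_inf_on_cmult C_inf_on_R_op S s)
  also have "\<dots> = a * (R_op g x + 2 * g x) + b * g x"
    using laplacian_cmult[OF C_inf_on_R_op[OF S s(2)] Suc.prems] laplacian_cmult[OF s(2) Suc.prems]
      laplacian_R_op[OF s(2) Suc.prems] lap_h by simp
  also have "laplacian (\<lambda>x. rho x * g x) x = rho x * laplacian g x - 4 * R_op g x - 2 * of_nat DIM('a) * g x"
    by (rule laplacian_rho_mult[OF s(1) Suc.prems])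
  finally have eq: "(laplacian ^^ Suc (Suc k)) (\<lambda>x. rho x * f x) x =
     rho x * laplacian g x + (a - 4) * R_op g x + (2 * a + b - 2 * of_nat DIM('a)) * g x"
    by (simp add: algebra_simps)
  have "a - 4 = - of_nat (4 * Suc (Suc k))"
    by (simp add: a_def)
  moreover have "2 * a + b - 2 * of_nat DIM('a) =
      - of_nat (4 * Suc (Suc k) * Suc k + 2 * DIM('a) * Suc (Suc k))"
    by (simp add: a_def b_def algebra_simps)
  moreover have "laplacian g = (laplacian ^^ Suc (Suc k)) f" by (simp add: g_def)
  ultimately show ?case
    unfolding eq g_def[symmetric] by (simp only: diff_conv_add_uminus minus_mult_left)
qed

end

subsection \<open>Operators on polyharmonic functions\<close>

text \<open>Trades the finite smoothness of the definition for smoothness of all orders, which opens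
  the way for the commutation rules.\<close>

lemma N_harmonic_iff:
  "N_harmonic N u \<longleftrightarrow> C_inf_on (ball 0 1) u \<and> (\<forall>x\<in>ball 0 1. (laplacian ^^ N) u x = 0)"
  using N_harmonic_C_k_on unfolding N_harmonic_def C_inf_on_def by blast

lemma laplacian_zero: "laplacian (\<lambda>x. 0) = (\<lambda>x. 0)"
  by (simp add: laplacian_def fun_eq_iff)

lemma laplacian_pow_eq_0:
  assumes "open S" "\<And>x. x \<in> S \<Longrightarrow> f x = 0" "x \<in> S"
  shows "(laplacian ^^ k) f x = 0"
proof -
  have "(laplacian ^^ k) f x = (laplacian ^^ k) (\<lambda>x. 0) x"
    by (rule laplacian_pow_cong[OF assms(1,3)]) (rule assms(2))
  also have "(laplacian ^^ k) (\<lambda>x::'a. 0) = (\<lambda>x. 0)"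
    by (induction k) (auto simp: laplacian_zero)
  finally show ?thesis .
qed

lemma R_op_eq_0:
  assumes "open S" "\<And>x. x \<in> S \<Longrightarrow> f x = 0" "x \<in> S"
  shows "R_op f x = 0"
  using R_op_cong[OF assms(1,3), of f "\<lambda>x. 0"] assms(2) by (simp add: R_op_def)

lemma N_harmonic_add: "N_harmonic N f \<Longrightarrow> N_harmonic N g \<Longrightarrow> N_harmonic N (\<lambda>x. f x + g x)"
  by (auto simp: N_harmonic_iff laplacian_pow_add[OF open_ball] intro: C_inf_on_add)

lemma N_harmonic_cmult: "N_harmonic N f \<Longrightarrow> N_harmonic N (\<lambda>x. c * f x)"
  by (auto simp: N_harmonic_iff laplacian_pow_cmult[OF open_ball] intro: C_inf_on_cmult)

text \<open>Rests on smoothness: \<open>2 * N\<close> derivatives of \<open>f\<close> alone would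
  not yield as many for \<open>partial_deriv b f\<close>.\<close>

lemma N_harmonic_partial_deriv:
  assumes f: "N_harmonic N f" and b: "b \<in> Basis"
  shows "N_harmonic N (partial_deriv b f)"
proof -
  have "partial_deriv b ((laplacian ^^ N) f) x = 0" if "x \<in> ball 0 1" for x
    using partial_deriv_cong[OF open_ball that, of "(laplacian ^^ N) f" "\<lambda>x. 0" b] f
    by (simp add: N_harmonic_iff)
  then show ?thesis
    using f b by (auto simp: N_harmonic_iff partial_deriv_laplacian_pow[OF open_ball] intro: C_inf_on_partial_deriv)
qed

text \<open>Every term of \<open>laplacian_pow_rho_mult\<close> contains the \<open>N\<close>-th
  Laplacian of \<open>f\<close> or derivatives of it.\<close>

lemma N_harmonic_rho_mult:
  assumes f: "N_harmonic N f"
  shows "N_harmonic (Suc N) (\<lambda>x. rho x * f x)"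
proof -
  have s: "C_inf_on (ball 0 1) f" and z: "\<And>x. x \<in> ball 0 1 \<Longrightarrow> (laplacian ^^ N) f x = 0"
    using f by (auto simp: N_harmonic_iff)
  have "(laplacian ^^ Suc N) (\<lambda>x. rho x * f x) x = 0" if x: "x \<in> ball 0 1" for x
    unfolding laplacian_pow_rho_mult[OF open_ball s x]
    using z[OF x] R_op_eq_0[OF open_ball z x] laplacian_pow_eq_0[OF open_ball z x, where k=1] by simp
  then show ?thesis
    using s by (auto simp: N_harmonic_iff intro: C_inf_on_mult C_inf_on_rho)
qed

text \<open>The \<open>N\<close>-th Laplacian of \<open>rho\<close> times \<open>laplacian u\<close>
  contains \<open>- 4 * N\<close> times \<open>R_op\<close> of the \<open>N\<close>-th Laplacian of
  \<open>u\<close>, cancelled by \<open>4 * \<theta>\<close> times the same term for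
  \<open>\<theta> = N\<close>. The top-order term vanishes as \<open>u\<close> is
  \<open>Suc N\<close>-harmonic.\<close>

lemma N_harmonic_L_op:
  fixes u :: "'a::euclidean_space \<Rightarrow> complex"
  assumes u: "N_harmonic (Suc N) u"
  shows "N_harmonic N (L_op (real N) u)"
proof -
  define c where "c = complex_of_real (2 * real N * (real DIM('a) - 2 - 2 * real N))"
  have s: "C_inf_on (ball 0 1) u" and z: "\<And>x. x \<in> ball 0 1 \<Longrightarrow> (laplacian ^^ Suc N) u x = 0"
    using u by (auto simp: N_harmonic_iff)
  note sl = C_inf_on_laplacian[OF open_ball s]
  have "(laplacian ^^ N) (L_op (real N) u) x = 0" if x: "x \<in> ball 0 1" for x
  proof -
    have "(laplacian ^^ N) (L_op (real N) u) x =
        (laplacian ^^ N) (\<lambda>x. rho x * laplacian u x + complex_of_real (4 * real N) * R_op u x) x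
        + (laplacian ^^ N) (\<lambda>x. c * u x) x"
      unfolding L_op_eq c_def
      by (intro laplacian_pow_add[OF open_ball _ _ x] C_inf_on_add C_inf_on_mult C_inf_on_const C_inf_on_rho
          C_inf_on_R_op sl s open_ball)
    also have "(laplacian ^^ N) (\<lambda>x. rho x * laplacian u x + complex_of_real (4 * real N) * R_op u x) x =
        (laplacian ^^ N) (\<lambda>x. rho x * laplacian u x) x + (laplacian ^^ N) (\<lambda>x. complex_of_real (4 * real N) * R_op u x) x"
      by (intro laplacian_pow_add[OF open_ball _ _ x] C_inf_on_mult C_inf_on_const C_inf_on_rho
          C_inf_on_R_op sl s open_ball)
    also have "(laplacian ^^ N) (\<lambda>x. complex_of_real (4 * real N) * R_op u x) x =
        of_nat (4 * N) * (R_op ((laplacian ^^ N) u) x + of_nat (2 * N) * (laplacian ^^ N) u x)"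
      unfolding laplacian_pow_cmult[OF open_ball C_inf_on_R_op[OF open_ball s] x]
        laplacian_pow_R_op[OF open_ball s x] by simp
    also have "(laplacian ^^ N) (\<lambda>x. c * u x) x = c * (laplacian ^^ N) u x"
      by (rule laplacian_pow_cmult[OF open_ball s x])
    finally have eq: "(laplacian ^^ N) (L_op (real N) u) x = (laplacian ^^ N) (\<lambda>x. rho x * laplacian u x) x
        + of_nat (4 * N) * (R_op ((laplacian ^^ N) u) x + of_nat (2 * N) * (laplacian ^^ N) u x)
        + c * (laplacian ^^ N) u x" .
    show ?thesis
    proof (cases N)
      \<comment> \<open>\<open>laplacian_pow_rho_mult\<close> starts at the first power; here
        \<open>L_op 0\<close> is \<open>rho\<close> times the Laplacian and \<open>u\<close> is
        harmonic.\<close>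
      case 0
      then show ?thesis using eq z[OF x] by (simp add: c_def)
    next
      case (Suc K)
      have e: "(laplacian ^^ k) (laplacian u) = (laplacian ^^ Suc k) u" for k
        by (simp add: funpow_swap1)
      have "(laplacian ^^ N) (\<lambda>x. rho x * laplacian u x) x =
          - of_nat (4 * N) * R_op ((laplacian ^^ N) u) x
          - of_nat (4 * N * K + 2 * DIM('a) * N) * (laplacian ^^ N) u x"
        unfolding Suc laplacian_pow_rho_mult[OF open_ball sl x] e z[OF x, unfolded Suc]
        by (simp only: mult_zero_right diff_0 minus_mult_left)
      \<comment> \<open>Zeroth-order balance, with \<open>n\<close> the dimension:
        \<open>8 N^2 + 2 N (n - 2 - 2 N) = 4 N (N - 1) + 2 n N\<close>.\<close>
      moreover have "of_nat (4 * N) * of_nat (2 * N) + c - of_nat (4 * N * K + 2 * DIM('a) * N) = 0"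
        unfolding c_def Suc by (simp add: algebra_simps)
      moreover have "(- A * R - D * L) + A * (R + B * L) + c * L = 0" if "A * B + c - D = 0" for A B D R L
        using that by algebra
      ultimately show ?thesis
        unfolding eq by presburger
    qed
  qed
  then show ?thesis
    using C_inf_on_L_op[OF open_ball s] by (simp add: N_harmonic_iff)
qed

subsection \<open>Operators on weighted spaces\<close>

lemma borel_measurable_weighted:
  fixes f :: "'a::euclidean_space \<Rightarrow> complex"
  assumes "p > 0" "continuous_on (ball 0 1) f"
  shows "(\<lambda>x. ennreal (norm (f x) powr p * (1 - norm x) powr \<alpha>) * indicator (ball 0 1) x)
    \<in> borel_measurable lborel"
proof -
  have "continuous_on (ball 0 1) (\<lambda>x::'a. (1 - norm x) powr \<alpha>)"
    by (intro continuous_on_powr continuous_intros) auto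
  then have "continuous_on (ball 0 1) (\<lambda>x. norm (f x) powr p * (1 - norm x) powr \<alpha>)"
    using assms by (intro continuous_on_mult continuous_on_norm_powr)
  from borel_measurable_ennreal_indicator[OF _ this] show ?thesis by simp
qed

lemma weighted_integral_finite_le:
  fixes f g :: "'a::euclidean_space \<Rightarrow> complex"
  assumes p: "p > 0" and f: "continuous_on (ball 0 1) f" and K: "K \<ge> 0"
    and le: "\<And>x. x \<in> ball 0 1 \<Longrightarrow> norm (g x) powr p * (1 - norm x) powr \<beta>
        \<le> K * (norm (f x) powr p * (1 - norm x) powr \<alpha>)"
    and fin: "weighted_integral p \<alpha> f < \<infinity>"
  shows "weighted_integral p \<beta> g < \<infinity>"
proof -
  have "weighted_integral p \<beta> g \<le> (\<integral>\<^sup>+x. ennreal K *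
      (ennreal (norm (f x) powr p * (1 - norm x) powr \<alpha>) * indicator (ball 0 1) x) \<partial>lborel)"
    unfolding weighted_integral_def
  proof (rule nn_integral_mono)
    fix x :: 'a
    show "ennreal (norm (g x) powr p * (1 - norm x) powr \<beta>) * indicator (ball 0 1) x \<le>
        ennreal K * (ennreal (norm (f x) powr p * (1 - norm x) powr \<alpha>) * indicator (ball 0 1) x)"
      using ennreal_leI[OF le] K by (auto simp: indicator_def ennreal_mult')
  qed
  also have "\<dots> = ennreal K * weighted_integral p \<alpha> f"
    unfolding weighted_integral_def
    using borel_measurable_weighted[OF p f] by (rule nn_integral_cmult)
  also have "\<dots> < \<infinity>"
    using fin by (simp add: ennreal_mult_less_top)
  finally show ?thesis .
qed

lemma weighted_integral_add:
  fixes f g :: "'a::euclidean_space \<Rightarrow> complex"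
  assumes p: "p > 0" and f: "continuous_on (ball 0 1) f" and g: "continuous_on (ball 0 1) g"
    and fin: "weighted_integral p \<alpha> f < \<infinity>" "weighted_integral p \<alpha> g < \<infinity>"
  shows "weighted_integral p \<alpha> (\<lambda>x. f x + g x) < \<infinity>"
proof -
  \<comment> \<open>A quasi-triangle inequality valid for every \<open>p > 0\<close>, bounding the
    sum by twice the larger term.\<close>
  have pw: "norm (a + b) powr p \<le> 2 powr p * (norm a powr p + norm b powr p)" for a b :: complex
  proof -
    have "norm (a + b) powr p \<le> (2 * max (norm a) (norm b)) powr p"
      using norm_triangle_ineq[of a b] p by (intro powr_mono2) auto
    also have "\<dots> = 2 powr p * max (norm a) (norm b) powr p"
      by (simp add: powr_mult)
    also have "max (norm a) (norm b) powr p \<le> norm a powr p + norm b powr p"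
      by (simp add: max_def)
    finally show ?thesis by (simp add: mult_left_mono)
  qed
  have "weighted_integral p \<alpha> (\<lambda>x. f x + g x) \<le> (\<integral>\<^sup>+x. ennreal (2 powr p) *
      (ennreal (norm (f x) powr p * (1 - norm x) powr \<alpha>) * indicator (ball 0 1) x +
       ennreal (norm (g x) powr p * (1 - norm x) powr \<alpha>) * indicator (ball 0 1) x) \<partial>lborel)"
    unfolding weighted_integral_def
  proof (rule nn_integral_mono)
    fix x :: 'a
    have "norm (f x + g x) powr p * (1 - norm x) powr \<alpha> \<le>
        2 powr p * (norm (f x) powr p * (1 - norm x) powr \<alpha> + norm (g x) powr p * (1 - norm x) powr \<alpha>)"
      using mult_right_mono[OF pw[of "f x" "g x"], of "(1 - norm x) powr \<alpha>"]
      by (simp add: algebra_simps)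
    then have "ennreal (norm (f x + g x) powr p * (1 - norm x) powr \<alpha>) \<le> ennreal (2 powr p) *
        (ennreal (norm (f x) powr p * (1 - norm x) powr \<alpha>) + ennreal (norm (g x) powr p * (1 - norm x) powr \<alpha>))"
      by (subst ennreal_plus[symmetric], simp, simp, subst ennreal_mult[symmetric]) (auto intro: ennreal_leI)
    then show "ennreal (norm (f x + g x) powr p * (1 - norm x) powr \<alpha>) * indicator (ball 0 1) x \<le> ennreal (2 powr p) *
      (ennreal (norm (f x) powr p * (1 - norm x) powr \<alpha>) * indicator (ball 0 1) x +
       ennreal (norm (g x) powr p * (1 - norm x) powr \<alpha>) * indicator (ball 0 1) x)"
      by (auto simp: indicator_def)
  qed
  also have "\<dots> = ennreal (2 powr p) * (weighted_integral p \<alpha> f + weighted_integral p \<alpha> g)"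
    unfolding weighted_integral_def using borel_measurable_weighted[OF p f] borel_measurable_weighted[OF p g]
    by (subst nn_integral_cmult, measurable, subst nn_integral_add) auto
  also have "\<dots> < \<infinity>"
    using fin by (simp add: ennreal_mult_less_top)
  finally show ?thesis .
qed

lemma N_harmonic_continuous_on: "N_harmonic N u \<Longrightarrow> continuous_on (ball 0 1) u"
  using C_inf_on_continuous_on N_harmonic_iff by blast

lemma PH_add: "0 < p \<Longrightarrow> f \<in> PH N p \<alpha> \<Longrightarrow> g \<in> PH N p \<alpha> \<Longrightarrow> (\<lambda>x. f x + g x) \<in> PH N p \<alpha>"
  using weighted_integral_add[OF _ N_harmonic_continuous_on N_harmonic_continuous_on] N_harmonic_add
  unfolding PH_iff by blast

lemma PH_cmult:
  assumes "0 < p" "f \<in> PH N p \<alpha>"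
  shows "(\<lambda>x. c * f x) \<in> PH N p \<alpha>"
  using assms weighted_integral_finite_le[OF assms(1) N_harmonic_continuous_on, of N f "norm c powr p" "\<lambda>x. c * f x" \<alpha> \<alpha>]
  by (auto simp: PH_iff norm_mult powr_mult mult.assoc intro: N_harmonic_cmult)

lemma PH_sum:
  fixes f :: "'i \<Rightarrow> 'a::euclidean_space \<Rightarrow> complex"
  assumes "0 < p" "finite I" "\<And>i. i \<in> I \<Longrightarrow> f i \<in> PH N p \<alpha>"
  shows "(\<lambda>x. \<Sum>i\<in>I. f i x) \<in> PH N p \<alpha>"
  using assms(2,3)
proof (induction I)
  case empty
  have "N_harmonic N (\<lambda>x::'a. 0)"
    using laplacian_pow_eq_0[OF open_ball, of 0 1 "\<lambda>x::'a. 0"] by (simp add: N_harmonic_iff C_inf_on_const)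
  moreover have "weighted_integral p \<alpha> (\<lambda>x::'a. 0) = 0"
    using assms(1) by (simp add: weighted_integral_def)
  ultimately show ?case by (simp add: PH_iff)
next
  case (insert i I)
  then show ?case using PH_add[OF assms(1), of "f i" N \<alpha> "\<lambda>x. \<Sum>i\<in>I. f i x"] by simp
qed

lemma norm_rho:
  assumes "x \<in> ball 0 1"
  shows "norm (rho x) \<le> 2 * (1 - norm x)" "norm (rho x) \<le> 1"
proof -
  have x: "0 \<le> norm x" "norm x < 1" using assms by auto
  have "0 \<le> (norm x)\<^sup>2" "(norm x)\<^sup>2 \<le> 1" using x by (auto simp: power_le_one)
  then have *: "norm (rho x) = 1 - (norm x)\<^sup>2"
    unfolding rho_def norm_of_real by simp
  also have "\<dots> = (1 - norm x) * (1 + norm x)"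
    by (simp add: power2_eq_square algebra_simps)
  also have "\<dots> \<le> (1 - norm x) * 2" using x by (intro mult_left_mono) auto
  finally show "norm (rho x) \<le> 2 * (1 - norm x)" by simp
  show "norm (rho x) \<le> 1" unfolding * by simp
qed

lemma weighted_integral_rho_mult:
  assumes p: "0 < p" and f: "continuous_on (ball 0 1) f" and fin: "weighted_integral p (\<alpha> + p) f < \<infinity>"
  shows "weighted_integral p \<alpha> (\<lambda>x. rho x * f x) < \<infinity>"
proof (rule weighted_integral_finite_le[OF p f _ _ fin])
  fix x :: 'a assume x: "x \<in> ball 0 1"
  have "norm (rho x) powr p \<le> (2 * (1 - norm x)) powr p"
    using norm_rho(1)[OF x] p by (intro powr_mono2) auto
  also have "\<dots> = 2 powr p * (1 - norm x) powr p" using x by (simp only: powr_mult)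
  finally have "norm (rho x) powr p * (norm (f x) powr p * (1 - norm x) powr \<alpha>) \<le>
      2 powr p * (1 - norm x) powr p * (norm (f x) powr p * (1 - norm x) powr \<alpha>)"
    by (rule mult_right_mono) simp
  then show "norm (rho x * f x) powr p * (1 - norm x) powr \<alpha> \<le>
      2 powr p * (norm (f x) powr p * (1 - norm x) powr (\<alpha> + p))"
    using x by (simp add: norm_mult powr_mult powr_add mult_ac)
qed simp

lemma weighted_integral_le_one_mult:
  assumes p: "0 < p" and f: "continuous_on (ball 0 1) f" and fin: "weighted_integral p \<alpha> f < \<infinity>"
    and a: "\<And>x. x \<in> ball 0 1 \<Longrightarrow> norm (a x) \<le> 1" and "\<alpha> \<le> \<beta>"
  shows "weighted_integral p \<beta> (\<lambda>x. a x * f x) < \<infinity>"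
proof (rule weighted_integral_finite_le[OF p f _ _ fin])
  fix x :: 'a assume x: "x \<in> ball 0 1"
  have "norm (a x * f x) powr p \<le> norm (f x) powr p"
    using p mult_right_mono[OF a[OF x], of "norm (f x)"] by (intro powr_mono2) (auto simp: norm_mult)
  moreover have "(1 - norm x) powr \<beta> \<le> (1 - norm x) powr \<alpha>"
    using x \<open>\<alpha> \<le> \<beta>\<close> by (intro powr_mono') auto
  ultimately show "norm (a x * f x) powr p * (1 - norm x) powr \<beta> \<le>
      1 * (norm (f x) powr p * (1 - norm x) powr \<alpha>)"
    by (simp add: mult_mono)
qed simp

text \<open>Second derivatives have exponent \<open>\<alpha> + 2 * p\<close>, of which
  \<open>rho\<close> takes back \<open>p\<close>. The Euler term has \<open>\<alpha> + p\<close>,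
  coordinates being bounded by 1, and \<open>u\<close> itself may be given the larger exponent since
  the distance is at most 1.\<close>

lemma PH_L_op:
  fixes u :: "'a::euclidean_space \<Rightarrow> complex"
  assumes p: "0 < p" and u: "u \<in> PH (Suc N) p \<alpha>"
  shows "L_op (real N) u \<in> PH N p (\<alpha> + p)"
proof -
  have h: "N_harmonic (Suc N) u" and fin: "weighted_integral p \<alpha> u < \<infinity>"
    using u by (auto simp: PH_iff)
  have d: "partial_deriv b u \<in> PH (Suc N) p (\<alpha> + p)" if "b \<in> Basis" for b
    using N_harmonic_partial_deriv[OF h that] weighted_integral_partial_deriv[OF p h that fin] by (simp add: PH_iff)
  have dd: "partial_deriv b (partial_deriv b u) \<in> PH (Suc N) p (\<alpha> + p + p)" if "b \<in> Basis" for b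
    using d[OF that] N_harmonic_partial_deriv[OF _ that] weighted_integral_partial_deriv[OF p _ that]
    unfolding PH_iff by blast
  have "laplacian u \<in> PH (Suc N) p (\<alpha> + p + p)"
    unfolding laplacian_def[abs_def] using dd by (intro PH_sum p) auto
  then have lap: "continuous_on (ball 0 1) (laplacian u)" "weighted_integral p (\<alpha> + p + p) (laplacian u) < \<infinity>"
    by (auto simp: PH_iff intro: N_harmonic_continuous_on)
  have coord: "continuous_on (ball 0 1) (\<lambda>x. complex_of_real (x \<bullet> b) * partial_deriv b u x)"
    "weighted_integral p (\<alpha> + p) (\<lambda>x. complex_of_real (x \<bullet> b) * partial_deriv b u x) < \<infinity>"
    if b: "b \<in> Basis" for b
  proof -
    have "continuous_on (ball 0 1) (partial_deriv b u)"
      using d[OF b] by (auto simp: PH_iff intro: N_harmonic_continuous_on)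
    moreover have "norm (complex_of_real (x \<bullet> b)) \<le> 1" if "x \<in> ball 0 1" for x
      using Basis_le_norm[OF b, of x] that by simp
    ultimately show "continuous_on (ball 0 1) (\<lambda>x. complex_of_real (x \<bullet> b) * partial_deriv b u x)"
      "weighted_integral p (\<alpha> + p) (\<lambda>x. complex_of_real (x \<bullet> b) * partial_deriv b u x) < \<infinity>"
      using d[OF b] weighted_integral_le_one_mult[OF p _ _ _ order_refl,
          of "partial_deriv b u" "\<alpha> + p" "\<lambda>x. complex_of_real (x \<bullet> b)"]
      by (auto intro!: continuous_intros simp: PH_iff)
  qed
  \<comment> \<open>Products with coordinates are tracked by continuity and weighted integral only,
    so the sum is built over subsets of \<open>Basis\<close> instead of by
    \<open>PH_sum\<close>.\<close>
  have sums: "continuous_on (ball 0 1) (\<lambda>x. \<Sum>b\<in>B. complex_of_real (x \<bullet> b) * partial_deriv b u x) \<and>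
      weighted_integral p (\<alpha> + p) (\<lambda>x. \<Sum>b\<in>B. complex_of_real (x \<bullet> b) * partial_deriv b u x) < \<infinity>"
    if "B \<subseteq> Basis" for B
    using finite_subset[OF that finite_Basis] that
  proof (induction B)
    case empty
    then show ?case using p by (simp add: weighted_integral_def)
  next
    case (insert b B)
    then show ?case
      using weighted_integral_add[OF p coord(1)[of b], of "\<lambda>x. \<Sum>b\<in>B. complex_of_real (x \<bullet> b) * partial_deriv b u x"]
        coord[of b] by (auto intro: continuous_on_add)
  qed
  have cu: "continuous_on (ball 0 1) u" using h by (rule N_harmonic_continuous_on)
  have const: "weighted_integral p \<beta> (\<lambda>x. c * f x) < \<infinity>"
    if "continuous_on (ball 0 1) f" "weighted_integral p \<beta> f < \<infinity>" for c \<beta> and f :: "'a \<Rightarrow> complex"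
    by (rule weighted_integral_finite_le[OF p that(1) _ _ that(2), of "norm c powr p"])
      (auto simp: norm_mult powr_mult)
  have R: "continuous_on (ball 0 1) (R_op u)" "weighted_integral p (\<alpha> + p) (R_op u) < \<infinity>"
    using sums[of Basis] by (auto simp: R_op_eq)
  have u': "weighted_integral p (\<alpha> + p) u < \<infinity>"
    using weighted_integral_le_one_mult[OF p cu fin, of "\<lambda>_. 1" "\<alpha> + p"] p by simp
  have rho: "continuous_on (ball 0 1) (rho :: 'a \<Rightarrow> complex)"
    using C_inf_on_rho by (rule C_inf_on_continuous_on)
  have "weighted_integral p (\<alpha> + p) (L_op (real N) u) < \<infinity>"
    unfolding L_op_eq
    by (intro weighted_integral_add[OF p] const weighted_integral_rho_mult[OF p] continuous_on_add
        continuous_on_mult continuous_on_const rho lap R u' cu)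
  then show ?thesis
    using N_harmonic_L_op[OF h] by (simp add: PH_iff)
qed

subsection \<open>The cellular decomposition\<close>

text \<open>Stated for smooth families so that the induction closes: after
  \<open>L_op (real N)\<close> the family \<open>c j * d (Suc j)\<close> satisfies the same
  hypotheses with one term fewer.\<close>

lemma decomposition_zero:
  fixes d :: "nat \<Rightarrow> 'a::euclidean_space \<Rightarrow> complex"
  assumes "\<And>j. j < N \<Longrightarrow> C_inf_on (ball 0 1) (d j)"
    and "\<And>j x. j < N \<Longrightarrow> x \<in> ball 0 1 \<Longrightarrow> L_op (real N - real j - 1) (d j) x = 0"
    and "\<And>x. x \<in> ball 0 1 \<Longrightarrow> (\<Sum>j<N. M_op j (d j) x) = 0"
    and "j < N" "x \<in> ball 0 1"
  shows "d j x = 0"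
  using assms
proof (induction N arbitrary: d j x)
  case 0
  then show ?case by simp
next
  case (Suc N)
  define c where "c j = complex_of_real (4 * real (Suc j) * (real j - 2 * real N))" for j
  \<comment> \<open>The coefficient could vanish only at \<open>j = 2 * N\<close>, outside the range
    of the index.\<close>
  have c: "c j \<noteq> 0" if "j < N" for j
  proof -
    have "real j - 2 * real N \<noteq> 0" using that by linarith
    then show ?thesis by (simp add: c_def del: of_nat_Suc of_real_mult)
  qed
  have sm: "C_inf_on (ball 0 1) (M_op j (d j))" if "j < Suc N" for j
    using Suc.prems(1)[OF that] by (rule C_inf_on_M_op[OF open_ball])
  have sum0: "(\<Sum>j<N. M_op j (\<lambda>x. c j * d (Suc j) x) x) = 0" if x: "x \<in> ball 0 1" for x
  proof -
    have "0 = L_op (real N) (\<lambda>x. \<Sum>j<Suc N. M_op j (d j) x) x"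
      using L_op_cong[OF open_ball x, of "\<lambda>x. \<Sum>j<Suc N. M_op j (d j) x" "\<lambda>x. 0" "real N"] Suc.prems(3)
      by (simp add: L_op_eq R_op_def laplacian_def)
    also have "\<dots> = (\<Sum>j<Suc N. L_op (real N) (M_op j (d j)) x)"
      using sm by (intro L_op_sum[OF open_ball _ _ x]) auto
    also have "\<dots> = L_op (real N) (d 0) x + (\<Sum>j<N. L_op (real N) (M_op (Suc j) (d (Suc j))) x)"
      by (subst sum.lessThan_Suc_shift) (simp add: M_op_eq)
    also have "L_op (real N) (d 0) x = 0"
      using Suc.prems(2)[of 0 x] x by simp
    also have "(\<Sum>j<N. L_op (real N) (M_op (Suc j) (d (Suc j))) x) = (\<Sum>j<N. M_op j (\<lambda>x. c j * d (Suc j) x) x)"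
    proof (rule sum.cong[OF refl])
      fix j assume j: "j \<in> {..<N}"
      \<comment> \<open>The index \<open>real (Suc N) - real (Suc j) - 1\<close> in the equation for
        \<open>d (Suc j)\<close> is exactly the shifted parameter in \<open>L_op_M_op_Suc\<close>,
        so only the lower power of \<open>rho\<close> survives.\<close>
      have "L_op (real N - real (Suc j)) (d (Suc j)) x = 0"
        using Suc.prems(2)[of "Suc j" x] j x by (simp add: algebra_simps)
      then show "L_op (real N) (M_op (Suc j) (d (Suc j))) x = M_op j (\<lambda>x. c j * d (Suc j) x) x"
        using j by (subst L_op_M_op_Suc[OF open_ball Suc.prems(1) x]) (auto simp: c_def M_op_eq)
    qed
    finally show ?thesis by simp
  qed
  have IH: "c j * d (Suc j) x = 0" if "j < N" "x \<in> ball 0 1" for j x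
  proof (rule Suc.IH[of "\<lambda>j x. c j * d (Suc j) x", OF _ _ sum0 that])
    show "C_inf_on (ball 0 1) (\<lambda>x. c j * d (Suc j) x)" if "j < N" for j
      using Suc.prems(1)[of "Suc j"] that by (intro C_inf_on_cmult) auto
    show "L_op (real N - real j - 1) (\<lambda>x. c j * d (Suc j) x) x = 0" if "j < N" "x \<in> ball 0 1" for j x
      using Suc.prems(1,2)[of "Suc j"] that
      by (subst L_op_cmult[OF open_ball _ that(2)]) (auto simp: algebra_simps)
  qed
  then have pos: "d (Suc j) x = 0" if "j < N" "x \<in> ball 0 1" for j x
    using that c by fastforce
  show ?case
  proof (cases j)
    case 0
    \<comment> \<open>The operator annihilates \<open>d 0\<close>, which is therefore read off from
      the sum once all other terms are known to vanish.\<close>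
    have "(\<Sum>j<Suc N. M_op j (d j) x) = d 0 x + (\<Sum>j<N. M_op (Suc j) (d (Suc j)) x)"
      by (subst sum.lessThan_Suc_shift) (simp add: M_op_eq)
    then show ?thesis
      using 0 Suc.prems(3)[OF Suc.prems(5)] pos Suc.prems(5) by (simp add: M_op_eq)
  next
    case (Suc i)
    then show ?thesis using pos Suc.prems by simp
  qed
qed

text \<open>\<alpha> varies in the induction: the hypothesis is applied to
  \<open>L_op (real N) u\<close> at exponent \<open>\<alpha> + p\<close>, and one more factor
  \<open>rho\<close> brings its terms back to \<alpha>. The remainder stays in the space because
  sums do.\<close>

lemma cellular_decomposition_exists:
  fixes u :: "'a::euclidean_space \<Rightarrow> complex"
  assumes p: "0 < p" and u: "u \<in> PH N p \<alpha>"
  shows "\<exists>w. cellular_decomposition N p \<alpha> u w"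
  using u
proof (induction N arbitrary: u \<alpha>)
  case 0
  then show ?case
    by (intro exI[of _ "\<lambda>_ _. 0"]) (simp add: cellular_decomposition_def PH_iff N_harmonic_iff)
next
  case (Suc N)
  obtain v where v: "cellular_decomposition N p (\<alpha> + p) (L_op (real N) u) v"
    using Suc.IH[OF PH_L_op[OF p Suc.prems]] by blast
  have v_sum: "\<And>x. x \<in> ball 0 1 \<Longrightarrow> L_op (real N) u x = (\<Sum>j<N. M_op j (v j) x)"
    and v_PH: "\<And>j. j < N \<Longrightarrow> M_op j (v j) \<in> PH N p (\<alpha> + p)"
    and v_harm: "\<And>j. j < N \<Longrightarrow> N_harmonic (N - j) (v j)"
    and v_L: "\<And>j x. j < N \<Longrightarrow> x \<in> ball 0 1 \<Longrightarrow> L_op (real N - real j - 1) (v j) x = 0"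
    using v by (auto simp: cellular_decomposition_def)
  have v_smooth: "C_inf_on (ball 0 1) (v j)" if "j < N" for j
    using v_harm[OF that] by (simp add: N_harmonic_iff)
  define c where "c j = complex_of_real (4 * real (Suc j) * (real j - 2 * real N))" for j
  have c: "c j \<noteq> 0" if "j < N" for j
  proof -
    have "real j - 2 * real N \<noteq> 0" using that by linarith
    then show ?thesis by (simp add: c_def del: of_nat_Suc of_real_mult)
  qed
  \<comment> \<open>Dividing by \<open>c j\<close> makes \<open>L_op (real N)\<close> send
    \<open>M_op (Suc j) (z j)\<close> to \<open>M_op j (v j)\<close>.\<close>
  define z where "z j = (\<lambda>x. inverse (c j) * v j x)" for j
  have z_smooth: "C_inf_on (ball 0 1) (z j)" if "j < N" for j
    unfolding z_def using v_smooth[OF that] by (intro C_inf_on_cmult) auto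
  have z_L: "L_op (real N - real (Suc j)) (z j) x = 0" if "j < N" "x \<in> ball 0 1" for j x
    unfolding z_def using v_L[OF that] v_smooth[OF that(1)]
    by (subst L_op_cmult[OF open_ball _ that(2)]) (auto simp: algebra_simps)
  have z_harm: "N_harmonic (N - j) (z j)" if "j < N" for j
    unfolding z_def using v_harm[OF that] by (rule N_harmonic_cmult)
  have z_PH: "M_op (Suc j) (z j) \<in> PH (Suc N) p \<alpha>" if j: "j < N" for j
  proof -
    have "(\<lambda>x. rho x * M_op j (v j) x) \<in> PH (Suc N) p \<alpha>"
      using v_PH[OF j] weighted_integral_rho_mult[OF p N_harmonic_continuous_on]
      by (auto simp: PH_iff intro: N_harmonic_rho_mult)
    from PH_cmult[OF p this, of "inverse (c j)"] show ?thesis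
      by (simp add: M_op_eq z_def mult_ac)
  qed
  \<comment> \<open>The rest of \<open>u\<close> after removing the terms of positive index;
    subtraction appears as \<open>- 1 *\<close> to match the rules for scalar multiples.\<close>
  define w0 where "w0 = (\<lambda>x. u x + (\<Sum>j<N. - 1 * M_op (Suc j) (z j) x))"
  define w where "w j = (case j of 0 \<Rightarrow> w0 | Suc i \<Rightarrow> z i)" for j
  have w0_PH: "w0 \<in> PH (Suc N) p \<alpha>"
    unfolding w0_def using z_PH by (intro PH_add PH_sum PH_cmult p Suc.prems) auto
  have w0_L: "L_op (real N) w0 x = 0" if x: "x \<in> ball 0 1" for x
  proof -
    have su: "C_inf_on (ball 0 1) u" using Suc.prems by (simp add: PH_iff N_harmonic_iff)
    have sz: "C_inf_on (ball 0 1) (M_op (Suc j) (z j))" if "j < N" for j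
      using z_smooth[OF that] by (rule C_inf_on_M_op[OF open_ball])
    have "L_op (real N) w0 x = L_op (real N) u x + L_op (real N) (\<lambda>x. \<Sum>j<N. - 1 * M_op (Suc j) (z j) x) x"
      unfolding w0_def using sz
      by (intro L_op_add[OF open_ball _ _ x] su C_inf_on_sum C_inf_on_cmult) auto
    also have "L_op (real N) (\<lambda>x. \<Sum>j<N. - 1 * M_op (Suc j) (z j) x) x =
        (\<Sum>j<N. L_op (real N) (\<lambda>x. - 1 * M_op (Suc j) (z j) x) x)"
      using sz by (intro L_op_sum[OF open_ball _ _ x] C_inf_on_cmult) auto
    also have "\<dots> = (\<Sum>j<N. - M_op j (v j) x)"
    proof (rule sum.cong[OF refl])
      fix j assume "j \<in> {..<N}"
      then have j: "j < N" by simp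
      have "L_op (real N) (\<lambda>x. - 1 * M_op (Suc j) (z j) x) x = - 1 * L_op (real N) (M_op (Suc j) (z j)) x"
        by (rule L_op_cmult[OF open_ball sz[OF j] x])
      also have "\<dots> = - 1 * (c j * M_op j (z j) x)"
        unfolding L_op_M_op_Suc[OF open_ball z_smooth[OF j] x] z_L[OF j x] c_def by simp
      also have "\<dots> = - M_op j (v j) x"
        using c[OF j] by (simp add: M_op_eq z_def)
      finally show "L_op (real N) (\<lambda>x. - 1 * M_op (Suc j) (z j) x) x = - M_op j (v j) x" .
    qed
    finally show ?thesis using v_sum[OF x] by (simp add: sum_negf)
  qed
  have "cellular_decomposition (Suc N) p \<alpha> u w"
    unfolding cellular_decomposition_def
  proof (intro conjI allI impI ballI)
    show "u x = (\<Sum>j<Suc N. M_op j (w j) x)" for x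
      by (subst sum.lessThan_Suc_shift) (simp add: w_def w0_def M_op_eq sum_negf)
    fix j assume j: "j < Suc N"
    show "M_op j (w j) \<in> PH (Suc N) p \<alpha>"
      using w0_PH z_PH j by (cases j) (auto simp: w_def M_op_eq)
    show "N_harmonic (Suc N - j) (w j)"
      using w0_PH z_harm j by (cases j) (auto simp: w_def PH_iff)
    show "L_op (real (Suc N) - real j - 1) (w j) x = 0" if "x \<in> ball 0 1" for x
    proof (cases j)
      case 0
      then show ?thesis using w0_L[OF that] by (simp add: w_def)
    next
      case (Suc i)
      have "real (Suc N) - real (Suc i) - 1 = real N - real (Suc i)" by simp
      then show ?thesis using z_L[of i x] that j by (simp only: Suc w_def nat.case)
    qed
  qed
  then show ?case by blast
qed

lemma cellular_decomposition_unique: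
  assumes v: "cellular_decomposition N p \<alpha> u v" and w: "cellular_decomposition N p \<alpha> u w"
    and j: "j < N" and x: "x \<in> ball 0 1"
  shows "v j x = w j x"
proof -
  define d where "d j = (\<lambda>x. v j x + - 1 * w j x)" for j
  have smooth: "C_inf_on (ball 0 1) (v j)" "C_inf_on (ball 0 1) (w j)" if "j < N" for j
    using v w that by (auto simp: cellular_decomposition_def N_harmonic_iff)
  have "d j x = 0"
  proof (rule decomposition_zero[OF _ _ _ j x])
    show "C_inf_on (ball 0 1) (d j)" if "j < N" for j
      unfolding d_def using smooth[OF that] by (intro C_inf_on_add C_inf_on_cmult) auto
    show "L_op (real N - real j - 1) (d j) x = 0" if "j < N" "x \<in> ball 0 1" for j x
    proof -
      have "L_op (real N - real j - 1) (d j) x =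
          L_op (real N - real j - 1) (v j) x + - 1 * L_op (real N - real j - 1) (w j) x"
        unfolding d_def L_op_cmult[OF open_ball smooth(2)[OF that(1)] that(2), symmetric]
        by (intro L_op_add[OF open_ball _ _ that(2)] smooth[OF that(1)] C_inf_on_cmult[OF open_ball])
      then show ?thesis using v w that by (simp add: cellular_decomposition_def)
    qed
    show "(\<Sum>j<N. M_op j (d j) x) = 0" if "x \<in> ball 0 1" for x
    proof -
      have "(\<Sum>j<N. M_op j (d j) x) = (\<Sum>j<N. M_op j (v j) x) - (\<Sum>j<N. M_op j (w j) x)"
        by (simp add: M_op_eq d_def algebra_simps sum_subtractf)
      then show ?thesis using v w that by (simp add: cellular_decomposition_def)
    qed
  qed
  then show ?thesis by (simp add: d_def)
qed

text \<open>Components are total functions with arbitrary values off the ball, so uniqueness means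
  agreement on the ball.\<close>

theorem theorem1p4:
  fixes u :: "real ^ 'n \<Rightarrow> complex" and p \<alpha> :: real and N :: nat
  assumes "CARD('n) \<ge> 2" and "0 < p" and "N \<ge> 1"
    and "u \<in> PH N p \<alpha>"
  shows "\<exists>w. cellular_decomposition N p \<alpha> u w \<and>
    (\<forall>v. cellular_decomposition N p \<alpha> u v \<longrightarrow>
      (\<forall>j<N. \<forall>x\<in>ball 0 1. v j x = w j x))"
  using cellular_decomposition_exists[OF assms(2,4)] cellular_decomposition_unique by blast

end
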